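(* Let $d\geq 3$ be an integer, let $\Omega\subset\mathbb{R}^d$ be a bounded $C^2$ domain, and let $\nu$ denote the outward unit normal vector field on $\partial\Omega$. Then $$\int_{\partial\Omega}\int_{\partial\Omega}\frac{|\nu(x)-\nu(y)|^2}{|x-y|^{d-1}}\,d\sigma(x)\,d\sigma(y)\;\geq\;\sigma(\partial\Omega)\int_{\mathbb{S}^{d-1}}|x-e|^{3-d}\,d\sigma(x),$$ where $\mathbb{S}^{d-1}$ is the unit sphere of $\mathbb{R}^d$ and $e\in\mathbb{S}^{d-1}$ is any fixed unit vector. Equality is attained if and only if $\Omega$ is a ball.
   Context: $\sigma$ denotes the surface measure, i.e. the $(d-1)$-dimensional Hausdorff measure restricted to the hypersurface under consideration ($\partial\Omega$ or the unit sphere $\mathbb{S}^{d-1}$). *)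

theory Defs
  imports "HOL-Analysis.Analysis"
begin

section \<open>Hausdorff measure\<close>

text \<open>
  The constant makes the \<open>n\<close>-dimensional Hausdorff measure on an \<open>n\<close>-dimensional Euclidean
  space agree with Lebesgue measure. The empty set is treated separately because
  \<open>0 ^ 0 = 1\<close>.
\<close>

definition hausdorff_weight :: "nat \<Rightarrow> 'a::metric_space set \<Rightarrow> ennreal" where
  "hausdorff_weight n C =
     (if C = {} then 0 else ennreal (unit_ball_vol (real n) * (diameter C / 2) ^ n))"

text \<open>Boundedness is demanded explicitly, as \<^const>\<open>diameter\<close> is unspecified on unbounded sets.\<close>

definition hausdorff_covers :: "real \<Rightarrow> 'a::metric_space set \<Rightarrow> (nat \<Rightarrow> 'a set) set" where
  "hausdorff_covers \<delta> A =
     {C. A \<subseteq> (\<Union>i. C i) \<and> (\<forall>i. bounded (C i) \<and> diameter (C i) \<le> \<delta>)}"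

definition hausdorff_content :: "nat \<Rightarrow> real \<Rightarrow> 'a::metric_space set \<Rightarrow> ennreal" where
  "hausdorff_content n \<delta> A = (INF C\<in>hausdorff_covers \<delta> A. \<Sum>i. hausdorff_weight n (C i))"

definition hausdorff_outer :: "nat \<Rightarrow> 'a::metric_space set \<Rightarrow> ennreal" where
  "hausdorff_outer n A = (SUP \<delta>\<in>{0<..}. hausdorff_content n \<delta> A)"

definition hausdorff_measure :: "nat \<Rightarrow> 'a::metric_space measure" where
  "hausdorff_measure n = measure_of UNIV (sets borel) (hausdorff_outer n)"

text \<open>
  The constant \<^const>\<open>measure_of\<close> yields the null measure when its argument is not countably
  additive. The following lemmas show that this does not happen here: Hausdorff outer measure
  is a metric outer measure, so all Borel sets are Caratheodory measurable.
\<close>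

lemma hausdorff_weight_empty [simp]: "hausdorff_weight n {} = 0"
  by (simp add: hausdorff_weight_def)

lemma hausdorff_content_antimono:
  assumes "\<delta> \<le> \<epsilon>"
  shows "hausdorff_content n \<epsilon> A \<le> hausdorff_content n \<delta> A"
  unfolding hausdorff_content_def
  by (rule INF_superset_mono) (use assms in \<open>auto simp: hausdorff_covers_def intro: order_trans\<close>)

lemma hausdorff_content_mono:
  assumes "A \<subseteq> B"
  shows "hausdorff_content n \<delta> A \<le> hausdorff_content n \<delta> B"
  unfolding hausdorff_content_def
  by (rule INF_superset_mono) (use assms in \<open>auto simp: hausdorff_covers_def\<close>)

lemma hausdorff_content_le_outer:
  "0 < \<delta> \<Longrightarrow> hausdorff_content n \<delta> A \<le> hausdorff_outer n A"
  unfolding hausdorff_outer_def by (rule SUP_upper) auto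

lemma hausdorff_outer_mono: "A \<subseteq> B \<Longrightarrow> hausdorff_outer n A \<le> hausdorff_outer n B"
  unfolding hausdorff_outer_def by (rule SUP_mono') (rule hausdorff_content_mono)

lemma hausdorff_outer_empty [simp]: "hausdorff_outer n {} = 0"
proof -
  have "hausdorff_content n \<delta> ({} :: 'a set) \<le> 0" if "\<delta> > 0" for \<delta>
  proof -
    have "(\<lambda>_. {}) \<in> hausdorff_covers \<delta> ({} :: 'a set)"
      using that by (simp add: hausdorff_covers_def)
    then have "hausdorff_content n \<delta> ({} :: 'a set)
                 \<le> (\<Sum>i::nat. hausdorff_weight n ((\<lambda>_. {} :: 'a set) i))"
      unfolding hausdorff_content_def by (rule INF_lower)
    then show ?thesis by simp
  qed
  then have "hausdorff_outer n ({} :: 'a set) \<le> 0"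
    unfolding hausdorff_outer_def by (intro SUP_least) auto
  then show ?thesis by simp
qed

lemma hausdorff_content_UN_le:
  fixes A :: "nat \<Rightarrow> 'a::metric_space set"
  shows "hausdorff_content n \<delta> (\<Union>i. A i) \<le> (\<Sum>i. hausdorff_content n \<delta> (A i))"
proof (rule ennreal_le_epsilon)
  fix e :: real
  assume fin: "(\<Sum>i. hausdorff_content n \<delta> (A i)) < top" and e: "0 < e"
  have fin_i: "hausdorff_content n \<delta> (A i) < top" for i
    using ennreal_suminf_lessD[OF fin] .
  have "\<exists>C\<in>hausdorff_covers \<delta> (A i). (\<Sum>j. hausdorff_weight n (C j))
          < hausdorff_content n \<delta> (A i) + ennreal (e * (1/2) ^ Suc i)" for i
  proof -
    have "hausdorff_content n \<delta> (A i)
            < hausdorff_content n \<delta> (A i) + ennreal (e * (1/2) ^ Suc i)"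
      using fin_i[of i] e by (simp add: ennreal_add_left_cancel_less[where b = 0, simplified] less_top)
    then show ?thesis
      unfolding hausdorff_content_def[of n \<delta> "A i"] by (simp add: INF_less_iff)
  qed
  then obtain C where C: "\<And>i. C i \<in> hausdorff_covers \<delta> (A i)"
    and less: "\<And>i. (\<Sum>j. hausdorff_weight n (C i j))
          < hausdorff_content n \<delta> (A i) + ennreal (e * (1/2) ^ Suc i)"
    by metis
  define D where "D k = (case prod_decode k of (i, j) \<Rightarrow> C i j)" for k
  have "(\<Union>i. A i) \<subseteq> (\<Union>k. D k)"
  proof
    fix x assume "x \<in> (\<Union>i. A i)"
    then obtain i where "x \<in> A i" by auto
    then obtain j where "x \<in> C i j"
      using C[of i] by (auto simp: hausdorff_covers_def)
    then have "x \<in> D (prod_encode (i, j))" by (simp add: D_def)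
    then show "x \<in> (\<Union>k. D k)" by blast
  qed
  moreover have "bounded (D k) \<and> diameter (D k) \<le> \<delta>" for k
    using C by (auto simp: D_def hausdorff_covers_def split: prod.split)
  ultimately have "D \<in> hausdorff_covers \<delta> (\<Union>i. A i)"
    by (simp add: hausdorff_covers_def)
  then have "hausdorff_content n \<delta> (\<Union>i. A i) \<le> (\<Sum>k. hausdorff_weight n (D k))"
    unfolding hausdorff_content_def by (rule INF_lower)
  also have "\<dots> = (\<Sum>i. \<Sum>j. hausdorff_weight n (C i j))"
  proof -
    have "(\<lambda>k. hausdorff_weight n (D k)) = (\<lambda>(i, j). hausdorff_weight n (C i j)) \<circ> prod_decode"
      by (auto simp: D_def fun_eq_iff split: prod.split)
    then have "(\<Sum>k. hausdorff_weight n (D k))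
        = (\<Sum>k. (\<lambda>(i, j). hausdorff_weight n (C i j)) (prod_decode k))"
      by (simp add: o_def)
    also have "\<dots> = (\<Sum>i. \<Sum>j. hausdorff_weight n (C i j))"
      by (rule suminf_ennreal_2dimen) simp
    finally show ?thesis .
  qed
  also have "\<dots> \<le> (\<Sum>i. hausdorff_content n \<delta> (A i) + ennreal (e * (1/2) ^ Suc i))"
    by (intro suminf_le less_imp_le less) auto
  also have "\<dots> = (\<Sum>i. hausdorff_content n \<delta> (A i)) + (\<Sum>i. ennreal (e * (1/2) ^ Suc i))"
    by (rule suminf_add[symmetric]) auto
  also have "(\<Sum>i. ennreal (e * (1/2) ^ Suc i)) = ennreal e"
    using e by (intro suminf_ennreal_eq) (use sums_mult[OF power_half_series, of e] in auto)
  finally show "hausdorff_content n \<delta> (\<Union>i. A i) \<le> (\<Sum>i. hausdorff_content n \<delta> (A i)) + ennreal e" .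
qed

lemma hausdorff_outer_UN_le:
  fixes A :: "nat \<Rightarrow> 'a::metric_space set"
  shows "hausdorff_outer n (\<Union>i. A i) \<le> (\<Sum>i. hausdorff_outer n (A i))"
  unfolding hausdorff_outer_def[of n "\<Union>i. A i"]
proof (rule SUP_least)
  fix \<delta> :: real assume "\<delta> \<in> {0<..}"
  then have "(\<Sum>i. hausdorff_content n \<delta> (A i)) \<le> (\<Sum>i. hausdorff_outer n (A i))"
    by (intro suminf_le hausdorff_content_le_outer) auto
  with hausdorff_content_UN_le[of n \<delta> A]
  show "hausdorff_content n \<delta> (\<Union>i. A i) \<le> (\<Sum>i. hausdorff_outer n (A i))"
    by (rule order_trans)
qed

lemma hausdorff_outer_measure_space: "outer_measure_space (Pow UNIV) (hausdorff_outer n)"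
  by (simp add: outer_measure_space_def positive_def increasing_def countably_subadditive_def
      hausdorff_outer_mono hausdorff_outer_UN_le)

lemma hausdorff_outer_Un_le:
  "hausdorff_outer n (A \<union> B) \<le> hausdorff_outer n A + hausdorff_outer n B"
proof -
  have "hausdorff_outer n (\<Union>i. binaryset A B i) \<le> (\<Sum>i. hausdorff_outer n (binaryset A B i))"
    by (rule hausdorff_outer_UN_le)
  also have "\<dots> = hausdorff_outer n A + hausdorff_outer n B"
    by (rule suminf_binaryset_eq) simp
  finally show ?thesis by (simp add: UN_binaryset_eq)
qed

lemma hausdorff_outer_metric:
  fixes A B :: "'a::metric_space set"
  assumes "0 < r" and sep: "\<And>x y. x \<in> A \<Longrightarrow> y \<in> B \<Longrightarrow> r \<le> dist x y"
  shows "hausdorff_outer n A + hausdorff_outer n B \<le> hausdorff_outer n (A \<union> B)"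
proof -
  have small: "hausdorff_content n \<delta> A + hausdorff_content n \<delta> B \<le> hausdorff_outer n (A \<union> B)"
    if \<delta>: "0 < \<delta>" "\<delta> < r" for \<delta>
  proof -
    have "hausdorff_content n \<delta> A + hausdorff_content n \<delta> B \<le> (\<Sum>i. hausdorff_weight n (C i))"
      if C: "C \<in> hausdorff_covers \<delta> (A \<union> B)" for C
    proof -
      define D where "D X i = (if C i \<inter> X = {} then {} else C i)" for X i
      have cov: "D X \<in> hausdorff_covers \<delta> X" if "X \<subseteq> A \<union> B" for X
        using C \<delta> that by (auto simp: hausdorff_covers_def D_def split: if_splits) blast
      have one: "C i \<inter> A = {} \<or> C i \<inter> B = {}" for i
      proof (rule ccontr)
        assume "\<not> ?thesis"
        then obtain x y where xy: "x \<in> C i" "x \<in> A" "y \<in> C i" "y \<in> B" by blast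
        have "dist x y \<le> \<delta>"
          using C xy diameter_bounded_bound[of "C i" x y]
          by (auto simp: hausdorff_covers_def intro: order_trans)
        with sep[of x y] xy \<delta> show False by auto
      qed
      have "hausdorff_content n \<delta> A + hausdorff_content n \<delta> B
              \<le> (\<Sum>i. hausdorff_weight n (D A i)) + (\<Sum>i. hausdorff_weight n (D B i))"
        unfolding hausdorff_content_def by (intro add_mono INF_lower cov) auto
      also have "\<dots> = (\<Sum>i. hausdorff_weight n (D A i) + hausdorff_weight n (D B i))"
        by (rule suminf_add) auto
      also have "\<dots> \<le> (\<Sum>i. hausdorff_weight n (C i))"
      proof (rule suminf_le)
        show "hausdorff_weight n (D A i) + hausdorff_weight n (D B i) \<le> hausdorff_weight n (C i)" for i
          using one[of i] by (auto simp: D_def)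
      qed auto
      finally show ?thesis .
    qed
    then have "hausdorff_content n \<delta> A + hausdorff_content n \<delta> B \<le> hausdorff_content n \<delta> (A \<union> B)"
      unfolding hausdorff_content_def[of n \<delta> "A \<union> B"] by (rule INF_greatest)
    also have "\<dots> \<le> hausdorff_outer n (A \<union> B)"
      using \<delta> by (intro hausdorff_content_le_outer)
    finally show ?thesis .
  qed
  have ne: "{0<..} \<noteq> ({}::real set)" by auto
  have "hausdorff_outer n A + hausdorff_outer n B
          = (SUP \<delta>\<in>{0<..}. hausdorff_content n \<delta> A + hausdorff_content n \<delta> B)"
    unfolding hausdorff_outer_def
  proof (rule SUP_add_directed_ennreal[symmetric])
    fix i j :: real
    assume "i \<in> {0<..}" "j \<in> {0<..}"
    then show "\<exists>k\<in>{0<..}. hausdorff_content n i A + hausdorff_content n j B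
            \<le> hausdorff_content n k A + hausdorff_content n k B"
      by (intro bexI[of _ "min i j"] add_mono hausdorff_content_antimono) auto
  qed
  also have "\<dots> \<le> hausdorff_outer n (A \<union> B)"
  proof (rule SUP_least)
    fix \<delta> :: real assume \<delta>: "\<delta> \<in> {0<..}"
    have "hausdorff_content n \<delta> A + hausdorff_content n \<delta> B
        \<le> hausdorff_content n (min \<delta> (r/2)) A + hausdorff_content n (min \<delta> (r/2)) B"
      by (intro add_mono hausdorff_content_antimono) auto
    also have "\<dots> \<le> hausdorff_outer n (A \<union> B)"
      using \<delta> assms(1) by (intro small) auto
    finally show "hausdorff_content n \<delta> A + hausdorff_content n \<delta> B \<le> hausdorff_outer n (A \<union> B)" .
  qed
  finally show ?thesis .
qed

lemma hausdorff_outer_closed_split: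
  fixes A F :: "'a::metric_space set"
  assumes "closed F"
  shows "hausdorff_outer n (F \<inter> A) + hausdorff_outer n (A - F) \<le> hausdorff_outer n A"
proof (cases "F = {} \<or> hausdorff_outer n A = top")
  case True
  then show ?thesis by auto
next
  case False
  then have F: "F \<noteq> {}" and fin: "hausdorff_outer n A < top" by (auto simp: less_top)
  define d where "d x = infdist x F" for x
  have d_le: "d x \<le> d y + dist x y" for x y
    unfolding d_def by (rule infdist_triangle)
  have d_pos: "0 < d x" if "x \<notin> F" for x
    using assms F that by (simp add: d_def infdist_pos_not_in_closed)
  have d_zero: "d x = 0" if "x \<in> F" for x
    using that by (simp add: d_def)
  define Q where "Q j = {x \<in> A. 1 / (real j + 3) \<le> d x \<and> d x < 1 / (real j + 2)}" for j
  have half: "(\<Sum>j<N. hausdorff_outer n (Q (2*j+c))) \<le> hausdorff_outer n (\<Union>j<N. Q (2*j+c))" for N c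
  proof (induction N)
    case 0
    then show ?case by simp
  next
    case (Suc N)
    define r where "r = 1 / (real (2*N+c) + 1) - 1 / (real (2*N+c) + 2)"
    have "r > 0" by (auto simp: r_def divide_simps)
    have sep: "r \<le> dist x y" if xy: "x \<in> (\<Union>j<N. Q (2*j+c))" "y \<in> Q (2*N+c)" for x y
    proof -
      obtain j where j: "j < N" "x \<in> Q (2*j+c)" using xy by auto
      have "1 / (real (2*N+c) + 1) \<le> 1 / (real (2*j+c) + 3)"
        using j by (intro divide_left_mono) auto
      also have "\<dots> \<le> d x" using j by (simp add: Q_def)
      finally have "1 / (real (2*N+c) + 1) \<le> d x" .
      moreover have "d y < 1 / (real (2*N+c) + 2)" using xy by (simp add: Q_def)
      ultimately show ?thesis using d_le[of x y] by (simp add: r_def)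
    qed
    have "(\<Sum>j<Suc N. hausdorff_outer n (Q (2*j+c)))
            \<le> hausdorff_outer n (\<Union>j<N. Q (2*j+c)) + hausdorff_outer n (Q (2*N+c))"
      using Suc by (simp add: add_right_mono)
    also have "\<dots> \<le> hausdorff_outer n ((\<Union>j<N. Q (2*j+c)) \<union> Q (2*N+c))"
      using \<open>r > 0\<close> sep by (rule hausdorff_outer_metric)
    also have "(\<Union>j<N. Q (2*j+c)) \<union> Q (2*N+c) = (\<Union>j<Suc N. Q (2*j+c))"
      by (auto simp: lessThan_Suc)
    finally show ?case .
  qed
  have half': "(\<Sum>j<N. hausdorff_outer n (Q (2*j+c))) \<le> hausdorff_outer n A" for N c
    by (rule order_trans[OF half hausdorff_outer_mono]) (auto simp: Q_def)
  have split: "(\<Sum>j<2*N. hausdorff_outer n (Q j))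
      = (\<Sum>j<N. hausdorff_outer n (Q (2*j+0))) + (\<Sum>j<N. hausdorff_outer n (Q (2*j+1)))" for N
    by (induction N) (simp_all add: ac_simps)
  have bound: "(\<Sum>j<N. hausdorff_outer n (Q j)) \<le> hausdorff_outer n A + hausdorff_outer n A" for N
  proof -
    have "(\<Sum>j<N. hausdorff_outer n (Q j)) \<le> (\<Sum>j<2*N. hausdorff_outer n (Q j))"
      by (rule sum_mono2) auto
    also have "\<dots> \<le> hausdorff_outer n A + hausdorff_outer n A"
      unfolding split by (intro add_mono half')
    finally show ?thesis .
  qed
  have "(\<Sum>j. hausdorff_outer n (Q j)) \<le> hausdorff_outer n A + hausdorff_outer n A"
    by (rule suminf_le_const) (auto intro: bound)
  also have "\<dots> < top" using fin by (simp add: less_top)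
  finally have sum_fin: "(\<Sum>j. hausdorff_outer n (Q j)) < top" .
  define q where "q j = enn2real (hausdorff_outer n (Q j))" for j
  have q: "hausdorff_outer n (Q j) = ennreal (q j)" for j
    using ennreal_suminf_lessD[OF sum_fin, of j] by (simp add: q_def)
  have q_nn: "0 \<le> q j" for j by (simp add: q_def)
  have sumq: "summable q"
    by (rule summable_suminf_not_top) (use sum_fin q_nn in \<open>auto simp: q\<close>)
  show ?thesis
  proof (rule ennreal_le_epsilon)
    fix e :: real assume "0 < e"
    from suminf_exist_split[OF this sumq] obtain k where k: "norm (\<Sum>i. q (i + k)) < e"
      by auto
    define B where "B = {x \<in> A. 1 / (real k + 2) \<le> d x}"
    have sub: "A - F \<subseteq> B \<union> (\<Union>i. Q (i + k))"
    proof
      fix x assume x: "x \<in> A - F"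
      show "x \<in> B \<union> (\<Union>i. Q (i + k))"
      proof (cases "x \<in> B")
        case False
        obtain m :: nat where m: "1 / d x < real m" using reals_Archimedean2 by blast
        define P where "P i \<longleftrightarrow> 1 / (real (i + k) + 3) \<le> d x" for i
        have "1 / d x \<le> real (m + k) + 3" using m by simp
        then have "P m" using d_pos[of x] x by (simp add: P_def field_simps)
        define i where "i = (LEAST i. P i)"
        have "P i" unfolding i_def using \<open>P m\<close> by (rule LeastI)
        have "d x < 1 / (real (i + k) + 2)"
        proof (cases i)
          case 0
          then show ?thesis using False x by (simp add: B_def)
        next
          case (Suc i')
          then have "\<not> P i'" using not_less_Least[of i' P] by (simp add: i_def)
          then show ?thesis by (simp add: P_def Suc algebra_simps)
        qed
        with \<open>P i\<close> x have "x \<in> Q (i + k)" by (simp add: Q_def P_def)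
        then show ?thesis by blast
      qed simp
    qed
    have tail: "hausdorff_outer n (\<Union>i. Q (i + k)) \<le> ennreal e"
    proof -
      have "hausdorff_outer n (\<Union>i. Q (i + k)) \<le> (\<Sum>i. ennreal (q (i + k)))"
        using hausdorff_outer_UN_le[of n "\<lambda>i. Q (i + k)"] by (simp add: q)
      also have "\<dots> = ennreal (\<Sum>i. q (i + k))"
        using sumq q_nn by (intro suminf_ennreal2) (auto simp: summable_iff_shift)
      also have "\<dots> \<le> ennreal e" using k by (intro ennreal_leI) auto
      finally show ?thesis .
    qed
    have "hausdorff_outer n (A - F) \<le> hausdorff_outer n B + hausdorff_outer n (\<Union>i. Q (i + k))"
      using hausdorff_outer_mono[OF sub] hausdorff_outer_Un_le by (rule order_trans)
    also have "\<dots> \<le> hausdorff_outer n B + ennreal e"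
      using tail by (rule add_left_mono)
    finally have AF: "hausdorff_outer n (A - F) \<le> hausdorff_outer n B + ennreal e" .
    have "hausdorff_outer n (F \<inter> A) + hausdorff_outer n B \<le> hausdorff_outer n ((F \<inter> A) \<union> B)"
    proof (rule hausdorff_outer_metric)
      show "0 < 1 / (real k + 2)" by simp
      show "1 / (real k + 2) \<le> dist x y" if "x \<in> F \<inter> A" "y \<in> B" for x y
        using that d_le[of y x] d_zero[of x] by (simp add: B_def dist_commute)
    qed
    also have "\<dots> \<le> hausdorff_outer n A"
      by (rule hausdorff_outer_mono) (auto simp: B_def)
    finally have "hausdorff_outer n (F \<inter> A) + hausdorff_outer n B \<le> hausdorff_outer n A" .
    then have "hausdorff_outer n (F \<inter> A) + hausdorff_outer n B + ennreal e \<le> hausdorff_outer n A + ennreal e"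
      by (rule add_right_mono)
    moreover have "hausdorff_outer n (F \<inter> A) + hausdorff_outer n (A - F)
        \<le> hausdorff_outer n (F \<inter> A) + (hausdorff_outer n B + ennreal e)"
      using AF by (rule add_left_mono)
    ultimately show "hausdorff_outer n (F \<inter> A) + hausdorff_outer n (A - F)
        \<le> hausdorff_outer n A + ennreal e"
      unfolding add.assoc by (rule order_trans[rotated])
  qed
qed

lemma measure_space_hausdorff:
  "measure_space UNIV (sets borel) (hausdorff_outer n :: 'a::metric_space set \<Rightarrow> ennreal)"
proof (rule measure_down)
  let ?L = "lambda_system UNIV (Pow UNIV) (hausdorff_outer n :: 'a set \<Rightarrow> ennreal)"
  show L: "measure_space UNIV ?L (hausdorff_outer n :: 'a set \<Rightarrow> ennreal)"
    by (rule sigma_algebra.caratheodory_lemma[OF sigma_algebra_Pow hausdorff_outer_measure_space])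
  show "sigma_algebra UNIV (sets (borel :: 'a measure))"
    using sets.sigma_algebra_axioms[of "borel :: 'a measure"] by simp
  have "F \<in> ?L" if "closed F" for F :: "'a set"
  proof -
    have "hausdorff_outer n (F \<inter> A) + hausdorff_outer n ((UNIV - F) \<inter> A) = hausdorff_outer n A" for A
    proof (rule antisym)
      have eq: "(UNIV - F) \<inter> A = A - F" by auto
      show "hausdorff_outer n (F \<inter> A) + hausdorff_outer n ((UNIV - F) \<inter> A) \<le> hausdorff_outer n A"
        unfolding eq using that by (rule hausdorff_outer_closed_split)
      show "hausdorff_outer n A \<le> hausdorff_outer n (F \<inter> A) + hausdorff_outer n ((UNIV - F) \<inter> A)"
        by (rule order_trans[OF hausdorff_outer_mono hausdorff_outer_Un_le]) auto
    qed
    then show ?thesis by (simp add: lambda_system_def)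
  qed
  then have "Collect closed \<subseteq> ?L" by blast
  moreover have "sigma_algebra UNIV ?L" using L by (simp only: measure_space_def)
  ultimately have "sigma_sets UNIV (Collect closed) \<subseteq> ?L"
    by (rule sigma_algebra.sigma_sets_subset[rotated])
  then show "sets (borel :: 'a measure) \<subseteq> ?L"
    by (simp add: borel_eq_closed)
qed

lemma space_hausdorff_measure [simp]: "space (hausdorff_measure n) = UNIV"
  by (simp add: hausdorff_measure_def space_measure_of_conv)

lemma sets_hausdorff_measure [simp, measurable_cong]: "sets (hausdorff_measure n) = sets borel"
  by (metis hausdorff_measure_def sets.sigma_sets_eq sets_measure_of space_borel top_greatest
      subset_Pow_Union UNIV_I Pow_UNIV)

lemma emeasure_hausdorff_measure:
  fixes A :: "'a::metric_space set"
  assumes "A \<in> sets borel"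
  shows "emeasure (hausdorff_measure n) A = hausdorff_outer n A"
proof (rule emeasure_measure_of[OF hausdorff_measure_def])
  show "positive (sets (hausdorff_measure n :: 'a measure)) (hausdorff_outer n)"
    using measure_space_hausdorff[of n, where 'a = 'a] by (simp add: measure_space_def)
  show "countably_additive (sets (hausdorff_measure n :: 'a measure)) (hausdorff_outer n)"
    using measure_space_hausdorff[of n, where 'a = 'a] by (simp add: measure_space_def)
qed (use assms in auto)

definition surface_measure :: "'a::euclidean_space set \<Rightarrow> 'a measure" where
  "surface_measure S = restrict_space (hausdorff_measure (DIM('a) - 1)) S"


section \<open>Bounded \<open>C\<^sup>2\<close> domains and their normals\<close>

definition C2_function :: "('a::euclidean_space \<Rightarrow> real) \<Rightarrow> bool" where
  "C2_function f \<longleftrightarrow>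
     (\<exists>(f' :: 'a \<Rightarrow> 'a \<Rightarrow>\<^sub>L real) (f'' :: 'a \<Rightarrow> 'a \<Rightarrow>\<^sub>L ('a \<Rightarrow>\<^sub>L real)).
        (\<forall>x. (f has_derivative blinfun_apply (f' x)) (at x)) \<and>
        (\<forall>x. (f' has_derivative blinfun_apply (f'' x)) (at x)) \<and>
        continuous_on UNIV f'')"

text \<open>
  Near each boundary point, \<open>\<Omega>\<close> is the region strictly above the graph of a \<open>C\<^sup>2\<close> function of
  \<open>d - 1\<close> variables in suitably rotated coordinates. The unit vector \<open>u\<close> is the direction of the
  last coordinate; the vector \<open>x - (x \<bullet> u) *\<^sub>R u\<close> is the orthogonal projection of \<open>x\<close> onto the
  hyperplane \<open>u\<^sup>\<bottom>\<close>, and only the values of \<open>\<gamma>\<close> on that hyperplane matter (every \<open>C\<^sup>2\<close> function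
  on the hyperplane extends to the whole space by composition with the projection).
\<close>

definition C2_boundary :: "'a::euclidean_space set \<Rightarrow> bool" where
  "C2_boundary \<Omega> \<longleftrightarrow>
     (\<forall>p\<in>frontier \<Omega>. \<exists>r>0. \<exists>u \<gamma>. norm u = 1 \<and> C2_function \<gamma> \<and>
        \<Omega> \<inter> ball p r = {x \<in> ball p r. \<gamma> (x - (x \<bullet> u) *\<^sub>R u) < x \<bullet> u})"

definition bounded_C2_domain :: "'a::euclidean_space set \<Rightarrow> bool" where
  "bounded_C2_domain \<Omega> \<longleftrightarrow>
     \<Omega> \<noteq> {} \<and> open \<Omega> \<and> connected \<Omega> \<and> bounded \<Omega> \<and> C2_boundary \<Omega>"

text \<open>Velocities at \<open>x\<close> of curves lying in \<open>S\<close>; for a hypersurface this is its tangent space.\<close>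

definition tangent_vectors :: "'a::euclidean_space set \<Rightarrow> 'a \<Rightarrow> 'a set" where
  "tangent_vectors S x =
     {v. \<exists>c :: real \<Rightarrow> 'a. c 0 = x \<and> (\<forall>\<^sub>F t in at 0. c t \<in> S) \<and>
           (c has_vector_derivative v) (at 0)}"

definition outward_unit_normal :: "'a::euclidean_space set \<Rightarrow> 'a \<Rightarrow> 'a \<Rightarrow> bool" where
  "outward_unit_normal \<Omega> x n \<longleftrightarrow>
     norm n = 1 \<and> (\<forall>v\<in>tangent_vectors (frontier \<Omega>) x. n \<bullet> v = 0) \<and>
     (\<forall>\<^sub>F t in at_right 0. x + t *\<^sub>R n \<notin> \<Omega> \<and> x - t *\<^sub>R n \<in> \<Omega>)"

end

theory Submission
  imports Defs
begin

text \<open>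
  Fix \<open>y\<close> on the boundary, write \<open>w = (x - y) / |x - y|\<close> and put \<open>a = \<nu> x \<bullet> w\<close>, \<open>b = \<nu> y \<bullet> w\<close>.
  Then \<open>|\<nu> x - \<nu> y|\<^sup>2 \<ge> (a - b)\<^sup>2 \<ge> - 4 a b\<close>. Moreover \<open>|a| / |x - y| ^ (d - 1)\<close> is the Jacobian of the
  radial projection \<open>x \<mapsto> w\<close> of the boundary to the unit sphere. Every ray that enters \<open>\<Omega>\<close> at \<open>y\<close>
  has a first exit point, where \<open>a \<ge> 0\<close> and \<open>b < 0\<close>, so these \<open>x\<close> project onto the half sphere
  \<open>w \<bullet> \<nu> y < 0\<close> and already the inner integral is at least the integral of \<open>- 4 (w \<bullet> \<nu> y)\<close> over this
  half sphere, which does not depend on \<open>y\<close>. For a sphere the projection is injective and all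
  inequalities are equalities, which identifies the constant. In the case of equality
  \<open>\<nu> x - \<nu> y\<close> is parallel to \<open>x - y\<close> for all \<open>x\<close>, \<open>y\<close>; hence \<open>\<nu>\<close> is an affine function of position
  with scalar linear part, and the boundary lies on a sphere.

  Both sides are quadratic in the surface measure, so the normalisation of Hausdorff measure
  plays no role: on a hyperplane it is only compared with Lebesgue measure up to a constant, by
  uniqueness of translation-invariant measures.
\<close>

section \<open>Hausdorff measure of images\<close>

text \<open>The obstacle is the area formula for the radial projection. On small pieces of the
  surface the projection is compared with a linear map between hyperplanes. Lipschitz bounds with
  constants near 1 are good enough for that comparison, but not for the linear map itself: its
  effect on Hausdorff measure must be known exactly, and only this step appeals to Lebesgue measure.
  The two halves of the area formula cost differently. That the image is at most the integral of the
  Jacobian follows from subadditivity on any surface, and this is the half which the lower bound for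
  a general boundary needs. The other half requires disjoint Borel images and is applied to spheres
  only, where the inverse of the projection is explicit. At boundary points seen tangentially from
  \<open>y\<close> the linear map degenerates; these points are kept, with Jacobian zero. Equality
  of integrals gives information only almost everywhere; continuity of the normal and the positive
  measure of every boundary ball extend it to all pairs of points.\<close>

lemma ennreal_power_mult_le_iff:
  fixes a b :: ennreal
  assumes "0 < K"
  shows "ennreal ((1 / K) ^ n) * a \<le> b \<longleftrightarrow> a \<le> ennreal (K ^ n) * b"
proof -
  have *: "ennreal (K ^ n) * (ennreal ((1 / K) ^ n) * c) = c"
          "ennreal ((1 / K) ^ n) * (ennreal (K ^ n) * c) = c" for c
    using assms
    by (simp_all add: mult.assoc[symmetric] ennreal_mult[symmetric] power_mult_distrib[symmetric])
  show ?thesis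
    by (metis * mult_left_mono zero_le)
qed

text \<open>The two maps out of a common domain stand for a \<open>K\<close>-Lipschitz map from the
  image of \<open>g\<close> to the image of \<open>f\<close>, so that no inverse of \<open>g\<close>
  has to be formed. All later comparisons of Hausdorff measures are instances.\<close>

lemma hausdorff_outer_dominated:
  fixes f :: "'c \<Rightarrow> 'a::metric_space" and g :: "'c \<Rightarrow> 'b::metric_space"
  assumes K: "0 < K"
    and dom: "\<And>x y. x \<in> A \<Longrightarrow> y \<in> A \<Longrightarrow> dist (f x) (f y) \<le> K * dist (g x) (g y)"
  shows "hausdorff_outer n (f ` A) \<le> ennreal (K ^ n) * hausdorff_outer n (g ` A)"
  unfolding hausdorff_outer_def[of n "f ` A"]
proof (rule SUP_least)
  fix \<delta> :: real assume "\<delta> \<in> {0<..}"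
  then have \<delta>: "\<delta> > 0" by simp
  have "hausdorff_content n \<delta> (f ` A) \<le> ennreal (K ^ n) * (\<Sum>i. hausdorff_weight n (C i))"
    if C: "C \<in> hausdorff_covers (\<delta> / K) (g ` A)" for C
  proof -
    have bC: "bounded (C i)" and dC: "diameter (C i) \<le> \<delta> / K" for i
      using C by (auto simp: hausdorff_covers_def)
    \<comment> \<open>The covering sets are pulled back along \<open>g\<close> and pushed forward
      along \<open>f\<close>, which multiplies diameters by at most \<open>K\<close>; hence the
      scale \<delta> / \<open>K\<close> for the given cover.\<close>
    define D where "D i = f ` (A \<inter> g -` C i)" for i
    have dist_D: "dist u v \<le> K * diameter (C i)" if uv: "u \<in> D i" "v \<in> D i" for u v i
    proof -
      obtain x y where xy: "x \<in> A" "y \<in> A" "g x \<in> C i" "g y \<in> C i" "u = f x" "v = f y"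
        using uv by (auto simp: D_def)
      have "dist u v \<le> K * dist (g x) (g y)" using dom xy by auto
      also have "\<dots> \<le> K * diameter (C i)"
        using K xy bC by (intro mult_left_mono diameter_bounded_bound) auto
      finally show ?thesis .
    qed
    have bD: "bounded (D i)" for i
      by (auto simp: bounded_two_points intro!: exI[of _ "K * diameter (C i)"] dist_D)
    have diam_D: "diameter (D i) \<le> K * diameter (C i)" for i
    proof (cases "D i = {}")
      case True
      then show ?thesis using K diameter_ge_0[OF bC[of i]] by simp
    next
      case False
      have "diameter (D i) = (SUP (x,y)\<in>D i \<times> D i. dist x y)"
        using False by (simp add: diameter_def)
      also have "\<dots> \<le> K * diameter (C i)"
        using False dist_D by (intro cSUP_least) auto
      finally show ?thesis .
    qed
    have "D \<in> hausdorff_covers \<delta> (f ` A)"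
      unfolding hausdorff_covers_def
    proof (intro CollectI conjI allI)
      show "f ` A \<subseteq> (\<Union>i. D i)"
        using C by (fastforce simp: hausdorff_covers_def D_def)
      show "bounded (D i)" for i by (rule bD)
      show "diameter (D i) \<le> \<delta>" for i
      proof -
        have "K * diameter (C i) \<le> K * (\<delta> / K)"
          using K dC by (intro mult_left_mono) auto
        with diam_D[of i] K show ?thesis by simp
      qed
    qed
    then have "hausdorff_content n \<delta> (f ` A) \<le> (\<Sum>i. hausdorff_weight n (D i))"
      unfolding hausdorff_content_def by (rule INF_lower)
    also have "\<dots> \<le> (\<Sum>i. ennreal (K ^ n) * hausdorff_weight n (C i))"
    proof (rule suminf_le)
      fix i
      show "hausdorff_weight n (D i) \<le> ennreal (K ^ n) * hausdorff_weight n (C i)"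
      proof (cases "D i = {}")
        case False
        then have ne: "C i \<noteq> {}" by (auto simp: D_def)
        have "(diameter (D i) / 2) ^ n \<le> (K * (diameter (C i) / 2)) ^ n"
          using diam_D[of i] diameter_ge_0[OF bD[of i]] by (intro power_mono) auto
        then have "unit_ball_vol (real n) * (diameter (D i) / 2) ^ n
            \<le> unit_ball_vol (real n) * (K ^ n * (diameter (C i) / 2) ^ n)"
          unfolding power_mult_distrib[of K] by (rule mult_left_mono) simp
        then have "unit_ball_vol (real n) * (diameter (D i) / 2) ^ n
            \<le> K ^ n * (unit_ball_vol (real n) * (diameter (C i) / 2) ^ n)"
          by (simp only: mult.left_commute)
        then show ?thesis
          using False ne K diameter_ge_0[OF bC[of i]]
          by (simp add: hausdorff_weight_def ennreal_mult[symmetric] ennreal_leI)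
      qed simp
    qed auto
    also have "\<dots> = ennreal (K ^ n) * (\<Sum>i. hausdorff_weight n (C i))"
      by (rule ennreal_suminf_cmult)
    finally show ?thesis .
  qed
  \<comment> \<open>With the factor on the left, the estimate for each cover becomes a lower bound
    for an infimum, and multiplication need not be pulled through the infimum.\<close>
  then have "ennreal ((1 / K) ^ n) * hausdorff_content n \<delta> (f ` A) \<le> hausdorff_content n (\<delta> / K) (g ` A)"
    unfolding hausdorff_content_def[of n "\<delta> / K"] ennreal_power_mult_le_iff[OF K, symmetric]
    by (intro INF_greatest)
  then have "hausdorff_content n \<delta> (f ` A) \<le> ennreal (K ^ n) * hausdorff_content n (\<delta> / K) (g ` A)"
    by (simp only: ennreal_power_mult_le_iff[OF K])
  also have "\<dots> \<le> ennreal (K ^ n) * hausdorff_outer n (g ` A)"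
    using K \<delta> by (intro mult_left_mono hausdorff_content_le_outer) auto
  finally show "hausdorff_content n \<delta> (f ` A) \<le> ennreal (K ^ n) * hausdorff_outer n (g ` A)" .
qed

lemma hausdorff_outer_isometric_images:
  fixes f :: "'c \<Rightarrow> 'a::metric_space" and g :: "'c \<Rightarrow> 'b::metric_space"
  assumes "\<And>x y. x \<in> A \<Longrightarrow> y \<in> A \<Longrightarrow> dist (f x) (f y) = dist (g x) (g y)"
  shows "hausdorff_outer n (f ` A) = hausdorff_outer n (g ` A)"
  using hausdorff_outer_dominated[of 1 A f g n] hausdorff_outer_dominated[of 1 A g f n] assms
  by (intro antisym) auto

lemma hausdorff_outer_translation:
  fixes a :: "'a::real_normed_vector"
  shows "hausdorff_outer n ((\<lambda>x. a + x) ` A) = hausdorff_outer n A"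
  using hausdorff_outer_isometric_images[of A "\<lambda>x. a + x" "\<lambda>x. x" n] by simp

lemma hausdorff_outer_scaleR:
  fixes f :: "'c \<Rightarrow> 'a::real_normed_vector"
  assumes "0 < s"
  shows "hausdorff_outer n ((\<lambda>x. s *\<^sub>R f x) ` A) = ennreal (s ^ n) * hausdorff_outer n (f ` A)"
proof (rule antisym)
  show le: "hausdorff_outer n ((\<lambda>x. s *\<^sub>R f x) ` A) \<le> ennreal (s ^ n) * hausdorff_outer n (f ` A)"
    using assms by (intro hausdorff_outer_dominated) (auto simp: dist_norm scaleR_diff_right[symmetric] simp del: scaleR_diff_right)
  have "hausdorff_outer n (f ` A) \<le> ennreal ((1/s) ^ n) * hausdorff_outer n ((\<lambda>x. s *\<^sub>R f x) ` A)"
    using assms by (intro hausdorff_outer_dominated) (auto simp: dist_norm scaleR_diff_right[symmetric] simp del: scaleR_diff_right)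
  then show "ennreal (s ^ n) * hausdorff_outer n (f ` A) \<le> hausdorff_outer n ((\<lambda>x. s *\<^sub>R f x) ` A)"
    using ennreal_power_mult_le_iff[of "1 / s" n] assms by simp
qed

lemma hausdorff_outer_singleton:
  assumes "0 < n"
  shows "hausdorff_outer n {x} = 0"
proof -
  have "hausdorff_content n \<delta> {x} \<le> 0" if "\<delta> > 0" for \<delta>
  proof -
    have "(\<lambda>_. {x}) \<in> hausdorff_covers \<delta> {x}"
      using that by (simp add: hausdorff_covers_def)
    then have "hausdorff_content n \<delta> {x} \<le> (\<Sum>i::nat. hausdorff_weight n ((\<lambda>_. {x}) i))"
      unfolding hausdorff_content_def by (rule INF_lower)
    then show ?thesis using assms by (simp add: hausdorff_weight_def zero_power)
  qed
  then have "hausdorff_outer n {x} \<le> 0"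
    unfolding hausdorff_outer_def by (intro SUP_least) auto
  then show ?thesis by simp
qed

text \<open>Covers are infinite sequences by definition; the finite family is padded with empty
  sets, which have weight 0 and diameter 0.\<close>

lemma hausdorff_content_finite_cover:
  assumes "finite I" and cov: "A \<subseteq> (\<Union>i\<in>I. C i)" and "0 \<le> \<delta>"
    and C: "\<And>i. i \<in> I \<Longrightarrow> bounded (C i) \<and> diameter (C i) \<le> \<delta>"
  shows "hausdorff_content n \<delta> A \<le> (\<Sum>i\<in>I. hausdorff_weight n (C i))"
proof -
  obtain h where h: "bij_betw h {0..<card I} I"
    using ex_bij_betw_nat_finite[OF \<open>finite I\<close>] by blast
  define D where "D m = (if m < card I then C (h m) else {})" for m
  have hI: "h m \<in> I" if "m < card I" for m
    using h that by (auto simp: bij_betw_def)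
  have "D \<in> hausdorff_covers \<delta> A"
    unfolding hausdorff_covers_def
  proof (intro CollectI conjI allI)
    show "A \<subseteq> (\<Union>i. D i)"
    proof
      fix x assume "x \<in> A"
      then obtain i where "i \<in> I" "x \<in> C i" using cov by auto
      moreover have "i \<in> h ` {0..<card I}"
        using h \<open>i \<in> I\<close> by (simp add: bij_betw_def)
      then obtain m where "m < card I" "h m = i" by auto
      ultimately show "x \<in> (\<Union>i. D i)" by (auto simp: D_def)
    qed
  qed (use C hI \<open>0 \<le> \<delta>\<close> in \<open>auto simp: D_def\<close>)
  then have "hausdorff_content n \<delta> A \<le> (\<Sum>m. hausdorff_weight n (D m))"
    unfolding hausdorff_content_def by (rule INF_lower)
  also have "\<dots> = (\<Sum>m<card I. hausdorff_weight n (D m))"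
    by (rule suminf_finite) (auto simp: D_def)
  also have "\<dots> = (\<Sum>m<card I. hausdorff_weight n (C (h m)))"
    by (rule sum.cong) (auto simp: D_def)
  also have "\<dots> = (\<Sum>i\<in>I. hausdorff_weight n (C i))"
    by (rule sum.reindex_bij_betw) (use h in \<open>simp add: lessThan_atLeast0\<close>)
  finally show ?thesis .
qed

section \<open>Hausdorff measure on hyperplanes\<close>

text \<open>The Fubini proof of uniqueness of Haar measure: the set of pairs with \<open>x\<close>
  in \<open>A\<close> and \<open>y - x\<close> in \<open>B\<close> is measured in both orders.
  Symmetry of \<open>B\<close> absorbs the reflection produced by the second shift. The group is
  \<open>E\<close>, which carries both measures although they are defined on the whole
  space.\<close>

lemma invariant_measures_proportional:
  fixes M N :: "'a::euclidean_space measure" and E :: "'a set"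
  assumes sM: "sets M = sets borel" and sN: "sets N = sets borel"
    and sf: "sigma_finite_measure M" "sigma_finite_measure N"
    and AE: "AE x in M. x \<in> E" "AE x in N. x \<in> E"
    and E: "\<And>x. x \<in> E \<Longrightarrow> -x \<in> E"
    and inv: "\<And>a f. a \<in> E \<Longrightarrow> f \<in> borel_measurable borel \<Longrightarrow> (\<integral>\<^sup>+ x. f (x + a) \<partial>M) = (\<integral>\<^sup>+ x. f x \<partial>M)"
             "\<And>a f. a \<in> E \<Longrightarrow> f \<in> borel_measurable borel \<Longrightarrow> (\<integral>\<^sup>+ x. f (x + a) \<partial>N) = (\<integral>\<^sup>+ x. f x \<partial>N)"
    and A: "A \<in> sets borel" and B: "B \<in> sets borel" and symB: "\<And>x. -x \<in> B \<longleftrightarrow> x \<in> B"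
  shows "emeasure M A * emeasure N B = emeasure N A * emeasure M B"
proof -
  interpret M: sigma_finite_measure M by fact
  interpret N: sigma_finite_measure N by fact
  interpret pair_sigma_finite N M by unfold_locales
  note [measurable_cong] = sM sN
  note [measurable] = A B
  let ?f = "indicator :: 'a set \<Rightarrow> 'a \<Rightarrow> ennreal"
  have spaces: "space M = UNIV" "space N = UNIV"
    using sets_eq_imp_space_eq[OF sM] sets_eq_imp_space_eq[OF sN] by auto
  have "emeasure M A * emeasure N B = (\<integral>\<^sup>+ x. ?f A x * (\<integral>\<^sup>+ y. ?f B y \<partial>N) \<partial>M)"
    by (simp add: nn_integral_multc sN sM)
  also have "\<dots> = (\<integral>\<^sup>+ x. ?f A x * (\<integral>\<^sup>+ y. ?f B (y - x) \<partial>N) \<partial>M)"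
  proof (rule nn_integral_cong_AE, use AE(1) in eventually_elim)
    fix x assume "x \<in> E"
    then show "?f A x * (\<integral>\<^sup>+ y. ?f B y \<partial>N) = ?f A x * (\<integral>\<^sup>+ y. ?f B (y - x) \<partial>N)"
      using inv(2)[of "-x" "?f B"] E by simp
  qed
  also have "\<dots> = (\<integral>\<^sup>+ x. (\<integral>\<^sup>+ y. ?f A x * ?f B (y - x) \<partial>N) \<partial>M)"
    by (simp add: nn_integral_cmult)
  also have "\<dots> = (\<integral>\<^sup>+ y. (\<integral>\<^sup>+ x. ?f A x * ?f B (y - x) \<partial>M) \<partial>N)"
    by (rule Fubini') measurable
  also have "\<dots> = (\<integral>\<^sup>+ y. (\<integral>\<^sup>+ x. ?f A (x + y) * ?f B x \<partial>M) \<partial>N)"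
  proof (rule nn_integral_cong_AE, use AE(2) in eventually_elim)
    fix y assume "y \<in> E"
    then show "(\<integral>\<^sup>+ x. ?f A x * ?f B (y - x) \<partial>M) = (\<integral>\<^sup>+ x. ?f A (x + y) * ?f B x \<partial>M)"
      using inv(1)[of y "\<lambda>x. ?f A x * ?f B (y - x)"] by (simp add: indicator_def symB)
  qed
  also have "\<dots> = (\<integral>\<^sup>+ x. (\<integral>\<^sup>+ y. ?f A (x + y) * ?f B x \<partial>N) \<partial>M)"
    by (rule Fubini'[symmetric]) measurable
  also have "\<dots> = (\<integral>\<^sup>+ x. (\<integral>\<^sup>+ y. ?f A (y + x) \<partial>N) * ?f B x \<partial>M)"
    by (simp add: nn_integral_multc add.commute)
  also have "\<dots> = (\<integral>\<^sup>+ x. emeasure N A * ?f B x \<partial>M)"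
  proof (rule nn_integral_cong_AE, use AE(1) in eventually_elim)
    fix x assume "x \<in> E"
    then show "(\<integral>\<^sup>+ y. ?f A (y + x) \<partial>N) * ?f B x = emeasure N A * ?f B x"
      using inv(2)[of x "?f A"] by (simp add: sN)
  qed
  also have "\<dots> = emeasure N A * emeasure M B"
    by (simp add: nn_integral_cmult sM)
  finally show ?thesis .
qed

abbreviation \<H> :: "'a::euclidean_space set \<Rightarrow> ennreal" where
  "\<H> \<equiv> hausdorff_outer (DIM('a) - 1)"

text \<open>For a unit vector \<open>k\<close> this is Lebesgue measure on the hyperplane orthogonal to \<open>k\<close>: the volume of the
  slab of height one over a set. It avoids a separate type of dimension \<open>d - 1\<close>.\<close>

definition slab_measure :: "'a::euclidean_space \<Rightarrow> 'a measure" where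
  "slab_measure k = distr (density lborel (indicator {x. 0 \<le> x \<bullet> k \<and> x \<bullet> k \<le> 1})) borel (\<lambda>x. x - (x \<bullet> k) *\<^sub>R k)"

text \<open>A density instead of \<open>restrict_space\<close> keeps the sigma-algebra equal to that
  of \<open>slab_measure\<close>, so that both fit
  \<open>invariant_measures_proportional\<close>.\<close>

definition hyperplane_hausdorff :: "'a::euclidean_space \<Rightarrow> 'a measure" where
  "hyperplane_hausdorff k = density (hausdorff_measure (DIM('a) - 1)) (indicator {x. x \<bullet> k = 0})"

lemma sets_slab_measure [simp, measurable_cong]: "sets (slab_measure k) = sets borel"
  by (simp add: slab_measure_def)

lemma sets_hyperplane_hausdorff [simp, measurable_cong]: "sets (hyperplane_hausdorff k) = sets borel"
  by (simp add: hyperplane_hausdorff_def)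

lemma space_slab_measure [simp]: "space (slab_measure k) = UNIV"
  by (simp add: slab_measure_def)

lemma space_hyperplane_hausdorff [simp]: "space (hyperplane_hausdorff k) = UNIV"
  by (simp add: hyperplane_hausdorff_def)

lemma hausdorff_measure_translation:
  fixes a :: "'a::euclidean_space"
  shows "distr (hausdorff_measure n) borel (\<lambda>x. x + a) = hausdorff_measure n"
proof (rule measure_eqI)
  fix A assume "A \<in> sets (distr (hausdorff_measure n) borel (\<lambda>x. x + a))"
  then have A [measurable]: "A \<in> sets borel" by simp
  have "(\<lambda>x. x + a) -` A = (\<lambda>x. - a + x) ` A"
    by (force simp: image_iff)
  moreover have "(\<lambda>x. x + a) -` A \<in> sets borel"
    using measurable_sets[of "\<lambda>x. x + a" borel borel A] by simp
  ultimately show "emeasure (distr (hausdorff_measure n) borel (\<lambda>x. x + a)) A = emeasure (hausdorff_measure n) A"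
    using hausdorff_outer_translation[of n "- a" A] by (simp add: emeasure_distr emeasure_hausdorff_measure)
qed simp

lemma hyperplane_hausdorff_invariant:
  fixes k a :: "'a::euclidean_space"
  assumes a: "a \<bullet> k = 0" and [measurable]: "f \<in> borel_measurable borel"
  shows "(\<integral>\<^sup>+ x. f (x + a) \<partial>hyperplane_hausdorff k) = (\<integral>\<^sup>+ x. f x \<partial>hyperplane_hausdorff k)"
proof -
  let ?H = "hausdorff_measure (DIM('a) - 1) :: 'a measure"
  have "(\<integral>\<^sup>+ x. f x \<partial>hyperplane_hausdorff k) = (\<integral>\<^sup>+ x. indicator {x. x \<bullet> k = 0} x * f x \<partial>?H)"
    unfolding hyperplane_hausdorff_def by (subst nn_integral_density) auto
  also have "\<dots> = (\<integral>\<^sup>+ x. indicator {x. x \<bullet> k = 0} x * f x \<partial>distr ?H borel (\<lambda>x. x + a))"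
    by (simp add: hausdorff_measure_translation)
  also have "\<dots> = (\<integral>\<^sup>+ x. indicator {x. x \<bullet> k = 0} (x + a) * f (x + a) \<partial>?H)"
    by (subst nn_integral_distr) auto
  also have "\<dots> = (\<integral>\<^sup>+ x. indicator {x. x \<bullet> k = 0} x * f (x + a) \<partial>?H)"
    by (intro nn_integral_cong) (auto simp: indicator_def inner_add_left a)
  also have "\<dots> = (\<integral>\<^sup>+ x. f (x + a) \<partial>hyperplane_hausdorff k)"
    unfolding hyperplane_hausdorff_def by (subst nn_integral_density) auto
  finally show ?thesis ..
qed

lemma slab_measure_invariant:
  fixes k a :: "'a::euclidean_space"
  assumes a: "a \<bullet> k = 0" and [measurable]: "f \<in> borel_measurable borel"
  shows "(\<integral>\<^sup>+ x. f (x + a) \<partial>slab_measure k) = (\<integral>\<^sup>+ x. f x \<partial>slab_measure k)"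
proof -
  let ?P = "\<lambda>x. x - (x \<bullet> k) *\<^sub>R k" and ?I = "indicator {x. 0 \<le> x \<bullet> k \<and> x \<bullet> k \<le> 1} :: 'a \<Rightarrow> ennreal"
  have eq: "(\<integral>\<^sup>+ x. g x \<partial>slab_measure k) = (\<integral>\<^sup>+ x. ?I x * g (?P x) \<partial>lborel)"
    if [measurable]: "g \<in> borel_measurable borel" for g
    unfolding slab_measure_def by (subst nn_integral_distr; (subst nn_integral_density)?) auto
  have "(\<integral>\<^sup>+ x. f x \<partial>slab_measure k) = (\<integral>\<^sup>+ x. ?I x * f (?P x) \<partial>distr lborel borel ((+) a))"
    by (simp add: eq lborel_distr_plus)
  also have "\<dots> = (\<integral>\<^sup>+ x. ?I (a + x) * f (?P (a + x)) \<partial>lborel)"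
    by (subst nn_integral_distr) auto
  also have "\<dots> = (\<integral>\<^sup>+ x. ?I x * f (?P x + a) \<partial>lborel)"
    by (intro nn_integral_cong) (simp add: indicator_def inner_add_left a algebra_simps)
  also have "\<dots> = (\<integral>\<^sup>+ x. f (x + a) \<partial>slab_measure k)"
    by (simp add: eq)
  finally show ?thesis ..
qed

abbreviation slab_over :: "'a::euclidean_space \<Rightarrow> 'a set \<Rightarrow> 'a set" where
  "slab_over k A \<equiv> {x. 0 \<le> x \<bullet> k \<and> x \<bullet> k \<le> 1 \<and> x - (x \<bullet> k) *\<^sub>R k \<in> A}"

lemma emeasure_slab_measure:
  assumes [measurable]: "A \<in> sets borel"
  shows "emeasure (slab_measure k) A
      = emeasure lborel (slab_over k A)"
proof -
  have [measurable]: "{x. x - (x \<bullet> k) *\<^sub>R k \<in> A} \<in> sets borel" by measurable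
  have "(\<lambda>x. x - (x \<bullet> k) *\<^sub>R k) -` A = {x. x - (x \<bullet> k) *\<^sub>R k \<in> A}" by auto
  then have "emeasure (slab_measure k) A
    = emeasure (density lborel (indicator {x. 0 \<le> x \<bullet> k \<and> x \<bullet> k \<le> 1})) {x. x - (x \<bullet> k) *\<^sub>R k \<in> A}"
    unfolding slab_measure_def by (subst emeasure_distr) auto
  also have "\<dots> = (\<integral>\<^sup>+ x. indicator (slab_over k A) x \<partial>lborel)"
    by (subst emeasure_density, simp, simp, intro nn_integral_cong) (simp add: indicator_def)
  also have "\<dots> = emeasure lborel (slab_over k A)"
    by (rule nn_integral_indicator) measurable
  finally show ?thesis .
qed

lemma emeasure_hyperplane_hausdorff:
  fixes k :: "'a::euclidean_space"
  assumes [measurable]: "A \<in> sets borel"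
  shows "emeasure (hyperplane_hausdorff k) A = \<H> (A \<inter> {x. x \<bullet> k = 0})"
proof -
  have "emeasure (hyperplane_hausdorff k) A
    = (\<integral>\<^sup>+ x. indicator (A \<inter> {x. x \<bullet> k = 0}) x \<partial>hausdorff_measure (DIM('a) - 1))"
    unfolding hyperplane_hausdorff_def
    by (subst emeasure_density, simp, simp, intro nn_integral_cong) (auto simp: indicator_def)
  also have "\<dots> = \<H> (A \<inter> {x. x \<bullet> k = 0})"
    by (subst nn_integral_indicator) (auto simp: emeasure_hausdorff_measure)
  finally show ?thesis .
qed

text \<open>The cube is cut into \<open>N ^ (DIM('a) - 1)\<close> boxes of side 1 /
  \<open>N\<close>. The number of boxes cancels the power of \<open>N\<close> in their weights, so
  the bound does not depend on \<delta>. Diameters are estimated crudely by the sum of the side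
  lengths, since only finiteness matters.\<close>

lemma hausdorff_outer_unit_cube_finite:
  fixes k :: "'a::euclidean_space"
  assumes k: "k \<in> Basis"
  shows "hausdorff_outer (DIM('a) - 1) {x. x \<bullet> k = 0 \<and> (\<forall>i\<in>Basis - {k}. 0 \<le> x \<bullet> i \<and> x \<bullet> i \<le> 1)} < top"
    (is "hausdorff_outer ?n ?Q < _")
proof -
  have "hausdorff_content ?n \<delta> ?Q \<le> ennreal (unit_ball_vol (real ?n) * (real DIM('a) / 2) ^ ?n)"
    if \<delta>: "\<delta> > 0" for \<delta>
  proof -
    obtain N :: nat where N: "real DIM('a) / \<delta> < real N" using reals_Archimedean2 by blast
    have "0 < real DIM('a) / \<delta>" using \<delta> by simp
    with N have N0: "0 < N" by (metis of_nat_0_less_iff order_less_trans)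
    have N\<delta>: "real DIM('a) / real N \<le> \<delta>" using N \<delta> N0 by (simp add: field_simps)
    define I where "I = (\<Pi>\<^sub>E i\<in>Basis - {k}. {..<N})"
    define C where "C f = {x::'a. x \<bullet> k = 0 \<and> (\<forall>i\<in>Basis - {k}. real (f i) / N \<le> x \<bullet> i \<and> x \<bullet> i \<le> (real (f i) + 1) / N)}"
      for f :: "'a \<Rightarrow> nat"
    have norm_C: "norm (x - y) \<le> real DIM('a) / N" if "x \<in> C f" "y \<in> C f" for x y f
    proof -
      have "norm (x - y) \<le> (\<Sum>b\<in>Basis. \<bar>(x - y) \<bullet> b\<bar>)" by (rule norm_le_l1)
      also have "\<dots> \<le> (\<Sum>b\<in>(Basis::'a set). 1 / N)"
      proof (rule sum_mono)
        fix b :: 'a assume b: "b \<in> Basis"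
        show "\<bar>(x - y) \<bullet> b\<bar> \<le> 1 / N"
        proof (cases "b = k")
          case False
          then have "real (f b) / N \<le> x \<bullet> b" "x \<bullet> b \<le> (real (f b) + 1) / N"
            "real (f b) / N \<le> y \<bullet> b" "y \<bullet> b \<le> (real (f b) + 1) / N"
            using that b by (auto simp: C_def)
          then show ?thesis unfolding inner_diff_left add_divide_distrib by linarith
        qed (use that in \<open>auto simp: C_def inner_diff_left\<close>)
      qed
      also have "\<dots> = real DIM('a) / N" by simp
      finally show ?thesis .
    qed
    have diam_C: "diameter (C f) \<le> real DIM('a) / N" for f
      by (rule diameter_le) (use norm_C in auto)
    have bdd_C: "bounded (C f)" for f
      unfolding bounded_two_points by (intro exI[of _ "real DIM('a) / N"]) (auto simp: dist_norm norm_C)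
    have "hausdorff_content ?n \<delta> ?Q \<le> (\<Sum>f\<in>I. hausdorff_weight ?n (C f))"
    proof (rule hausdorff_content_finite_cover)
      show "finite I" unfolding I_def by (intro finite_PiE) auto
      show "?Q \<subseteq> (\<Union>f\<in>I. C f)"
      proof
        fix x assume x: "x \<in> ?Q"
        \<comment> \<open>The minimum with \<open>N - 1\<close> puts points with a coordinate equal
          to 1 into the last box; the floor alone would give the index \<open>N\<close>.\<close>
        define f where "f = restrict (\<lambda>i. min (N - 1) (nat \<lfloor>N * (x \<bullet> i)\<rfloor>)) (Basis - {k})"
        have "f \<in> I" using N0 by (auto simp: f_def I_def)
        moreover have "x \<in> C f"
        proof -
          have "real (f i) / N \<le> x \<bullet> i \<and> x \<bullet> i \<le> (real (f i) + 1) / N" if i: "i \<in> Basis - {k}" for i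
          proof -
            have xi: "0 \<le> x \<bullet> i" "x \<bullet> i \<le> 1" using x i by auto
            define t where "t = N * (x \<bullet> i)"
            have t: "0 \<le> t" "t \<le> N" using xi N0 by (auto simp: t_def mult_left_le)
            have fi: "f i = min (N - 1) (nat \<lfloor>t\<rfloor>)" using i by (simp add: f_def t_def)
            have "real (f i) \<le> real (nat \<lfloor>t\<rfloor>)" by (simp add: fi)
            also have "\<dots> \<le> t" using t by simp
            finally have 1: "real (f i) \<le> t" .
            have 2: "t \<le> real (f i) + 1"
            proof (cases "nat \<lfloor>t\<rfloor> \<le> N - 1")
              case True
              then have "f i = nat \<lfloor>t\<rfloor>" by (simp add: fi)
              then show ?thesis using t by linarith
            next
              case False
              then have "f i = N - 1" by (simp add: fi)
              then show ?thesis using t N0 by simp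
            qed
            have "x \<bullet> i = t / N" using N0 by (simp add: t_def)
            then show ?thesis using 1 2 N0 by (simp add: divide_right_mono)
          qed
          then show ?thesis using x by (simp add: C_def)
        qed
        ultimately show "x \<in> (\<Union>f\<in>I. C f)" by blast
      qed
      show "bounded (C f) \<and> diameter (C f) \<le> \<delta>" for f
        using bdd_C diam_C N\<delta> by (auto intro: order_trans)
    qed (use \<delta> in simp)
    also have "\<dots> \<le> (\<Sum>f\<in>I. ennreal (unit_ball_vol (real ?n) * (real DIM('a) / N / 2) ^ ?n))"
    proof (rule sum_mono)
      fix f
      have "(diameter (C f) / 2) ^ ?n \<le> (real DIM('a) / N / 2) ^ ?n"
        using diam_C[of f] diameter_ge_0[OF bdd_C[of f]] by (intro power_mono divide_right_mono) auto
      then show "hausdorff_weight ?n (C f) \<le> ennreal (unit_ball_vol (real ?n) * (real DIM('a) / N / 2) ^ ?n)"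
        by (auto simp: hausdorff_weight_def intro!: ennreal_leI mult_left_mono)
    qed
    also have "\<dots> = ennreal (real (card I) * (unit_ball_vol (real ?n) * (real DIM('a) / N / 2) ^ ?n))"
      by (simp add: ennreal_mult ennreal_of_nat_eq_real_of_nat)
    also have "card I = N ^ ?n"
      using k by (simp add: I_def card_PiE card_Diff_singleton)
    also have "real (N ^ ?n) * (unit_ball_vol (real ?n) * (real DIM('a) / N / 2) ^ ?n)
        = unit_ball_vol (real ?n) * (real DIM('a) / 2) ^ ?n"
      using N0 by (simp add: power_divide)
    finally show ?thesis .
  qed
  then have "hausdorff_outer ?n ?Q \<le> ennreal (unit_ball_vol (real ?n) * (real DIM('a) / 2) ^ ?n)"
    unfolding hausdorff_outer_def by (intro SUP_least) auto
  also have "\<dots> < top" by simp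
  finally show ?thesis .
qed

lemma hausdorff_outer_coordinate_hyperplane_finite:
  fixes k :: "'a::euclidean_space"
  assumes k: "k \<in> Basis" and A: "bounded A" "A \<subseteq> {x. x \<bullet> k = 0}"
  shows "\<H> A < top"
proof -
  obtain m where m: "m > 0" "\<And>x. x \<in> A \<Longrightarrow> norm x \<le> m"
    using A by (auto simp: bounded_pos)
  \<comment> \<open>Maps each coordinate from [-\<open>m\<close>, \<open>m\<close>] to [0, 1],
    except coordinate \<open>k\<close>, which has to remain 0.\<close>
  define g where "g x = (1 / (2*m)) *\<^sub>R (x + m *\<^sub>R (One - k))" for x
  have gd: "g x - g y = (1 / (2*m)) *\<^sub>R (x - y)" for x y
    by (simp add: g_def scaleR_diff_right[symmetric] del: scaleR_diff_right)
  have "\<H> ((\<lambda>x. x) ` A) \<le> ennreal ((2*m) ^ (DIM('a) - 1)) * \<H> (g ` A)"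
    by (rule hausdorff_outer_dominated) (use m in \<open>auto simp: dist_norm gd\<close>)
  also have "\<dots> \<le> ennreal ((2*m) ^ (DIM('a) - 1)) *
      \<H> {x. x \<bullet> k = 0 \<and> (\<forall>i\<in>Basis - {k}. 0 \<le> x \<bullet> i \<and> x \<bullet> i \<le> 1)}"
  proof (intro mult_left_mono hausdorff_outer_mono subsetI CollectI conjI ballI)
    fix z assume "z \<in> g ` A"
    then obtain x where x: "x \<in> A" "z = g x" by auto
    show "z \<bullet> k = 0"
      using x A k by (auto simp: g_def inner_add_left inner_diff_left inner_Basis)
    fix i assume i: "i \<in> Basis - {k}"
    have "z \<bullet> i = (x \<bullet> i + m) / (2*m)"
      unfolding x(2) g_def using k i by (auto simp: inner_add_left inner_diff_left inner_Basis)
    moreover have "\<bar>x \<bullet> i\<bar> \<le> m"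
      using m(2)[OF x(1)] Basis_le_norm[of i x] i by auto
    ultimately show "0 \<le> z \<bullet> i" "z \<bullet> i \<le> 1" using m(1) by (auto simp: abs_le_iff)
  qed simp
  also have "\<dots> < top"
    using hausdorff_outer_unit_cube_finite[OF k] by (simp add: ennreal_mult_less_top)
  finally show ?thesis by simp
qed

text \<open>A covering set of diameter \<open>d\<close> lies over a box of side 2 \<open>d\<close>
  around one of its points. Comparing (2 \<open>d\<close>) with the \<open>d\<close> / 2 in the
  Hausdorff weight produces the factor 1/4 per dimension. The bound shows that Hausdorff measure is
  nonzero on discs in hyperplanes.\<close>

lemma slab_measure_le_hausdorff_outer:
  fixes k :: "'a::euclidean_space"
  assumes k: "k \<in> Basis" and A: "A \<in> sets borel" "A \<subseteq> {x. x \<bullet> k = 0}"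
  shows "ennreal (unit_ball_vol (real (DIM('a) - 1)) * (1/4) ^ (DIM('a) - 1)) * emeasure (slab_measure k) A
      \<le> \<H> A"
proof -
  let ?n = "DIM('a) - 1"
  let ?c = "unit_ball_vol (real ?n) * (1/4) ^ ?n"
  have "ennreal ?c * emeasure (slab_measure k) A \<le> (\<Sum>i. hausdorff_weight ?n (C i))"
    if C: "C \<in> hausdorff_covers 1 A" for C
  proof -
    have bC: "bounded (C i)" for i using C by (auto simp: hausdorff_covers_def)
    define a where "a i = (SOME x. x \<in> C i)" for i
    have a: "a i \<in> C i" if "C i \<noteq> {}" for i
      using that by (auto simp: a_def some_in_eq)
    define d where "d i = diameter (C i)" for i
    have d0: "0 \<le> d i" for i using diameter_ge_0[OF bC] by (simp add: d_def)
    define l where "l i = (\<Sum>b\<in>Basis. (if b = k then 0 else a i \<bullet> b - d i) *\<^sub>R b)" for i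
    define u where "u i = (\<Sum>b\<in>Basis. (if b = k then 1 else a i \<bullet> b + d i) *\<^sub>R b)" for i
    define X where "X i = (if C i = {} then {} else cbox (l i) (u i))" for i
    have lb: "l i \<bullet> b = (if b = k then 0 else a i \<bullet> b - d i)" if "b \<in> Basis" for i b
      using that by (simp add: l_def)
    have ub: "u i \<bullet> b = (if b = k then 1 else a i \<bullet> b + d i)" if "b \<in> Basis" for i b
      using that by (simp add: u_def)
    have vol: "emeasure lborel (X i) \<le> ennreal ((2 * d i) ^ ?n)" for i
    proof (cases "C i = {}")
      case False
      have "(\<Prod>b\<in>Basis. (u i - l i) \<bullet> b) = (\<Prod>b\<in>Basis. if b = k then 1 else 2 * d i)"
        by (intro prod.cong) (auto simp: inner_diff_left lb ub)
      also have "\<dots> = (2 * d i) ^ ?n"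
        using k by (simp add: prod.If_cases card_Diff_singleton Diff_eq[symmetric] Collect_neg_eq[symmetric] Collect_conv_if)
      finally show ?thesis
        using False d0[of i] by (auto simp: X_def emeasure_lborel_cbox_eq)
    qed (simp add: X_def)
    have sub: "(slab_over k A) \<subseteq> (\<Union>i. X i)"
    proof
      fix x assume x: "x \<in> (slab_over k A)"
      then obtain i where i: "x - (x \<bullet> k) *\<^sub>R k \<in> C i"
        using C by (fastforce simp: hausdorff_covers_def)
      then have ne: "C i \<noteq> {}" by auto
      have "x \<in> cbox (l i) (u i)"
        unfolding mem_box
      proof
        fix b :: 'a assume b: "b \<in> Basis"
        show "l i \<bullet> b \<le> x \<bullet> b \<and> x \<bullet> b \<le> u i \<bullet> b"
        proof (cases "b = k")
          case False
          have "\<bar>(x - (x \<bullet> k) *\<^sub>R k - a i) \<bullet> b\<bar> \<le> norm (x - (x \<bullet> k) *\<^sub>R k - a i)"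
            using b by (rule Basis_le_norm)
          also have "\<dots> \<le> d i"
            using diameter_bounded_bound[OF bC[of i] i a[OF ne]] by (simp add: d_def dist_norm)
          finally show ?thesis
            using b k False by (auto simp: lb ub inner_diff_left inner_Basis)
        qed (use x b in \<open>auto simp: lb ub\<close>)
      qed
      then show "x \<in> (\<Union>i. X i)" using ne by (auto simp: X_def)
    qed
    have "emeasure (slab_measure k) A \<le> emeasure lborel (\<Union>i. X i)"
      unfolding emeasure_slab_measure[OF A(1)] by (rule emeasure_mono[OF sub]) (auto simp: X_def)
    also have "\<dots> \<le> (\<Sum>i. emeasure lborel (X i))"
      by (rule emeasure_subadditive_countably) (auto simp: X_def)
    finally have "ennreal ?c * emeasure (slab_measure k) A \<le> ennreal ?c * (\<Sum>i. emeasure lborel (X i))"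
      by (rule mult_left_mono) simp
    also have "\<dots> = (\<Sum>i. ennreal ?c * emeasure lborel (X i))"
      by (rule ennreal_suminf_cmult[symmetric])
    also have "\<dots> \<le> (\<Sum>i. hausdorff_weight ?n (C i))"
    proof (rule suminf_le)
      fix i
      show "ennreal ?c * emeasure lborel (X i) \<le> hausdorff_weight ?n (C i)"
      proof (cases "C i = {}")
        case False
        have "ennreal ?c * emeasure lborel (X i) \<le> ennreal ?c * ennreal ((2 * d i) ^ ?n)"
          by (intro mult_left_mono vol) simp
        also have "\<dots> = ennreal (unit_ball_vol (real ?n) * ((1/4) ^ ?n * (2 * d i) ^ ?n))"
          using d0[of i] by (simp add: ennreal_mult[symmetric] mult.assoc)
        also have "(1/4) ^ ?n * (2 * d i) ^ ?n = (d i / 2) ^ ?n"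
          unfolding power_mult_distrib[symmetric] by simp
        finally show ?thesis using False by (simp add: hausdorff_weight_def d_def)
      qed (simp add: X_def)
    qed auto
    finally show ?thesis .
  qed
  then have "ennreal ?c * emeasure (slab_measure k) A \<le> hausdorff_content ?n 1 A"
    unfolding hausdorff_content_def by (rule INF_greatest)
  also have "\<dots> \<le> \<H> A" by (rule hausdorff_content_le_outer) simp
  finally show ?thesis .
qed

lemma slab_measure_bounded_finite:
  fixes k :: "'a::euclidean_space"
  assumes "norm k = 1" "bounded A" "A \<in> sets borel"
  shows "emeasure (slab_measure k) A < top"
proof -
  obtain m where m: "\<And>x. x \<in> A \<Longrightarrow> norm x \<le> m"
    using assms by (auto simp: bounded_iff)
  have "(slab_over k A) \<subseteq> cball 0 (m + 1)"
  proof
    fix x assume x: "x \<in> (slab_over k A)"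
    have "norm x \<le> norm (x - (x \<bullet> k) *\<^sub>R k) + norm ((x \<bullet> k) *\<^sub>R k)"
      using norm_triangle_ineq[of "x - (x \<bullet> k) *\<^sub>R k" "(x \<bullet> k) *\<^sub>R k"] by simp
    also have "\<dots> \<le> m + 1" using x m assms by (intro add_mono) auto
    finally show "x \<in> cball 0 (m + 1)" by simp
  qed
  then have "emeasure (slab_measure k) A \<le> emeasure lborel (cball (0::'a) (m + 1))"
    unfolding emeasure_slab_measure[OF assms(3)] by (rule emeasure_mono) simp
  also have "\<dots> < top"
    using emeasure_lborel_cball_finite[of "0::'a" "m+1"] by simp
  finally show ?thesis .
qed

lemma sigma_finite_if_bounded_finite:
  fixes M :: "'a::euclidean_space measure"
  assumes "sets M = sets borel" "\<And>A. A \<in> sets borel \<Longrightarrow> bounded A \<Longrightarrow> emeasure M A < top"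
  shows "sigma_finite_measure M"
proof
  have "(\<Union>m::nat. cball (0::'a) (real m)) = UNIV"
    using real_arch_simple by (auto simp: set_eq_iff)
  moreover have "emeasure M (cball 0 (real m)) \<noteq> \<infinity>" for m
    using assms(2)[of "cball 0 (real m)"] by auto
  ultimately show "\<exists>A. countable A \<and> A \<subseteq> sets M \<and> \<Union>A = space M \<and> (\<forall>a\<in>A. emeasure M a \<noteq> \<infinity>)"
    using sets_eq_imp_space_eq[OF assms(1)] assms(1)
    by (intro exI[of _ "range (\<lambda>m::nat. cball 0 (real m))"]) auto
qed

text \<open>The constant is never evaluated. It is read off from one symmetric cube
  \<open>B\<close>, for which division only requires that its slab measure be neither 0 nor
  infinite.\<close>

lemma hausdorff_proportional_slab_measure:
  fixes k :: "'a::euclidean_space"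
  assumes k: "k \<in> Basis"
  shows "\<exists>\<kappa>. \<forall>A. A \<in> sets borel \<and> A \<subseteq> {x. x \<bullet> k = 0} \<longrightarrow>
      \<H> A = \<kappa> * emeasure (slab_measure k) A"
proof -
  let ?E = "{x. x \<bullet> k = 0}"
  define B :: "'a set" where "B = cbox (- One) One"
  have B: "B \<in> sets borel" "bounded B" by (auto simp: B_def)
  have Bsym: "- x \<in> B \<longleftrightarrow> x \<in> B" for x by (auto simp: B_def mem_box)
  have nk: "norm k = 1" using k by simp
  let ?b = "emeasure (slab_measure k) B"
  \<comment> \<open>This box has side [0, 1] in direction \<open>k\<close> and [-1, 1] in all
    others, hence lies in the slab over \<open>B\<close> and has volume at least 1.\<close>
  have "ennreal 1 \<le> emeasure lborel (cbox (k - One) One)"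
  proof -
    have "(\<Prod>b\<in>Basis. (One - (k - One)) \<bullet> b) \<ge> (1::real)"
      by (rule prod_ge_1) (use k in \<open>auto simp: inner_diff_left inner_Basis\<close>)
    moreover have "\<forall>b\<in>Basis. (k - One) \<bullet> b \<le> (One::'a) \<bullet> b"
      using k by (auto simp: inner_diff_left inner_Basis)
    ultimately show ?thesis unfolding emeasure_lborel_cbox_eq by (intro ennreal_leI) (subst if_P, assumption+)
  qed
  also have "\<dots> \<le> ?b"
    unfolding emeasure_slab_measure[OF B(1)]
  proof (rule emeasure_mono)
    show "cbox (k - One) One \<subseteq> (slab_over k B)"
    proof
      fix x assume x: "x \<in> cbox (k - One) (One::'a)"
      then have xb: "(k - One) \<bullet> b \<le> x \<bullet> b \<and> x \<bullet> b \<le> One \<bullet> b" if "b \<in> Basis" for b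
        using that by (simp add: mem_box)
      have "0 \<le> x \<bullet> k" "x \<bullet> k \<le> 1"
        using xb[OF k] k by (auto simp: inner_diff_left)
      moreover have "x - (x \<bullet> k) *\<^sub>R k \<in> B"
        unfolding B_def mem_box
      proof
        fix b :: 'a assume b: "b \<in> Basis"
        show "- One \<bullet> b \<le> (x - (x \<bullet> k) *\<^sub>R k) \<bullet> b \<and> (x - (x \<bullet> k) *\<^sub>R k) \<bullet> b \<le> One \<bullet> b"
          using xb[OF b] b k by (cases "b = k") (auto simp: inner_diff_left inner_Basis)
      qed
      ultimately show "x \<in> (slab_over k B)" by simp
    qed
    have [measurable]: "B \<in> sets borel" by fact
    show "(slab_over k B) \<in> sets lborel" by measurable
  qed
  finally have b0: "?b \<noteq> 0" by auto
  have bfin: "?b \<noteq> top"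
    using slab_measure_bounded_finite[OF nk B(2,1)] by simp
  have "emeasure (hyperplane_hausdorff k) A * ?b = emeasure (slab_measure k) A * emeasure (hyperplane_hausdorff k) B"
    if A: "A \<in> sets borel" for A
  proof (rule invariant_measures_proportional[where E = ?E])
    show "sigma_finite_measure (hyperplane_hausdorff k)"
      by (rule sigma_finite_if_bounded_finite)
         (auto simp: emeasure_hyperplane_hausdorff bounded_Int
            simp del: One_nat_def intro!: hausdorff_outer_coordinate_hyperplane_finite[OF k])
    show "sigma_finite_measure (slab_measure k)"
      by (rule sigma_finite_if_bounded_finite) (auto intro: slab_measure_bounded_finite[OF nk])
    show "AE x in hyperplane_hausdorff k. x \<in> ?E"
      unfolding hyperplane_hausdorff_def by (subst AE_density) (auto simp: indicator_def)
    have "AE x in density lborel (indicator {x. 0 \<le> x \<bullet> k \<and> x \<bullet> k \<le> 1}). (x - (x \<bullet> k) *\<^sub>R k) \<bullet> k = 0"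
      using k by (intro AE_I2) (simp add: inner_diff_left)
    then show "AE x in slab_measure k. x \<in> ?E"
      unfolding slab_measure_def by (subst AE_distr_iff) auto
  qed (use A B Bsym hyperplane_hausdorff_invariant slab_measure_invariant in auto)
  note proportional = this
  show ?thesis
  proof (intro exI[of _ "emeasure (hyperplane_hausdorff k) B / ?b"] allI impI)
    fix A assume "A \<in> sets borel \<and> A \<subseteq> ?E"
    then have A: "A \<in> sets borel" "A \<subseteq> ?E" by auto
    have "\<H> A = emeasure (hyperplane_hausdorff k) A * ?b / ?b"
      using A b0 bfin by (simp add: emeasure_hyperplane_hausdorff Int_absorb2 ennreal_mult_divide_eq)
    also have "\<dots> = emeasure (hyperplane_hausdorff k) B / ?b * emeasure (slab_measure k) A"
      unfolding proportional[OF A(1)] by (simp add: ennreal_times_divide mult.commute)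
    finally show "\<H> A = emeasure (hyperplane_hausdorff k) B / ?b * emeasure (slab_measure k) A" .
  qed
qed

text \<open>Lipschitz estimates would only bound the effect of stretching a single coordinate. The
  exact factor is that of Lebesgue measure on the slab, and it carries over because the
  proportionality constant cancels.\<close>

lemma hausdorff_outer_scale_coordinate:
  fixes j k :: "'a::euclidean_space"
  assumes jk: "j \<in> Basis" "k \<in> Basis" "j \<noteq> k" and c: "0 < c"
    and A: "A \<in> sets borel" "A \<subseteq> {x. x \<bullet> k = 0}"
  shows "\<H> ((\<lambda>x. x + ((c - 1) * (x \<bullet> j)) *\<^sub>R j) ` A)
      = ennreal c * \<H> A"
proof -
  obtain \<kappa> where \<kappa>: "\<And>A. A \<in> sets borel \<Longrightarrow> A \<subseteq> {x. x \<bullet> k = 0} \<Longrightarrow>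
      \<H> A = \<kappa> * emeasure (slab_measure k) A"
    using hausdorff_proportional_slab_measure[OF jk(2)] by blast
  define D where "D c x = x + ((c - 1) * (x \<bullet> j)) *\<^sub>R j" for c and x :: 'a
  have Dj: "D c x \<bullet> j = c * (x \<bullet> j)" for c x
    using jk by (simp add: D_def inner_add_left algebra_simps)
  have DD: "D (1/b) (D b x) = x" if "b > 0" for b x
  proof -
    have "(b - 1) * (x \<bullet> j) + (1 / b - 1) * (b * (x \<bullet> j)) = 0"
      using that by (simp add: field_simps)
    then show ?thesis
      by (simp add: D_def[of "1 / b"] Dj) (simp add: D_def add.assoc flip: scaleR_add_left)
  qed
  have Dinv: "D (1/c) (D c x) = x" "D c (D (1/c) x) = x" for x
    using DD[of c x] DD[of "1/c" x] c by simp_all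
  have Dk: "D c x \<bullet> k = x \<bullet> k" for c x
    using jk by (simp add: D_def inner_add_left inner_Basis)
  have DP: "D c (x - (x \<bullet> k) *\<^sub>R k) = D c x - (x \<bullet> k) *\<^sub>R k" for c x
    using jk by (simp add: D_def inner_diff_left inner_Basis)
  have im: "D c ` X = D (1/c) -` X" for X
  proof (intro set_eqI iffI)
    fix x assume "x \<in> D (1/c) -` X"
    then show "x \<in> D c ` X" using Dinv(2)[of x] by (metis imageI vimage_eq)
  qed (use Dinv(1) in auto)
  have [measurable]: "D c \<in> borel_measurable borel" for c unfolding D_def by measurable
  have [measurable]: "A \<in> sets borel" by fact
  define X where "X = (slab_over k A)"
  have X [measurable]: "X \<in> sets borel" unfolding X_def by measurable
  have DA: "D c ` A \<in> sets borel"
    unfolding im using measurable_sets[of "D (1/c)" borel borel A] by simp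
  have DX: "D c ` X \<in> sets borel"
    unfolding im using measurable_sets[of "D (1/c)" borel borel X] by simp
  have XD: "(slab_over k (D c ` A)) = D c ` X"
    unfolding im by (auto simp: X_def Dk DP)
  have T: "(\<Sum>i\<in>Basis. ((if i = j then c else 1) * (x \<bullet> i)) *\<^sub>R i) = D c x" for x
  proof (rule euclidean_eqI)
    fix b :: 'a assume "b \<in> Basis"
    then show "(\<Sum>i\<in>Basis. ((if i = j then c else 1) * (x \<bullet> i)) *\<^sub>R i) \<bullet> b = D c x \<bullet> b"
      using jk by (auto simp: Dj) (auto simp: D_def inner_add_left inner_Basis)
  qed
  have lb: "lborel = density (distr lborel borel (D c)) (\<lambda>_. ennreal c)"
  proof -
    have "c' \<noteq> 0" if "c' = (if i = j then c else 1)" for c' i using that c by auto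
    then show ?thesis
      using lborel_affine_euclidean[of "\<lambda>i. if i = j then c else 1" 0] c jk by (simp add: T)
  qed
  have "emeasure lborel (D c ` X) = emeasure (density (distr lborel borel (D c)) (\<lambda>_. ennreal c)) (D c ` X)"
    using arg_cong[OF lb, of "\<lambda>M. emeasure M (D c ` X)"] .
  also have "\<dots> = ennreal c * emeasure lborel (D c -` (D c ` X))"
    using DX by (simp add: emeasure_density nn_integral_cmult emeasure_distr)
  also have "D c -` (D c ` X) = X"
    by (rule inj_vimage_image_eq) (metis Dinv(1) injI)
  finally have "emeasure (slab_measure k) (D c ` A) = ennreal c * emeasure (slab_measure k) A"
    unfolding emeasure_slab_measure[OF DA] emeasure_slab_measure[OF A(1)] XD X_def .
  moreover have "D c ` A \<subseteq> {x. x \<bullet> k = 0}" using A by (auto simp: Dk)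
  ultimately have "\<H> (D c ` A) = ennreal c * \<H> A"
    using \<kappa>[OF DA] \<kappa>[OF A] by (simp add: mult.left_commute)
  then show ?thesis by (simp add: D_def[abs_def])
qed

section \<open>Orthogonal transformations and projections of hyperplanes\<close>

text \<open>The witness is the reflection in the hyperplane orthogonal to \<open>a - b\<close>. That
  it fixes everything orthogonal to both vectors allows a second reflection to leave an already
  placed vector alone.\<close>

lemma reflection_exists:
  fixes a b :: "'a::euclidean_space"
  assumes "norm a = norm b"
  obtains R where "orthogonal_transformation R" "R a = b"
    "\<And>x. x \<bullet> a = 0 \<Longrightarrow> x \<bullet> b = 0 \<Longrightarrow> R x = x"
proof (cases "a = b")
  case True
  then show ?thesis by (intro that[of id]) (auto simp: orthogonal_transformation_def linear_iff)
next
  case False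
  define q where "q = a - b"
  have q: "q \<bullet> q \<noteq> 0" using False by (simp add: q_def)
  have aa: "a \<bullet> a = b \<bullet> b" using assms by (simp add: norm_eq)
  define R where "R x = x - (2 * (x \<bullet> q) / (q \<bullet> q)) *\<^sub>R q" for x
  show ?thesis
  proof (rule that[of R])
    have "linear R"
      by (rule linearI) (simp_all add: R_def inner_add_left add_divide_distrib algebra_simps)
    moreover have "R x \<bullet> R y = x \<bullet> y" for x y
      using q by (simp add: R_def inner_diff_left inner_diff_right inner_commute field_simps)
    ultimately show "orthogonal_transformation R" by (simp add: orthogonal_transformation_def)
    have "q \<bullet> q = 2 * (a \<bullet> q)" using aa by (simp add: q_def inner_diff_left inner_diff_right inner_commute)
    then have "2 * (a \<bullet> q) / (q \<bullet> q) = 1" using q by (metis divide_self)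
    then have "R a = a - 1 *\<^sub>R q" by (simp only: R_def)
    then show "R a = b" by (simp add: q_def)
    show "R x = x" if "x \<bullet> a = 0" "x \<bullet> b = 0" for x
      using that by (simp add: R_def q_def inner_diff_right)
  qed
qed

text \<open>Two vectors suffice for the later use: projecting one hyperplane to another distorts a
  single direction. The first reflection places \<open>k\<close>; the second, applied before it,
  turns \<open>j\<close> to the preimage of \<open>v\<close> and fixes \<open>k\<close>.\<close>

lemma orthogonal_frame_exists:
  fixes u v j k :: "'a::euclidean_space"
  assumes "norm u = 1" "norm v = 1" "u \<bullet> v = 0" "j \<in> Basis" "k \<in> Basis" "j \<noteq> k"
  obtains R where "orthogonal_transformation R" "R k = u" "R j = v"
proof -
  obtain R1 where R1: "orthogonal_transformation R1" "R1 k = u"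
    using reflection_exists[of k u] assms by auto
  have inv1: "orthogonal_transformation (inv R1)"
    using R1(1) by (rule orthogonal_transformation_inv)
  have R1i: "R1 (inv R1 x) = x" "inv R1 (R1 x) = x" for x
    using R1(1) by (simp_all add: orthogonal_transformation_surj surj_f_inv_f orthogonal_transformation_inj)
  have "inv R1 v \<bullet> k = inv R1 v \<bullet> inv R1 u" using R1 R1i by metis
  also have "\<dots> = 0" using inv1 assms by (simp add: orthogonal_transformation_def inner_commute)
  finally have vk: "k \<bullet> inv R1 v = 0" by (simp add: inner_commute)
  have "norm j = norm (inv R1 v)"
    using inv1 assms by (simp add: orthogonal_transformation_norm)
  then obtain R2 where R2: "orthogonal_transformation R2" "R2 j = inv R1 v"
    "\<And>x. x \<bullet> j = 0 \<Longrightarrow> x \<bullet> inv R1 v = 0 \<Longrightarrow> R2 x = x"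
    using reflection_exists by blast
  have "R2 k = k" using R2(3) vk assms by (simp add: inner_Basis)
  then show ?thesis
    using R1 R2 R1i by (intro that[of "R1 \<circ> R2"]) (auto intro: orthogonal_transformation_compose)
qed

lemma orthogonal_transformation_dist:
  fixes R :: "'a::real_inner \<Rightarrow> 'a"
  shows
  "orthogonal_transformation R \<Longrightarrow> dist (R x) (R y) = dist x y"
  by (meson orthogonal_transformation_isometry)

lemma hausdorff_outer_orthogonal_image:
  fixes R :: "'a::real_inner \<Rightarrow> 'a"
  assumes "orthogonal_transformation R"
  shows "hausdorff_outer n (R ` A) = hausdorff_outer n A"
  using hausdorff_outer_isometric_images[of A R "\<lambda>x. x" n] orthogonal_transformation_dist[OF assms]
  by simp

lemma hausdorff_outer_hyperplane_finite:
  fixes u :: "'a::euclidean_space"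
  assumes u: "norm u = 1" and A: "bounded A" "A \<subseteq> {x. x \<bullet> u = 0}"
  shows "\<H> A < top"
proof -
  obtain k :: 'a where k: "k \<in> Basis" using nonempty_Basis by blast
  obtain R where R: "orthogonal_transformation R" "R u = k"
    using reflection_exists[of u k] u k by auto
  have "\<H> (R ` A) < top"
  proof (rule hausdorff_outer_coordinate_hyperplane_finite[OF k])
    show "bounded (R ` A)"
      using A R by (simp add: bounded_iff orthogonal_transformation_norm)
    show "R ` A \<subseteq> {x. x \<bullet> k = 0}"
      using A R unfolding orthogonal_transformation_def by force
  qed
  then show ?thesis using R by (simp add: hausdorff_outer_orthogonal_image)
qed

text \<open>After a rotation to a coordinate hyperplane, the slab over the disc contains a nonempty
  open set.\<close>

lemma hausdorff_outer_hyperplane_positive: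
  fixes u a :: "'a::euclidean_space"
  assumes u: "norm u = 1" and a: "a \<bullet> u = 0" and r: "0 < r"
  shows "0 < \<H> {x. x \<bullet> u = 0 \<and> dist a x < r}"
proof -
  obtain k :: 'a where k: "k \<in> Basis" using nonempty_Basis by blast
  obtain R where R: "orthogonal_transformation R" "R u = k"
    using reflection_exists[of u k] u k by auto
  define b where "b = R a"
  have bk: "b \<bullet> k = 0" using R a unfolding orthogonal_transformation_def b_def by metis
  define B where "B = {x. x \<bullet> k = 0 \<and> dist b x < r}"
  have B: "B \<in> sets borel" unfolding B_def by measurable
  let ?X = "{x. 0 < x \<bullet> k \<and> x \<bullet> k < 1 \<and> dist b (x - (x \<bullet> k) *\<^sub>R k) < r}"
  have "open ?X"
    by (intro open_Collect_conj open_Collect_less continuous_intros)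
  moreover have "b + (1/2) *\<^sub>R k \<in> ?X"
    using bk k r by (simp add: inner_add_left)
  ultimately have "\<not> negligible ?X" by (intro open_not_negligible) auto
  then have "0 < emeasure lborel ?X"
    using \<open>open ?X\<close> by (auto simp: negligible_iff_emeasure0 zero_less_iff_neq_zero)
  also have "\<dots> \<le> emeasure (slab_measure k) B"
    unfolding emeasure_slab_measure[OF B]
  proof (rule emeasure_mono)
    show "?X \<subseteq> (slab_over k B)"
      using k by (auto simp: B_def inner_diff_left)
    have [measurable]: "B \<in> sets borel" by fact
    show "(slab_over k B) \<in> sets lborel" by measurable
  qed
  finally have pos: "0 < emeasure (slab_measure k) B" .
  have "0 < ennreal (unit_ball_vol (real (DIM('a) - 1)) * (1/4) ^ (DIM('a) - 1)) * emeasure (slab_measure k) B"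
    using pos by (simp add: ennreal_zero_less_mult_iff del: One_nat_def)
  also have "\<dots> \<le> \<H> B"
    by (rule slab_measure_le_hausdorff_outer[OF k B]) (auto simp: B_def)
  also have "B = R ` {x. x \<bullet> u = 0 \<and> dist a x < r}"
  proof -
    have "R x \<bullet> k = x \<bullet> u" for x using R unfolding orthogonal_transformation_def by metis
    moreover have "dist b (R x) = dist a x" for x
      using R by (simp add: b_def orthogonal_transformation_dist)
    ultimately show ?thesis
      using orthogonal_transformation_surj[OF R(1)] by (force simp: B_def image_iff surj_def)
  qed
  finally show ?thesis using R by (simp add: hausdorff_outer_orthogonal_image)
qed

text \<open>For a unit vector \<open>w\<close> this is the orthogonal projection along
  \<open>w\<close>. Up to the factor 1 / \<open>norm z\<close>, \<open>perp (sgn z)\<close> is also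
  the derivative of \<open>sgn\<close> at \<open>z\<close>.\<close>

definition perp :: "'a::real_inner \<Rightarrow> 'a \<Rightarrow> 'a" where
  "perp w x = x - (x \<bullet> w) *\<^sub>R w"

lemma perp_diff: "perp w (x - y) = perp w x - perp w y"
  by (simp add: perp_def inner_diff_left algebra_simps)

lemma norm_perp_sq: "norm w = 1 \<Longrightarrow> (norm (perp w x))\<^sup>2 = (norm x)\<^sup>2 - (x \<bullet> w)\<^sup>2"
  by (simp add: perp_def power2_norm_eq_inner inner_diff_left inner_diff_right norm_eq_1 inner_commute)
     (simp add: power2_eq_square algebra_simps)

lemma norm_perp_le: "norm w = 1 \<Longrightarrow> norm (perp w x) \<le> norm x"
  by (rule power2_le_imp_le) (auto simp: norm_perp_sq)

lemma continuous_on_perp: "continuous_on S (perp w)"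
  unfolding perp_def[abs_def] by (intro continuous_intros)

lemma perp_orthogonal: "norm w = 1 \<Longrightarrow> perp w x \<bullet> w = 0"
  by (simp add: perp_def inner_diff_left norm_eq_1)

text \<open>For \<open>x\<close> orthogonal to \<open>u\<close>, only the part of \<open>w\<close>
  tangential to that hyperplane contributes to \<open>x \<bullet> w\<close>, and its squared length
  is 1 - \<open>(u \<bullet> w)\<^sup>2\<close>. So |\<open>u \<bullet> w\<close>| is the strongest
  contraction that the projection can cause.\<close>

lemma norm_perp_ge:
  assumes "norm u = 1" "norm w = 1" "x \<bullet> u = 0"
  shows "\<bar>u \<bullet> w\<bar> * norm x \<le> norm (perp w x)"
proof (rule power2_le_imp_le)
  have "x \<bullet> w = x \<bullet> perp u w"
    using assms by (simp add: perp_def inner_diff_right)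
  then have "\<bar>x \<bullet> w\<bar> \<le> norm x * norm (perp u w)" by (simp add: Cauchy_Schwarz_ineq2)
  then have "\<bar>x \<bullet> w\<bar>\<^sup>2 \<le> (norm x * norm (perp u w))\<^sup>2" by (intro power_mono) auto
  also have "\<dots> = (norm x)\<^sup>2 * (1 - (u \<bullet> w)\<^sup>2)"
    using assms by (simp add: power_mult_distrib norm_perp_sq inner_commute)
  finally show "(\<bar>u \<bullet> w\<bar> * norm x)\<^sup>2 \<le> (norm (perp w x))\<^sup>2"
    using assms by (simp add: norm_perp_sq power_mult_distrib algebra_simps)
qed simp

text \<open>On the hyperplane orthogonal to \<open>u\<close>, \<open>perp w\<close> preserves
  lengths except in the direction \<open>v\<close> of the tangential part of \<open>w\<close>, where
  it shrinks by |\<open>u \<bullet> w\<close>|. In a frame with \<open>k\<close>, \<open>j\<close>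
  sent to \<open>u\<close>, \<open>v\<close> it is thus isometric to the scaling of one coordinate.
  If the tangential part vanishes, the projection is the identity there.\<close>

lemma hausdorff_outer_perp:
  fixes u w :: "'a::euclidean_space"
  assumes d: "2 \<le> DIM('a)" and u: "norm u = 1" and w: "norm w = 1" and c: "u \<bullet> w \<noteq> 0"
    and A: "A \<in> sets borel" "A \<subseteq> {x. x \<bullet> u = 0}"
  shows "\<H> (perp w ` A) = ennreal \<bar>u \<bullet> w\<bar> * \<H> A"
proof (cases "perp u w = 0")
  case True
  then have w': "w = (w \<bullet> u) *\<^sub>R u" by (simp add: perp_def)
  have "norm w = \<bar>w \<bullet> u\<bar> * norm u" by (subst w') simp
  then have 1: "\<bar>u \<bullet> w\<bar> = 1" using u w by (simp add: inner_commute)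
  have "perp w x = x" if "x \<in> A" for x
  proof -
    have "x \<bullet> w = (w \<bullet> u) * (x \<bullet> u)" by (subst w') simp
    then show ?thesis using that A by (auto simp: perp_def)
  qed
  then have "perp w ` A = A" by force
  then show ?thesis by (simp only: 1) simp
next
  case False
  define v where "v = sgn (perp u w)"
  have v: "norm v = 1" "u \<bullet> v = 0"
    using False perp_orthogonal[OF u, of w] by (simp_all add: v_def norm_sgn sgn_div_norm inner_commute)
  define c' where "c' = \<bar>u \<bullet> w\<bar>"
  have c': "0 < c'" using c by (simp add: c'_def)
  obtain k :: 'a where k: "k \<in> Basis" using nonempty_Basis by blast
  have "\<exists>j. j \<in> Basis - {k}"
    using d k card_Diff_singleton[of k "Basis :: 'a set"] card_gt_0_iff[of "Basis - {k}"] by auto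
  then obtain j where j: "j \<in> Basis" "j \<noteq> k" by blast
  obtain R where R: "orthogonal_transformation R" "R k = u" "R j = v"
    using orthogonal_frame_exists[OF u v(1) v(2) j(1) k j(2)] .
  have Rin: "R x \<bullet> R y = x \<bullet> y" for x y
    using R(1) by (simp add: orthogonal_transformation_def)
  have linR: "linear R" using R(1) by (simp add: orthogonal_transformation_def)
  define B where "B = R -` A"
  have RB: "R ` B = A"
    unfolding B_def using orthogonal_transformation_surj[OF R(1)] by (rule surj_image_vimage_eq)
  have [measurable]: "R \<in> borel_measurable borel"
    using linR by (intro borel_measurable_continuous_onI linear_continuous_on linear_conv_bounded_linear[THEN iffD1])
  have B: "B \<in> sets borel"
    unfolding B_def using measurable_sets[of R borel borel A] A by simp
  have Bk: "B \<subseteq> {x. x \<bullet> k = 0}"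
    using A(2) R(2) Rin by (force simp: B_def)
  let ?D = "\<lambda>x. x + ((c' - 1) * (x \<bullet> j)) *\<^sub>R j"
  have wn: "(perp u w \<bullet> perp u w) = 1 - c'\<^sup>2"
    using norm_perp_sq[OF u, of w] w by (simp add: power2_norm_eq_inner c'_def inner_commute norm_eq_1)
  have eq: "norm (perp w (R z)) = norm (?D z)" if "z \<bullet> k = 0" for z
  proof -
    have 1: "R z \<bullet> u = 0" using that Rin R(2) by metis
    then have "R z \<bullet> w = R z \<bullet> perp u w" by (simp add: perp_def inner_diff_right)
    also have "\<dots> = norm (perp u w) * (R z \<bullet> v)"
      using False by (simp add: v_def sgn_div_norm)
    also have "R z \<bullet> v = z \<bullet> j" using Rin R(3) by metis
    finally have "(R z \<bullet> w)\<^sup>2 = (1 - c'\<^sup>2) * (z \<bullet> j)\<^sup>2"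
      using wn by (simp add: power_mult_distrib power2_norm_eq_inner)
    then have "(norm (perp w (R z)))\<^sup>2 = (norm z)\<^sup>2 - (1 - c'\<^sup>2) * (z \<bullet> j)\<^sup>2"
      using orthogonal_transformation_norm[OF R(1), of z] by (simp add: norm_perp_sq[OF w])
    also have "\<dots> = (norm (?D z))\<^sup>2"
      using j by (simp add: power2_norm_eq_inner inner_add_left inner_add_right inner_commute)
         (simp add: power2_eq_square algebra_simps)
    finally show ?thesis by simp
  qed
  have "\<H> ((\<lambda>z. perp w (R z)) ` B) = \<H> (?D ` B)"
  proof (rule hausdorff_outer_isometric_images)
    fix x y assume "x \<in> B" "y \<in> B"
    then have "(x - y) \<bullet> k = 0" using subsetD[OF Bk, of x] subsetD[OF Bk, of y] by (simp add: inner_diff_left)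
    from eq[OF this] show "dist (perp w (R x)) (perp w (R y)) = dist (?D x) (?D y)"
      by (simp add: dist_norm linear_diff[OF linR] perp_diff inner_diff_left algebra_simps)
  qed
  also have "(\<lambda>z. perp w (R z)) ` B = perp w ` A" using RB by (metis image_image)
  also have "\<H> (?D ` B) = ennreal c' * \<H> B"
    by (rule hausdorff_outer_scale_coordinate[OF j(1) k j(2) c' B Bk])
  also have "\<H> B = \<H> A"
    using hausdorff_outer_orthogonal_image[OF R(1), of _ B] RB by simp
  finally show ?thesis by (simp add: c'_def)
qed

text \<open>On a compact set the inverse of a continuous injection is continuous, so the image is a
  preimage under a Borel map and no analytic sets are involved.\<close>

lemma borel_injective_image_compact:
  fixes g :: "'a::euclidean_space \<Rightarrow> 'b::euclidean_space"
  assumes K: "compact K" and g: "continuous_on K g" "inj_on g K" and A: "A \<in> sets borel" "A \<subseteq> K"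
  shows "g ` A \<in> sets borel"
proof -
  have "continuous_on (g ` K) (inv_into K g)"
    using g K by (intro continuous_on_inv) (auto simp: inv_into_f_f)
  then have "inv_into K g \<in> borel_measurable (restrict_space borel (g ` K))"
    by (rule borel_measurable_continuous_on_restrict)
  then have "inv_into K g -` A \<inter> space (restrict_space borel (g ` K)) \<in> sets (restrict_space borel (g ` K))"
    using A(1) by (rule measurable_sets)
  moreover have "inv_into K g -` A \<inter> g ` K = g ` A"
    using A(2) g(2) by (auto simp: inv_into_f_f subset_eq)
  moreover have gK: "g ` K \<in> sets borel"
    by (intro borel_compact compact_continuous_image g K)
  ultimately show ?thesis
    by (auto simp: space_restrict_space sets_restrict_space_iff)
qed

text \<open>The model for \<open>f\<close> is \<open>s *\<^sub>R perp w\<close> after projection to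
  the hyperplane orthogonal to \<open>u\<close>. In the condition on \<theta>, \<kappa> is the error
  of linearising \<open>f\<close>, \<open>s\<close> \<epsilon> the error of replacing a secant by
  its tangential part, and (1 - \<epsilon>) |\<open>u \<bullet> w\<close>| \<open>s\<close> the
  least stretch of the model on secants; so \<theta> is the error relative to the model. The upper
  bound also admits large \<theta>, which the tangential case exploits.\<close>

lemma hausdorff_outer_nearly_linear_image:
  fixes f :: "'a::euclidean_space \<Rightarrow> 'a"
  assumes d: "2 \<le> DIM('a)" and u: "norm u = 1" and w: "norm w = 1"
    and c: "u \<bullet> w \<noteq> 0" and s: "0 < s" and \<epsilon>: "0 \<le> \<epsilon>" "\<epsilon> < 1"
    and K: "compact K" and flat: "\<And>x y. x \<in> K \<Longrightarrow> y \<in> K \<Longrightarrow> \<bar>u \<bullet> (x - y)\<bar> \<le> \<epsilon> * norm (x - y)"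
    and A: "A \<in> sets borel" "A \<subseteq> K"
    and f: "\<And>x y. x \<in> K \<Longrightarrow> y \<in> K \<Longrightarrow> norm (f x - f y - s *\<^sub>R perp w (x - y)) \<le> \<kappa> * norm (x - y)"
    and \<theta>: "0 \<le> \<theta>" "\<kappa> + s * \<epsilon> \<le> \<theta> * ((1 - \<epsilon>) * \<bar>u \<bullet> w\<bar> * s)"
  shows "\<H> (f ` A)
      \<le> ennreal ((1 + \<theta>) ^ (DIM('a) - 1) * (s ^ (DIM('a) - 1) * \<bar>u \<bullet> w\<bar>)) * \<H> A"
    and "\<theta> < 1 \<Longrightarrow> ennreal ((1 - \<theta>) ^ (DIM('a) - 1) * (s ^ (DIM('a) - 1) * \<bar>u \<bullet> w\<bar>) * (1 - \<epsilon>) ^ (DIM('a) - 1))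
        * \<H> A \<le> \<H> (f ` A)"
proof -
  let ?n = "DIM('a) - 1" and ?c = "\<bar>u \<bullet> w\<bar>"
  define P where "P = perp u"
  have Pge: "(1 - \<epsilon>) * norm (x - y) \<le> norm (P x - P y)" if "x \<in> K" "y \<in> K" for x y
  proof -
    have "norm (x - y) \<le> norm (perp u (x - y)) + norm (((x - y) \<bullet> u) *\<^sub>R u)"
      using norm_triangle_ineq[of "perp u (x - y)" "((x - y) \<bullet> u) *\<^sub>R u"] by (simp add: perp_def)
    also have "norm (((x - y) \<bullet> u) *\<^sub>R u) = \<bar>u \<bullet> (x - y)\<bar>" using u by (simp add: inner_commute)
    also have "\<dots> \<le> \<epsilon> * norm (x - y)" using flat that by blast
    finally show ?thesis by (simp add: P_def perp_diff algebra_simps)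
  qed
  have "inj_on P K"
  proof (rule inj_onI)
    fix x y assume "x \<in> K" "y \<in> K" "P x = P y"
    with Pge[of x y] \<epsilon> have "norm (x - y) \<le> 0" by (simp add: mult_le_0_iff)
    then show "x = y" by simp
  qed
  then have B: "P ` A \<in> sets borel"
    unfolding P_def using K A by (intro borel_injective_image_compact continuous_on_perp)
  have Bu: "P ` A \<subseteq> {x. x \<bullet> u = 0}" by (auto simp: P_def perp_orthogonal u)
  define M where "M x = s *\<^sub>R perp w (P x)" for x
  have "\<H> (M ` A) = ennreal (s ^ ?n) * \<H> ((\<lambda>x. perp w (P x)) ` A)"
    unfolding M_def using s by (rule hausdorff_outer_scaleR)
  also have "(\<lambda>x. perp w (P x)) ` A = perp w ` P ` A" by auto
  also have "ennreal (s ^ ?n) * \<H> (perp w ` P ` A) = ennreal (s ^ ?n * ?c) * \<H> (P ` A)"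
    using s by (simp add: hausdorff_outer_perp[OF d u w c B Bu] ennreal_mult mult.assoc del: One_nat_def)
  finally have HM: "\<H> (M ` A) = ennreal (s ^ ?n * ?c) * \<H> (P ` A)" .
  have close: "norm (f x - f y - (M x - M y)) \<le> \<theta> * norm (M x - M y)" if xy: "x \<in> K" "y \<in> K" for x y
  proof -
    have Md: "M x - M y = s *\<^sub>R perp w (P x - P y)"
      by (simp add: M_def perp_diff algebra_simps)
    have "P x - P y = (x - y) - ((x - y) \<bullet> u) *\<^sub>R u"
      by (simp add: P_def perp_def inner_diff_left algebra_simps)
    then have "perp w (x - y) - perp w (P x - P y) = perp w (((x - y) \<bullet> u) *\<^sub>R u)"
      by (simp add: perp_diff[symmetric])
    then have "norm (perp w (x - y) - perp w (P x - P y)) \<le> norm (((x - y) \<bullet> u) *\<^sub>R u)"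
      using norm_perp_le[OF w, of "((x - y) \<bullet> u) *\<^sub>R u"] by simp
    also have "\<dots> \<le> \<epsilon> * norm (x - y)"
      using flat[OF xy] u by (simp add: inner_commute)
    finally have 1: "norm (s *\<^sub>R perp w (x - y) - (M x - M y)) \<le> s * (\<epsilon> * norm (x - y))"
      using s unfolding Md by (simp add: scaleR_diff_right[symmetric] mult_left_mono del: scaleR_diff_right)
    have "norm (f x - f y - (M x - M y)) \<le> norm (f x - f y - s *\<^sub>R perp w (x - y))
        + norm (s *\<^sub>R perp w (x - y) - (M x - M y))"
      using norm_triangle_ineq[of "f x - f y - s *\<^sub>R perp w (x - y)" "s *\<^sub>R perp w (x - y) - (M x - M y)"]
      by (simp only: diff_add_cancel add_diff_eq)
    also have "\<dots> \<le> \<kappa> * norm (x - y) + s * (\<epsilon> * norm (x - y))"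
      using f[OF xy] 1 by (rule add_mono)
    also have "\<dots> = (\<kappa> + s * \<epsilon>) * norm (x - y)" by (simp add: algebra_simps)
    also have "\<dots> \<le> \<theta> * ((1 - \<epsilon>) * ?c * s) * norm (x - y)"
      using \<theta>(2) by (rule mult_right_mono) simp
    also have "\<dots> = \<theta> * (s * (?c * ((1 - \<epsilon>) * norm (x - y))))" by (simp add: algebra_simps)
    also have "\<dots> \<le> \<theta> * (s * (?c * norm (P x - P y)))"
      using \<theta> s by (intro mult_left_mono Pge xy) auto
    also have "\<dots> \<le> \<theta> * (s * norm (perp w (P x - P y)))"
    proof -
      have "(P x - P y) \<bullet> u = 0" by (simp add: P_def inner_diff_left perp_orthogonal u)
      then show ?thesis using \<theta> s norm_perp_ge[OF u w] by (intro mult_left_mono) auto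
    qed
    also have "\<dots> = \<theta> * norm (M x - M y)" using s unfolding Md by simp
    finally show ?thesis .
  qed
  have "\<H> (f ` A) \<le> ennreal ((1 + \<theta>) ^ ?n) * \<H> (M ` A)"
  proof (rule hausdorff_outer_dominated)
    fix x y assume "x \<in> A" "y \<in> A"
    then have "norm (f x - f y - (M x - M y)) \<le> \<theta> * norm (M x - M y)" using A close by blast
    moreover have "norm (f x - f y) \<le> norm (f x - f y - (M x - M y)) + norm (M x - M y)"
      using norm_triangle_ineq[of "f x - f y - (M x - M y)" "M x - M y"] by simp
    ultimately show "dist (f x) (f y) \<le> (1 + \<theta>) * dist (M x) (M y)"
      by (simp add: dist_norm algebra_simps)
  qed (use \<theta> in simp)
  also have "\<dots> = ennreal ((1 + \<theta>) ^ ?n * (s ^ ?n * ?c)) * \<H> (P ` A)"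
    using \<theta> s unfolding HM by (subst ennreal_mult) (auto simp: mult.assoc)
  also have "\<H> (P ` A) \<le> ennreal (1 ^ ?n) * \<H> ((\<lambda>x. x) ` A)"
    unfolding P_def
    by (rule hausdorff_outer_dominated) (auto simp: dist_norm perp_diff[symmetric] norm_perp_le u)
  finally show "\<H> (f ` A) \<le> ennreal ((1 + \<theta>) ^ ?n * (s ^ ?n * ?c)) * \<H> A"
    by (simp add: mult_left_mono)
  assume \<theta>1: "\<theta> < 1"
  have "\<H> (M ` A) \<le> ennreal ((1 / (1 - \<theta>)) ^ ?n) * \<H> (f ` A)"
  proof (rule hausdorff_outer_dominated)
    fix x y assume "x \<in> A" "y \<in> A"
    then have "norm (f x - f y - (M x - M y)) \<le> \<theta> * norm (M x - M y)" using A close by blast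
    moreover have "norm (M x - M y) \<le> norm (f x - f y) + norm (f x - f y - (M x - M y))"
      using norm_triangle_ineq4[of "f x - f y" "f x - f y - (M x - M y)"] by simp
    ultimately have "(1 - \<theta>) * norm (M x - M y) \<le> norm (f x - f y)"
      by (simp add: algebra_simps)
    then show "dist (M x) (M y) \<le> 1 / (1 - \<theta>) * dist (f x) (f y)"
      using \<theta>1 by (simp add: dist_norm field_simps)
  qed (use \<theta>1 in simp)
  then have 1: "ennreal ((1 - \<theta>) ^ ?n) * \<H> (M ` A) \<le> \<H> (f ` A)"
    using ennreal_power_mult_le_iff[of "1 / (1 - \<theta>)" ?n] \<theta>1 by simp
  have "\<H> ((\<lambda>x. x) ` A) \<le> ennreal ((1 / (1 - \<epsilon>)) ^ ?n) * \<H> (P ` A)"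
  proof (rule hausdorff_outer_dominated)
    fix x y assume "x \<in> A" "y \<in> A"
    then have "(1 - \<epsilon>) * norm (x - y) \<le> norm (P x - P y)" using A Pge by blast
    then show "dist x y \<le> 1 / (1 - \<epsilon>) * dist (P x) (P y)"
      using \<epsilon> by (simp add: dist_norm field_simps)
  qed (use \<epsilon> in simp)
  then have 2: "ennreal ((1 - \<epsilon>) ^ ?n) * \<H> A \<le> \<H> (P ` A)"
    using ennreal_power_mult_le_iff[of "1 / (1 - \<epsilon>)" ?n] \<epsilon> by simp
  have "ennreal ((1 - \<theta>) ^ ?n * (s ^ ?n * ?c) * (1 - \<epsilon>) ^ ?n) * \<H> A
      = ennreal ((1 - \<theta>) ^ ?n) * (ennreal (s ^ ?n * ?c) * (ennreal ((1 - \<epsilon>) ^ ?n) * \<H> A))"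
    using \<theta>1 s \<epsilon> by (simp add: ennreal_mult mult.assoc)
  also have "\<dots> \<le> ennreal ((1 - \<theta>) ^ ?n) * (ennreal (s ^ ?n * ?c) * \<H> (P ` A))"
    by (intro mult_left_mono 2) auto
  also have "\<dots> \<le> \<H> (f ` A)" using 1 unfolding HM .
  finally show "ennreal ((1 - \<theta>) ^ ?n * (s ^ ?n * ?c) * (1 - \<epsilon>) ^ ?n) * \<H> A \<le> \<H> (f ` A)" .
qed

section \<open>Radial projection of hypersurfaces\<close>

text \<open>The last condition is \<open>C\<^sup>1\<close> regularity without charts: near \<open>p\<close>, all secants of \<open>S\<close> are almost
  tangential at \<open>p\<close>.\<close>

definition C1_surface :: "'a::euclidean_space set \<Rightarrow> ('a \<Rightarrow> 'a) \<Rightarrow> bool" where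
  "C1_surface S \<nu> \<longleftrightarrow> compact S \<and> continuous_on S \<nu> \<and> (\<forall>x\<in>S. norm (\<nu> x) = 1) \<and>
     (\<forall>p\<in>S. \<forall>\<epsilon>>0. \<exists>\<delta>>0. \<forall>x\<in>S \<inter> ball p \<delta>. \<forall>y\<in>S \<inter> ball p \<delta>. \<bar>\<nu> p \<bullet> (x - y)\<bar> \<le> \<epsilon> * norm (x - y))"

text \<open>The averaged direction (\<open>x\<close> + \<open>y\<close>) / (\<open>norm x\<close> +
  \<open>norm y\<close>) turns \<open>norm x - norm y\<close> into an inner product with
  \<open>x - y\<close>. The difference is thereby exact, and when \<open>x\<close> and
  \<open>y\<close> approach \<open>z\<close> the bracket approaches
  \<open>perp (sgn z) (x - y)\<close>.\<close>

lemma sgn_diff_eq: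
  fixes x y :: "'a::real_inner"
  assumes "x \<noteq> 0" "y \<noteq> 0"
  shows "sgn x - sgn y = (1 / norm x) *\<^sub>R ((x - y) - ((x - y) \<bullet> ((1 / (norm x + norm y)) *\<^sub>R (x + y))) *\<^sub>R sgn y)"
proof -
  have "(x - y) \<bullet> (x + y) = (norm x - norm y) * (norm x + norm y)"
    by (simp add: inner_diff_left inner_add_right inner_commute algebra_simps flip: power2_norm_eq_inner)
       (simp add: power2_eq_square)
  moreover have "norm x + norm y \<noteq> 0" using assms by (simp add: add_nonneg_eq_0_iff)
  ultimately have 1: "(x - y) \<bullet> ((1 / (norm x + norm y)) *\<^sub>R (x + y)) = norm x - norm y"
    unfolding inner_scaleR_right by simp
  have 2: "(x - y) - (norm x - norm y) *\<^sub>R sgn y = x - norm x *\<^sub>R sgn y"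
  proof -
    have "norm y *\<^sub>R sgn y = y" using assms by (simp add: sgn_div_norm)
    then show ?thesis by (simp add: scaleR_diff_left)
  qed
  show ?thesis
    unfolding 1 2 using assms by (simp add: scaleR_diff_right) (simp add: sgn_div_norm divide_inverse)
qed

text \<open>Both points must vary: differentiability at \<open>z\<close> alone would not control
  distances between images of two nearby points.\<close>

lemma sgn_strictly_differentiable:
  fixes z :: "'a::real_inner"
  assumes z: "z \<noteq> 0" and \<epsilon>: "0 < \<epsilon>"
  shows "\<exists>\<delta>>0. \<forall>x\<in>ball z \<delta>. \<forall>y\<in>ball z \<delta>.
    norm (sgn x - sgn y - (1 / norm z) *\<^sub>R perp (sgn z) (x - y)) \<le> \<epsilon> * norm (x - y)"
proof -
  define r where "r = norm z"
  have r: "r > 0" using z by (simp add: r_def)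
  \<comment> \<open>The tolerances are chosen so that the final errors 2 \<epsilon> / 4 and (1 /
    \<open>r\<close>) (\<epsilon> \<open>r\<close> / 2) add up to \<epsilon>.\<close>
  have "isCont (\<lambda>x. 1 / norm x) z" using z by (intro continuous_intros) auto
  moreover have "0 < \<epsilon> / 4" using \<epsilon> by simp
  ultimately obtain d1 where d1: "d1 > 0" "\<And>x. dist x z < d1 \<Longrightarrow> dist (1 / norm x) (1 / norm z) < \<epsilon> / 4"
    unfolding continuous_at_eps_delta by blast
  have "isCont sgn z" using z by (intro continuous_intros) auto
  moreover have "0 < \<epsilon> * r / 4" using \<epsilon> r by simp
  ultimately obtain d2 where d2: "d2 > 0" "\<And>x. dist x z < d2 \<Longrightarrow> dist (sgn x) (sgn z) < \<epsilon> * r / 4"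
    unfolding continuous_at_eps_delta by blast
  define \<delta> where "\<delta> = min r (min d1 d2)"
  have "\<delta> > 0" using r d1 d2 by (simp add: \<delta>_def)
  moreover have "norm (sgn x - sgn y - (1 / norm z) *\<^sub>R perp (sgn z) (x - y)) \<le> \<epsilon> * norm (x - y)"
    if xy: "x \<in> ball z \<delta>" "y \<in> ball z \<delta>" for x y
  proof -
    have "dist z x < norm z" "dist z y < norm z" using xy by (auto simp: \<delta>_def r_def)
    then have nz: "x \<noteq> 0" "y \<noteq> 0" by auto
    define h where "h = x - y"
    define w where "w = sgn z"
    define m where "m = (1 / (norm x + norm y)) *\<^sub>R (x + y)"
    have w: "norm w = 1" using z by (simp add: w_def norm_sgn)
    have sy: "norm (sgn y) = 1" using nz by (simp add: norm_sgn)
    have nxy: "norm x + norm y > 0" using nz by (simp add: add_pos_pos)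
    have m1: "norm m \<le> 1"
      using nxy norm_triangle_ineq[of x y] by (simp add: m_def)
    have ds: "norm (sgn x - w) \<le> \<epsilon> * r / 4" "norm (sgn y - w) \<le> \<epsilon> * r / 4"
      using d2(2)[of x] d2(2)[of y] xy by (auto simp: \<delta>_def w_def dist_norm norm_minus_commute)
    \<comment> \<open>\<open>m\<close> is the convex combination of \<open>sgn x\<close> and
      \<open>sgn y\<close> with weights proportional to the norms, hence no farther from
      \<open>w\<close> than the worse of the two.\<close>
    have dm: "norm (m - w) \<le> \<epsilon> * r / 4"
    proof -
      have "x = norm x *\<^sub>R sgn x" "y = norm y *\<^sub>R sgn y" using nz by (simp_all add: sgn_div_norm)
      then have "(norm x + norm y) *\<^sub>R (m - w) = norm x *\<^sub>R (sgn x - w) + norm y *\<^sub>R (sgn y - w)"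
        using nxy by (simp add: m_def scaleR_diff_right scaleR_add_left)
      then have "(norm x + norm y) * norm (m - w) = norm (norm x *\<^sub>R (sgn x - w) + norm y *\<^sub>R (sgn y - w))"
        using nxy by (metis abs_of_pos norm_scaleR)
      also have "\<dots> \<le> norm x * norm (sgn x - w) + norm y * norm (sgn y - w)"
        by (rule order_trans[OF norm_triangle_ineq]) simp
      also have "\<dots> \<le> norm x * (\<epsilon> * r / 4) + norm y * (\<epsilon> * r / 4)"
        using ds by (intro add_mono mult_left_mono) auto
      also have "\<dots> = (norm x + norm y) * (\<epsilon> * r / 4)" by (simp add: algebra_simps)
      finally show ?thesis using nxy by (simp only: mult_le_cancel_left_pos)
    qed
    have hm: "\<bar>h \<bullet> m\<bar> \<le> norm h"
      using Cauchy_Schwarz_ineq2[of h m] m1 by (meson mult_left_le norm_ge_zero order_trans)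
    have n1: "norm (h - (h \<bullet> m) *\<^sub>R sgn y) \<le> 2 * norm h"
      using norm_triangle_ineq4[of h "(h \<bullet> m) *\<^sub>R sgn y"] hm sy by simp
    have n2: "norm ((h \<bullet> w) *\<^sub>R w - (h \<bullet> m) *\<^sub>R sgn y) \<le> \<epsilon> * r / 2 * norm h"
    proof -
      have eq: "(h \<bullet> w) *\<^sub>R w - (h \<bullet> m) *\<^sub>R sgn y = (h \<bullet> (w - m)) *\<^sub>R w + (h \<bullet> m) *\<^sub>R (w - sgn y)"
        by (simp add: inner_diff_right algebra_simps)
      have "norm ((h \<bullet> w) *\<^sub>R w - (h \<bullet> m) *\<^sub>R sgn y) \<le> \<bar>h \<bullet> (w - m)\<bar> + \<bar>h \<bullet> m\<bar> * norm (w - sgn y)"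
        unfolding eq by (rule order_trans[OF norm_triangle_ineq]) (simp add: w)
      also have "\<dots> \<le> norm h * (\<epsilon> * r / 4) + norm h * (\<epsilon> * r / 4)"
      proof (intro add_mono mult_mono)
        show "\<bar>h \<bullet> (w - m)\<bar> \<le> norm h * (\<epsilon> * r / 4)"
          by (rule order_trans[OF Cauchy_Schwarz_ineq2])
             (use mult_left_mono[OF dm, of "norm h"] in \<open>simp add: norm_minus_commute\<close>)
      qed (use hm ds in \<open>auto simp: norm_minus_commute\<close>)
      finally show ?thesis by (simp add: algebra_simps)
    qed
    have i1: "\<bar>1 / norm x - 1 / r\<bar> \<le> \<epsilon> / 4"
      using d1(2)[of x] xy by (auto simp: \<delta>_def r_def dist_norm norm_minus_commute)
    have "sgn x - sgn y - (1 / norm z) *\<^sub>R perp (sgn z) (x - y)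
        = (1 / norm x - 1 / r) *\<^sub>R (h - (h \<bullet> m) *\<^sub>R sgn y) + (1 / r) *\<^sub>R ((h \<bullet> w) *\<^sub>R w - (h \<bullet> m) *\<^sub>R sgn y)"
      unfolding sgn_diff_eq[OF nz] perp_def h_def[symmetric] m_def[symmetric] w_def[symmetric] r_def[symmetric]
      by (simp add: algebra_simps)
    also have "norm \<dots> \<le> \<bar>1 / norm x - 1 / r\<bar> * norm (h - (h \<bullet> m) *\<^sub>R sgn y)
        + (1 / r) * norm ((h \<bullet> w) *\<^sub>R w - (h \<bullet> m) *\<^sub>R sgn y)"
      by (rule order_trans[OF norm_triangle_ineq]) (use r in simp)
    also have "\<dots> \<le> \<epsilon> / 4 * (2 * norm h) + (1 / r) * (\<epsilon> * r / 2 * norm h)"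
      using i1 n1 n2 r \<epsilon> by (intro add_mono mult_mono) auto
    also have "\<dots> = \<epsilon> * norm h" using r by (simp add: field_simps)
    finally show ?thesis by (simp add: h_def)
  qed
  ultimately show ?thesis by blast
qed

lemma norm_perp_diff_direction:
  fixes v w :: "'a::real_inner"
  assumes "norm v = 1" "norm w = 1"
  shows "norm (perp v z - perp w z) \<le> 2 * norm (v - w) * norm z"
proof -
  have "perp v z - perp w z = (z \<bullet> (w - v)) *\<^sub>R w + (z \<bullet> v) *\<^sub>R (w - v)"
    by (simp add: perp_def inner_diff_right algebra_simps)
  also have "norm \<dots> \<le> \<bar>z \<bullet> (w - v)\<bar> + \<bar>z \<bullet> v\<bar> * norm (w - v)"
    by (rule order_trans[OF norm_triangle_ineq]) (simp add: assms)
  also have "\<dots> \<le> norm z * norm (w - v) + (norm z * norm v) * norm (w - v)"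
    by (intro add_mono mult_right_mono Cauchy_Schwarz_ineq2) auto
  finally show ?thesis by (simp add: assms norm_minus_commute algebra_simps)
qed

abbreviation radial :: "'a::euclidean_space \<Rightarrow> 'a \<Rightarrow> 'a" where
  "radial y \<equiv> \<lambda>x. sgn (x - y)"

text \<open>The Jacobian of the radial projection \<open>x \<mapsto> sgn (x - y)\<close> restricted to a hypersurface with normal \<open>\<nu>\<close>.\<close>

definition jacobian :: "('a::euclidean_space \<Rightarrow> 'a) \<Rightarrow> 'a \<Rightarrow> 'a \<Rightarrow> real" where
  "jacobian \<nu> y x = \<bar>\<nu> x \<bullet> sgn (x - y)\<bar> / norm (x - y) ^ (DIM('a) - 1)"

text \<open>Closed balls are used because \<open>hausdorff_outer_nearly_linear_image\<close> asks
  for a compact piece. The same \<epsilon> serves as flatness of the surface and as relative error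
  of the derivative, whose scale is 1 / \<open>norm (p - y)\<close>.\<close>

lemma C1_surface_near:
  fixes S :: "'a::euclidean_space set"
  assumes S: "C1_surface S \<nu>" and p: "p \<in> S" "p \<noteq> y" and \<epsilon>: "0 < \<epsilon>"
  obtains \<delta> where "\<delta> > 0"
    "\<And>x x'. x \<in> S \<inter> cball p \<delta> \<Longrightarrow> x' \<in> S \<inter> cball p \<delta> \<Longrightarrow> \<bar>\<nu> p \<bullet> (x - x')\<bar> \<le> \<epsilon> * norm (x - x')"
    "\<And>x x'. x \<in> S \<inter> cball p \<delta> \<Longrightarrow> x' \<in> S \<inter> cball p \<delta> \<Longrightarrow>
      norm (sgn (x - y) - sgn (x' - y) - (1 / norm (p - y)) *\<^sub>R perp (sgn (p - y)) (x - x'))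
        \<le> 1 / norm (p - y) * \<epsilon> * norm (x - x')"
proof -
  obtain d1 where d1: "d1 > 0" "\<And>x x'. x \<in> S \<inter> ball p d1 \<Longrightarrow> x' \<in> S \<inter> ball p d1 \<Longrightarrow>
      \<bar>\<nu> p \<bullet> (x - x')\<bar> \<le> \<epsilon> * norm (x - x')"
    using S p \<epsilon> unfolding C1_surface_def by blast
  have "1 / norm (p - y) * \<epsilon> > 0" using p \<epsilon> by simp
  then obtain d2 where d2: "d2 > 0" "\<And>x x'. x \<in> ball (p - y) d2 \<Longrightarrow> x' \<in> ball (p - y) d2 \<Longrightarrow>
    norm (sgn x - sgn x' - (1 / norm (p - y)) *\<^sub>R perp (sgn (p - y)) (x - x')) \<le> 1 / norm (p - y) * \<epsilon> * norm (x - x')"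
    using sgn_strictly_differentiable[of "p - y"] p by (metis right_minus_eq)
  define \<delta> where "\<delta> = min d1 d2 / 2"
  have \<delta>: "0 < \<delta>" "\<delta> < d1" "\<delta> < d2" using d1(1) d2(1) by (auto simp: \<delta>_def min_def)
  show thesis
  proof (rule that[OF \<delta>(1)])
    fix x x' assume x: "x \<in> S \<inter> cball p \<delta>" "x' \<in> S \<inter> cball p \<delta>"
    then show "\<bar>\<nu> p \<bullet> (x - x')\<bar> \<le> \<epsilon> * norm (x - x')" using \<delta> by (intro d1) auto
    have "x - y \<in> ball (p - y) d2" "x' - y \<in> ball (p - y) d2" using x \<delta> by (auto simp: dist_norm)
    from d2(2)[OF this] show "norm (sgn (x - y) - sgn (x' - y) - (1 / norm (p - y)) *\<^sub>R perp (sgn (p - y)) (x - x'))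
        \<le> 1 / norm (p - y) * \<epsilon> * norm (x - x')" by simp
  qed
qed

text \<open>With \<kappa> = \<open>s\<close> \<epsilon>, the quotient 2 \<epsilon> / ((1 -
  \<epsilon>) \<open>c\<close>) is the value of \<theta> for which the error condition of
  \<open>hausdorff_outer_nearly_linear_image\<close> is an equality. All bounds hold in the limit
  \<epsilon> to 0.\<close>

lemma exists_small_parameter:
  fixes c B :: real
  assumes "0 < c" "B > 0" "\<eta> > 0"
  shows "\<exists>\<epsilon>>0. \<epsilon> < 1 / 2 \<and> 2 * \<epsilon> / ((1 - \<epsilon>) * c) < 1 \<and>
      (1 + 2 * \<epsilon> / ((1 - \<epsilon>) * c)) ^ n * B < B + \<eta> \<and>
      B - \<eta> < (1 - 2 * \<epsilon> / ((1 - \<epsilon>) * c)) ^ n * B * (1 - \<epsilon>) ^ n"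
proof -
  have 1: "((\<lambda>\<epsilon>. 2 * \<epsilon> / ((1 - \<epsilon>) * c)) \<longlongrightarrow> 2 * 0 / ((1 - 0) * c)) (at_right 0)"
    using assms by (intro tendsto_intros) auto
  have 2: "((\<lambda>\<epsilon>. (1 + 2 * \<epsilon> / ((1 - \<epsilon>) * c)) ^ n * B) \<longlongrightarrow> (1 + 2 * 0 / ((1 - 0) * c)) ^ n * B) (at_right 0)"
    using assms by (intro tendsto_intros) auto
  have 3: "((\<lambda>\<epsilon>. (1 - 2 * \<epsilon> / ((1 - \<epsilon>) * c)) ^ n * B * (1 - \<epsilon>) ^ n)
      \<longlongrightarrow> (1 - 2 * 0 / ((1 - 0) * c)) ^ n * B * (1 - 0) ^ n) (at_right 0)"
    using assms by (intro tendsto_intros) auto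
  have "\<forall>\<^sub>F \<epsilon> in at_right (0::real). 0 < \<epsilon> \<and> \<epsilon> < 1 / 2 \<and> 2 * \<epsilon> / ((1 - \<epsilon>) * c) < 1 \<and>
      (1 + 2 * \<epsilon> / ((1 - \<epsilon>) * c)) ^ n * B < B + \<eta> \<and>
      B - \<eta> < (1 - 2 * \<epsilon> / ((1 - \<epsilon>) * c)) ^ n * B * (1 - \<epsilon>) ^ n"
    using order_tendstoD(2)[OF 1, of 1] order_tendstoD(2)[OF 2, of "B + \<eta>"]
      order_tendstoD(1)[OF 3, of "B - \<eta>"] assms
    by (intro eventually_conj eventually_at_right_less order_tendstoD(2)[OF tendsto_ident_at]) auto
  then show ?thesis using eventually_happens'[OF trivial_limit_at_right_real] by blast
qed

text \<open>At \<open>p\<close> the derivative of the projection is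
  \<open>s *\<^sub>R perp w\<close>, which multiplies measure on the tangent plane by
  \<open>s ^ (DIM('a) - 1)\<close> |\<open>u \<bullet> w\<close>|, the Jacobian. The additive \<eta>
  instead of a factor close to 1 makes the statement meaningful when the Jacobian is 0.\<close>

lemma radial_projection_local:
  fixes S :: "'a::euclidean_space set"
  assumes d: "2 \<le> DIM('a)" and S: "C1_surface S \<nu>" and p: "p \<in> S" "p \<noteq> y" and \<eta>: "0 < \<eta>"
  shows "\<exists>\<delta>>0. \<forall>A. A \<in> sets borel \<and> A \<subseteq> S \<inter> cball p \<delta> \<longrightarrow>
      \<H> (radial y ` A)
        \<le> ennreal (jacobian \<nu> y p + \<eta>) * \<H> A \<and>
      ennreal (jacobian \<nu> y p - \<eta>) * \<H> A
        \<le> \<H> (radial y ` A)"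
proof -
  let ?n = "DIM('a) - 1" and ?J = "jacobian \<nu> y p"
  define u where "u = \<nu> p"
  define w where "w = sgn (p - y)"
  define s where "s = 1 / norm (p - y)"
  have u: "norm u = 1" using S p by (auto simp: u_def C1_surface_def)
  have w: "norm w = 1" using p by (simp add: w_def norm_sgn)
  have s: "0 < s" using p by (simp add: s_def)
  have J: "?J = s ^ ?n * \<bar>u \<bullet> w\<bar>"
    by (simp add: jacobian_def u_def w_def s_def power_divide)
  have comp: "compact (S \<inter> cball p \<delta>)" for \<delta>
    using S by (auto simp: C1_surface_def intro: compact_Int_closed)
  show ?thesis
  proof (cases "u \<bullet> w = 0")
    case False
    define B where "B = s ^ ?n * \<bar>u \<bullet> w\<bar>"
    have B: "B > 0" using False s by (simp add: B_def)
    obtain \<epsilon> where \<epsilon>: "\<epsilon> > 0" "\<epsilon> < 1/2" "2 * \<epsilon> / ((1 - \<epsilon>) * \<bar>u \<bullet> w\<bar>) < 1"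
      "(1 + 2 * \<epsilon> / ((1 - \<epsilon>) * \<bar>u \<bullet> w\<bar>)) ^ ?n * B < B + \<eta>"
      "B - \<eta> < (1 - 2 * \<epsilon> / ((1 - \<epsilon>) * \<bar>u \<bullet> w\<bar>)) ^ ?n * B * (1 - \<epsilon>) ^ ?n"
      using exists_small_parameter[of "\<bar>u \<bullet> w\<bar>" B \<eta> ?n] False B \<eta> by auto
    obtain \<delta> where \<delta>: "\<delta> > 0"
      "\<And>x x'. x \<in> S \<inter> cball p \<delta> \<Longrightarrow> x' \<in> S \<inter> cball p \<delta> \<Longrightarrow> \<bar>u \<bullet> (x - x')\<bar> \<le> \<epsilon> * norm (x - x')"
      "\<And>x x'. x \<in> S \<inter> cball p \<delta> \<Longrightarrow> x' \<in> S \<inter> cball p \<delta> \<Longrightarrow>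
        norm (sgn (x - y) - sgn (x' - y) - s *\<^sub>R perp w (x - x')) \<le> s * \<epsilon> * norm (x - x')"
      using C1_surface_near[OF S p \<epsilon>(1)] unfolding u_def w_def s_def by blast
    define \<theta> where "\<theta> = 2 * \<epsilon> / ((1 - \<epsilon>) * \<bar>u \<bullet> w\<bar>)"
    have \<theta>: "0 \<le> \<theta>" "\<theta> < 1" using \<epsilon> by (auto simp: \<theta>_def)
    have \<theta>2: "s * \<epsilon> + s * \<epsilon> \<le> \<theta> * ((1 - \<epsilon>) * \<bar>u \<bullet> w\<bar> * s)"
      using \<epsilon> False by (simp add: \<theta>_def)
    have "\<H> (radial y ` A) \<le> ennreal (?J + \<eta>) * \<H> A \<and>
      ennreal (?J - \<eta>) * \<H> A \<le> \<H> (radial y ` A)"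
      if A: "A \<in> sets borel" "A \<subseteq> S \<inter> cball p \<delta>" for A
    proof
      have "\<H> (radial y ` A) \<le> ennreal ((1 + \<theta>) ^ ?n * B) * \<H> A"
        unfolding B_def
        by (rule hausdorff_outer_nearly_linear_image(1)[OF d u w False s _ _ comp \<delta>(2) A \<delta>(3) \<theta>(1) \<theta>2])
           (use \<epsilon> in auto)
      also have "\<dots> \<le> ennreal (?J + \<eta>) * \<H> A"
        using \<epsilon>(4) unfolding J B_def[symmetric] \<theta>_def[symmetric] by (intro mult_right_mono ennreal_leI) auto
      finally show "\<H> (radial y ` A) \<le> ennreal (?J + \<eta>) * \<H> A" .
      have "ennreal (?J - \<eta>) * \<H> A \<le> ennreal ((1 - \<theta>) ^ ?n * B * (1 - \<epsilon>) ^ ?n) * \<H> A"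
        using \<epsilon>(5) unfolding J B_def[symmetric] \<theta>_def[symmetric] by (intro mult_right_mono ennreal_leI) auto
      also have "\<dots> \<le> \<H> (radial y ` A)"
        unfolding B_def
        by (rule hausdorff_outer_nearly_linear_image(2)[OF d u w False s _ _ comp \<delta>(2) A \<delta>(3) \<theta>(1) \<theta>2 \<theta>(2)])
           (use \<epsilon> in auto)
      finally show "ennreal (?J - \<eta>) * \<H> A \<le> \<H> (radial y ` A)" .
    qed
    then show ?thesis using \<delta>(1) by blast
  next
    case True
    text \<open>Tilting the direction \<open>w\<close> slightly towards the normal makes the projection invertible
      on the tangent space, with arbitrarily small Jacobian.\<close>
    define t where "t = min (1/2) (\<eta> / (13 ^ ?n * s ^ ?n))"
    have t: "0 < t" "t \<le> 1/2" "13 ^ ?n * (s ^ ?n * t) \<le> \<eta>"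
    proof -
      have pos: "0 < 13 ^ ?n * s ^ ?n" using s by simp
      then show "0 < t" using \<eta> by (simp add: t_def)
      show "t \<le> 1/2" unfolding t_def by (rule min.cobounded1)
      have "(13 ^ ?n * s ^ ?n) * t \<le> (13 ^ ?n * s ^ ?n) * (\<eta> / (13 ^ ?n * s ^ ?n))"
        using pos by (intro mult_left_mono) (auto simp: t_def)
      then show "13 ^ ?n * (s ^ ?n * t) \<le> \<eta>" using pos s by (simp add: mult.assoc)
    qed
    define q where "q = sqrt (1 - t\<^sup>2)"
    define w' where "w' = q *\<^sub>R w + t *\<^sub>R u"
    have t2: "t\<^sup>2 \<le> 1" using t by (simp add: power_le_one)
    have q2: "q\<^sup>2 = 1 - t\<^sup>2" using t2 by (simp add: q_def)
    have q0: "0 \<le> q" "q \<le> 1" using t2 by (auto simp: q_def)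
    have q1: "1 - t\<^sup>2 \<le> q" using q0 q2 by (metis mult_left_le power2_eq_square)
    have uu: "u \<bullet> u = 1" "w \<bullet> w = 1" using u w by (simp_all add: norm_eq_1)
    have "w' \<bullet> w' = q\<^sup>2 + t\<^sup>2"
      using True uu by (simp add: w'_def inner_add_left inner_add_right inner_commute power2_eq_square)
    then have w': "norm w' = 1" using q2 by (simp add: norm_eq_1)
    have uw': "u \<bullet> w' = t" using True uu by (simp add: w'_def inner_add_right)
    have "(norm (w - w'))\<^sup>2 = (1 - q)\<^sup>2 + t\<^sup>2"
      unfolding w'_def power2_norm_eq_inner using True uu
      by (simp add: inner_add_left inner_add_right inner_diff_left inner_diff_right inner_commute)
         (simp add: power2_eq_square algebra_simps)
    also have "\<dots> = 2 - 2 * q" using q2 by (simp add: power2_eq_square algebra_simps)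
    also have "\<dots> \<le> (2 * t)\<^sup>2"
  proof -
    have "0 \<le> t\<^sup>2" "(2 * t)\<^sup>2 = 4 * t\<^sup>2" by (simp_all add: power_mult_distrib)
    then show ?thesis using q1 by linarith
  qed
    finally have ww: "norm (w - w') \<le> 2 * t" by (rule power2_le_imp_le) (use t in simp)
    obtain \<delta> where \<delta>: "\<delta> > 0"
      "\<And>x x'. x \<in> S \<inter> cball p \<delta> \<Longrightarrow> x' \<in> S \<inter> cball p \<delta> \<Longrightarrow> \<bar>u \<bullet> (x - x')\<bar> \<le> t * norm (x - x')"
      "\<And>x x'. x \<in> S \<inter> cball p \<delta> \<Longrightarrow> x' \<in> S \<inter> cball p \<delta> \<Longrightarrow>
        norm (sgn (x - y) - sgn (x' - y) - s *\<^sub>R perp w (x - x')) \<le> s * t * norm (x - x')"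
      using C1_surface_near[OF S p t(1)] unfolding u_def w_def s_def by blast
    have near: "norm (sgn (x - y) - sgn (x' - y) - s *\<^sub>R perp w' (x - x')) \<le> 5 * s * t * norm (x - x')"
      if "x \<in> S \<inter> cball p \<delta>" "x' \<in> S \<inter> cball p \<delta>" for x x'
    proof -
      have "norm (s *\<^sub>R perp w (x - x') - s *\<^sub>R perp w' (x - x')) = s * norm (perp w (x - x') - perp w' (x - x'))"
        using s by (simp add: scaleR_diff_right[symmetric] del: scaleR_diff_right)
      also have "\<dots> \<le> s * (2 * (2 * t) * norm (x - x'))"
      proof (intro mult_left_mono)
        have "2 * norm (w - w') * norm (x - x') \<le> 2 * (2 * t) * norm (x - x')"
          using ww by (intro mult_right_mono) auto
        with norm_perp_diff_direction[OF w w', of "x - x'"]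
        show "norm (perp w (x - x') - perp w' (x - x')) \<le> 2 * (2 * t) * norm (x - x')"
          by (rule order_trans)
      qed (use s in simp)
      finally have "norm (s *\<^sub>R perp w (x - x') - s *\<^sub>R perp w' (x - x')) \<le> 4 * s * t * norm (x - x')"
        by (simp add: algebra_simps)
      with \<delta>(3)[OF that] norm_triangle_ineq[of "sgn (x - y) - sgn (x' - y) - s *\<^sub>R perp w (x - x')"
          "s *\<^sub>R perp w (x - x') - s *\<^sub>R perp w' (x - x')"]
      show ?thesis by (simp add: algebra_simps)
    qed
    have \<theta>: "5 * s * t + s * t \<le> 12 * ((1 - t) * \<bar>u \<bullet> w'\<bar> * s)"
    proof -
      have "6 * (s * t) \<le> 12 * (1 - t) * (s * t)"
        using t s by (intro mult_right_mono) auto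
      then show ?thesis using t by (simp add: uw' algebra_simps)
    qed
    have "\<H> (radial y ` A) \<le> ennreal (?J + \<eta>) * \<H> A \<and>
      ennreal (?J - \<eta>) * \<H> A \<le> \<H> (radial y ` A)"
      if A: "A \<in> sets borel" "A \<subseteq> S \<inter> cball p \<delta>" for A
    proof
      have "\<H> (radial y ` A)
          \<le> ennreal ((1 + 12) ^ ?n * (s ^ ?n * \<bar>u \<bullet> w'\<bar>)) * \<H> A"
        by (rule hausdorff_outer_nearly_linear_image(1)[OF d u w' _ s _ _ comp \<delta>(2) A near _ \<theta>])
           (use t uw' in auto)
      also have "\<dots> \<le> ennreal (?J + \<eta>) * \<H> A"
        using t True unfolding J uw' by (intro mult_right_mono ennreal_leI) auto
      finally show "\<H> (radial y ` A) \<le> ennreal (?J + \<eta>) * \<H> A" .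
      have "ennreal (?J - \<eta>) = 0" using True \<eta> unfolding J by (simp add: ennreal_neg)
      then show "ennreal (?J - \<eta>) * \<H> A \<le> \<H> (radial y ` A)" by simp
    qed
    then show ?thesis using \<delta>(1) by blast
  qed
qed

section \<open>Finite area of the surface and measurability of the Jacobian\<close>

lemma hausdorff_outer_finite_UN:
  assumes "finite F" "\<And>p. p \<in> F \<Longrightarrow> hausdorff_outer n (B p) < top"
  shows "hausdorff_outer n (\<Union>p\<in>F. B p) < top"
  using assms
proof (induction F rule: finite_induct)
  case (insert p F)
  have "hausdorff_outer n (\<Union>q\<in>insert p F. B q) \<le> hausdorff_outer n (B p) + hausdorff_outer n (\<Union>q\<in>F. B q)"
    using hausdorff_outer_Un_le[of n "B p" "\<Union>q\<in>F. B q"] by simp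
  also have "\<dots> < top" using insert by simp
  finally show ?case .
qed simp

text \<open>Where secants deviate from the tangent plane by at most half their length, projection to
  that plane shrinks distances by at most the factor 2, and bounded subsets of a hyperplane have
  finite measure. Compactness leaves finitely many such pieces.\<close>

lemma C1_surface_finite:
  fixes S :: "'a::euclidean_space set"
  assumes S: "C1_surface S \<nu>"
  shows "\<H> S < top"
proof -
  have "\<exists>\<delta>>0. \<forall>x\<in>S \<inter> ball p \<delta>. \<forall>y\<in>S \<inter> ball p \<delta>. \<bar>\<nu> p \<bullet> (x - y)\<bar> \<le> 1/2 * norm (x - y)"
    if "p \<in> S" for p
  proof -
    have "(0::real) < 1/2" by simp
    with S that show ?thesis unfolding C1_surface_def by blast
  qed
  then obtain \<delta> where \<delta>: "\<And>p. p \<in> S \<Longrightarrow> \<delta> p > 0"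
    "\<And>p x y. p \<in> S \<Longrightarrow> x \<in> S \<inter> ball p (\<delta> p) \<Longrightarrow> y \<in> S \<inter> ball p (\<delta> p) \<Longrightarrow> \<bar>\<nu> p \<bullet> (x - y)\<bar> \<le> 1/2 * norm (x - y)"
    by metis
  have fin: "\<H> (S \<inter> ball p (\<delta> p)) < top" if p: "p \<in> S" for p
  proof -
    have u: "norm (\<nu> p) = 1" using S p by (simp add: C1_surface_def)
    let ?A = "S \<inter> ball p (\<delta> p)"
    have "\<H> ((\<lambda>x. x) ` ?A) \<le> ennreal (2 ^ (DIM('a) - 1)) * \<H> (perp (\<nu> p) ` ?A)"
    proof (rule hausdorff_outer_dominated)
      fix x y assume xy: "x \<in> ?A" "y \<in> ?A"
      have "norm (x - y) \<le> norm (perp (\<nu> p) (x - y)) + norm (((x - y) \<bullet> \<nu> p) *\<^sub>R \<nu> p)"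
        using norm_triangle_ineq[of "perp (\<nu> p) (x - y)" "((x - y) \<bullet> \<nu> p) *\<^sub>R \<nu> p"] by (simp add: perp_def)
      also have "norm (((x - y) \<bullet> \<nu> p) *\<^sub>R \<nu> p) = \<bar>\<nu> p \<bullet> (x - y)\<bar>" using u by (simp add: inner_commute)
      also have "\<dots> \<le> 1/2 * norm (x - y)" using \<delta>(2)[OF p xy] .
      finally show "dist x y \<le> 2 * dist (perp (\<nu> p) x) (perp (\<nu> p) y)"
        by (simp add: dist_norm perp_diff)
    qed simp
    also have "\<dots> < top"
    proof -
      have "bounded (perp (\<nu> p) ` ?A)"
        using bounded_ball[of p "\<delta> p"] order_trans[OF norm_perp_le[OF u]]
        by (fastforce simp: bounded_iff)
      then have "\<H> (perp (\<nu> p) ` ?A) < top"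
        using u by (intro hausdorff_outer_hyperplane_finite) (auto simp: perp_orthogonal)
      then show ?thesis by (simp add: ennreal_mult_less_top)
    qed
    finally show ?thesis by simp
  qed
  have "compact S" using S by (simp add: C1_surface_def)
  then obtain F where F: "F \<subseteq> S" "finite F" "S \<subseteq> (\<Union>p\<in>F. ball p (\<delta> p))"
  proof (rule compactE_image[of S S "\<lambda>p. ball p (\<delta> p)"])
    show "S \<subseteq> (\<Union>p\<in>S. ball p (\<delta> p))" using \<delta>(1) by force
  qed auto
  have "S \<subseteq> (\<Union>p\<in>F. S \<inter> ball p (\<delta> p))" using F by blast
  then have "\<H> S \<le> \<H> (\<Union>p\<in>F. S \<inter> ball p (\<delta> p))"
    by (rule hausdorff_outer_mono)
  also have "\<dots> < top" using F fin by (intro hausdorff_outer_finite_UN) auto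
  finally show ?thesis .
qed

lemma space_surface_measure [simp]: "space (surface_measure S) = S"
  by (simp add: surface_measure_def space_restrict_space)

lemma sets_surface_measure: "sets (surface_measure S) = sets (restrict_space borel S)"
  unfolding surface_measure_def by (rule sets_restrict_space_cong) simp

lemma emeasure_surface_measure:
  fixes S :: "'a::euclidean_space set"
  assumes "S \<in> sets borel" "A \<in> sets borel" "A \<subseteq> S"
  shows "emeasure (surface_measure S) A = \<H> A"
  unfolding surface_measure_def using assms
  by (subst emeasure_restrict_space) (auto simp: emeasure_hausdorff_measure)

lemma C1_surface_borel: "C1_surface S \<nu> \<Longrightarrow> S \<in> sets borel"
  by (auto simp: C1_surface_def intro: borel_compact)

lemma C1_surface_normal_measurable:
  "C1_surface S \<nu> \<Longrightarrow> \<nu> \<in> borel_measurable (surface_measure S)"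
  unfolding C1_surface_def measurable_cong_sets[OF sets_surface_measure refl]
  by (auto intro: borel_measurable_continuous_on_restrict)

lemma borel_measurable_surface_measure:
  fixes S :: "'a::euclidean_space set" and f :: "'a \<Rightarrow> 'b::topological_space"
  shows "f \<in> borel_measurable borel \<Longrightarrow> f \<in> borel_measurable (surface_measure S)"
  unfolding measurable_cong_sets[OF sets_surface_measure refl] by (rule measurable_restrict_space1)

lemma borel_measurable_sgn [measurable]:
  "(sgn :: 'a::euclidean_space \<Rightarrow> 'a) \<in> borel_measurable borel"
  unfolding sgn_div_norm[abs_def] by measurable

lemma jacobian_measurable:
  fixes S :: "'a::euclidean_space set"
  assumes "C1_surface S \<nu>"
  shows "jacobian \<nu> y \<in> borel_measurable (surface_measure S)"
proof -
  have [measurable]: "\<nu> \<in> borel_measurable (surface_measure S)"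
    by (rule C1_surface_normal_measurable[OF assms])
  have [measurable]: "radial y \<in> borel_measurable (surface_measure S)"
    "(\<lambda>x. norm (x - y) ^ (DIM('a) - 1)) \<in> borel_measurable (surface_measure S)"
    by (intro borel_measurable_surface_measure; measurable)+
  show ?thesis unfolding jacobian_def[abs_def] by measurable
qed

lemma jacobian_continuous:
  assumes "C1_surface S \<nu>"
  shows "continuous_on (S - {y}) (jacobian \<nu> y)"
proof -
  have "continuous_on (S - {y}) \<nu>"
    using assms by (auto simp: C1_surface_def intro: continuous_on_subset)
  then show ?thesis
    unfolding jacobian_def[abs_def] by (intro continuous_intros) auto
qed

section \<open>Area formula for the radial projection\<close>

lemma countable_fine_partition:
  fixes X :: "'a::euclidean_space set"
  assumes "\<And>p. p \<in> X \<Longrightarrow> 0 < \<delta> p"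
  shows "\<exists>A::nat \<Rightarrow> 'a set. disjoint_family A \<and> (\<forall>i. A i \<in> sets borel) \<and> X \<subseteq> (\<Union>i. A i) \<and>
    (\<forall>i. A i = {} \<or> (\<exists>p\<in>X. A i \<subseteq> ball p (\<delta> p)))"
proof (cases "X = {}")
  case True
  then show ?thesis by (intro exI[of _ "\<lambda>_. {}"]) (auto simp: disjoint_family_on_def)
next
  case False
  obtain F' where F': "F' \<subseteq> (\<lambda>p. ball p (\<delta> p)) ` X" "countable F'" "\<Union>F' = \<Union>((\<lambda>p. ball p (\<delta> p)) ` X)"
    using Lindelof[of "(\<lambda>p. ball p (\<delta> p)) ` X"] by auto
  have X: "X \<subseteq> \<Union>F'" unfolding F'(3) using assms by force
  then have ne: "F' \<noteq> {}" using False by auto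
  define B where "B = from_nat_into F'"
  have B: "range B = F'" unfolding B_def by (rule range_from_nat_into[OF ne F'(2)])
  then have BX: "\<exists>p\<in>X. B i = ball p (\<delta> p)" for i using F'(1) by blast
  have "B i \<in> sets borel" for i using BX[of i] by auto
  then have "range B \<subseteq> sets borel" by auto
  then have "range (disjointed B) \<subseteq> sets borel" by (rule sets.range_disjointed_sets)
  moreover have "X \<subseteq> (\<Union>i. disjointed B i)" using X B by (simp add: UN_disjointed_eq)
  moreover have "\<exists>p\<in>X. disjointed B i \<subseteq> ball p (\<delta> p)" for i
    using BX[of i] disjointed_subset[of B i] by blast
  ultimately show ?thesis
    by (intro exI[of _ "disjointed B"]) (auto simp: disjoint_family_disjointed)
qed

lemma nn_integral_disjoint_pieces:
  fixes V :: "nat \<Rightarrow> 'a set"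
  assumes [measurable]: "f \<in> borel_measurable M" and V: "\<And>i. V i \<in> sets M" "disjoint_family V"
  shows "(\<Sum>i. \<integral>\<^sup>+ x. f x * indicator (V i) x \<partial>M) = (\<integral>\<^sup>+ x. f x * indicator (\<Union>i. V i) x \<partial>M)"
proof -
  note [measurable] = V(1)
  have "(\<Sum>i. \<integral>\<^sup>+ x. f x * indicator (V i) x \<partial>M) = (\<integral>\<^sup>+ x. (\<Sum>i. f x * indicator (V i) x) \<partial>M)"
    by (rule nn_integral_suminf[symmetric]) measurable
  also have "\<dots> = (\<integral>\<^sup>+ x. f x * indicator (\<Union>i. V i) x \<partial>M)"
    by (intro nn_integral_cong) (simp add: ennreal_suminf_cmult suminf_indicator[OF V(2)])
  finally show ?thesis .
qed

abbreviation jacobian_integral :: "'a::euclidean_space set \<Rightarrow> ('a \<Rightarrow> 'a) \<Rightarrow> 'a \<Rightarrow> 'a set \<Rightarrow> ennreal" where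
  "jacobian_integral S \<nu> y A \<equiv>
     (\<integral>\<^sup>+ x. ennreal (jacobian \<nu> y x) * indicator A x \<partial>surface_measure S)"

text \<open>Half of \<eta> pays for the local linear approximation, the other half for the
  oscillation of the Jacobian on a piece. Excluding \<open>y\<close> from \<open>V\<close> keeps the
  Jacobian continuous at every centre.\<close>

lemma radial_projection_partition:
  fixes S :: "'a::euclidean_space set"
  assumes d: "2 \<le> DIM('a)" and S: "C1_surface S \<nu>" and V: "V \<in> sets borel" "V \<subseteq> S - {y}" and \<eta>: "0 < \<eta>"
  obtains W :: "nat \<Rightarrow> 'a set" where "disjoint_family W" "\<forall>i. W i \<in> sets borel" "(\<Union>i. W i) = V"
    "\<forall>i. \<H> (radial y ` W i)
        \<le> (\<integral>\<^sup>+ x. (ennreal (jacobian \<nu> y x) + ennreal \<eta>) * indicator (W i) x \<partial>surface_measure S)"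
    "\<forall>i. jacobian_integral S \<nu> y (W i)
        \<le> \<H> (radial y ` W i) + ennreal \<eta> * \<H> (W i)"
proof -
  let ?J = "jacobian \<nu> y" and ?f = "radial y" and ?M = "surface_measure S"
  have SB: "S \<in> sets borel" using S by (rule C1_surface_borel)
  have \<eta>2: "0 < \<eta> / 2" using \<eta> by simp
  have [measurable]: "?J \<in> borel_measurable ?M" by (rule jacobian_measurable[OF S])
  have J0: "0 \<le> ?J x" for x by (simp add: jacobian_def)
  define good where "good p \<delta> \<longleftrightarrow> (\<forall>x\<in>S \<inter> ball p \<delta> - {y}. \<bar>?J x - ?J p\<bar> \<le> \<eta>/2) \<and>
      (\<forall>A. A \<in> sets borel \<and> A \<subseteq> S \<inter> cball p \<delta> \<longrightarrow>
        \<H> (?f ` A) \<le> ennreal (?J p + \<eta>/2) * \<H> A \<and>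
        ennreal (?J p - \<eta>/2) * \<H> A \<le> \<H> (?f ` A))" for p \<delta>
  have "\<exists>\<delta>>0. good p \<delta>" if p: "p \<in> V" for p
  proof -
    have pS: "p \<in> S" "p \<noteq> y" using p V by auto
    obtain d1 where d1: "d1 > 0" "\<And>A. A \<in> sets borel \<and> A \<subseteq> S \<inter> cball p d1 \<Longrightarrow>
        \<H> (?f ` A) \<le> ennreal (?J p + \<eta>/2) * \<H> A \<and>
        ennreal (?J p - \<eta>/2) * \<H> A \<le> \<H> (?f ` A)"
      using radial_projection_local[OF d S pS \<eta>2] by blast
    obtain d2 where d2: "d2 > 0" "\<And>x. x \<in> S - {y} \<Longrightarrow> dist x p < d2 \<Longrightarrow> dist (?J x) (?J p) < \<eta>/2"
      using jacobian_continuous[OF S, of y] pS \<eta>2 unfolding continuous_on_iff by blast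
    show ?thesis
    proof (intro exI[of _ "min d1 d2"] conjI)
      show "good p (min d1 d2)"
        unfolding good_def
      proof (rule conjI, rule ballI)
        show "\<bar>?J x - ?J p\<bar> \<le> \<eta> / 2" if "x \<in> S \<inter> ball p (min d1 d2) - {y}" for x
          using d2(2)[of x] that by (auto simp: dist_real_def dist_commute)
        have "S \<inter> cball p (min d1 d2) \<subseteq> S \<inter> cball p d1" by auto
        with d1(2) show "\<forall>A. A \<in> sets borel \<and> A \<subseteq> S \<inter> cball p (min d1 d2) \<longrightarrow>
            \<H> (?f ` A) \<le> ennreal (?J p + \<eta>/2) * \<H> A \<and>
            ennreal (?J p - \<eta>/2) * \<H> A \<le> \<H> (?f ` A)"
          by (meson order_trans)
      qed
    qed (use d1 d2 in auto)
  qed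
  then obtain \<delta> where \<delta>: "\<And>p. p \<in> V \<Longrightarrow> \<delta> p > 0" "\<And>p. p \<in> V \<Longrightarrow> good p (\<delta> p)" by metis
  have "\<exists>A::nat \<Rightarrow> 'a set. disjoint_family A \<and> (\<forall>i. A i \<in> sets borel) \<and> V \<subseteq> (\<Union>i. A i) \<and>
      (\<forall>i. A i = {} \<or> (\<exists>p\<in>V. A i \<subseteq> ball p (\<delta> p)))"
    by (rule countable_fine_partition) (rule \<delta>(1))
  then obtain A :: "nat \<Rightarrow> 'a set" where "disjoint_family A \<and> (\<forall>i. A i \<in> sets borel) \<and> V \<subseteq> (\<Union>i. A i) \<and>
      (\<forall>i. A i = {} \<or> (\<exists>p\<in>V. A i \<subseteq> ball p (\<delta> p)))" ..
  then have A: "disjoint_family A" "\<And>i. A i \<in> sets borel" "V \<subseteq> (\<Union>i. A i)"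
    "\<And>i. A i = {} \<or> (\<exists>p\<in>V. A i \<subseteq> ball p (\<delta> p))" by simp_all
  define W where "W i = V \<inter> A i" for i
  have WB: "W i \<in> sets borel" for i using V A by (auto simp: W_def)
  have WS: "W i \<subseteq> S" for i using V by (auto simp: W_def)
  have WM [measurable]: "W i \<in> sets ?M" for i
    using WB WS SB by (simp add: sets_surface_measure sets_restrict_space_iff)
  have const: "(\<integral>\<^sup>+ x. c * indicator (W i) x \<partial>?M) = c * \<H> (W i)" for c i
    by (simp add: nn_integral_cmult emeasure_surface_measure[OF SB WB WS])
  have W: "W i = {} \<or> (\<exists>p. good p (\<delta> p) \<and> W i \<subseteq> S \<inter> ball p (\<delta> p) - {y})" for i
    using A(4)[of i]
  proof (elim disjE bexE)
    fix p assume "p \<in> V" "A i \<subseteq> ball p (\<delta> p)"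
    then have "W i \<subseteq> S \<inter> ball p (\<delta> p) - {y}" using V by (auto simp: W_def)
    with \<delta>(2)[OF \<open>p \<in> V\<close>] show ?thesis by blast
  qed (simp add: W_def)
    have up: "\<H> (?f ` W i) \<le> (\<integral>\<^sup>+ x. (ennreal (?J x) + ennreal \<eta>) * indicator (W i) x \<partial>?M)" for i
      using W[of i]
    proof (elim disjE exE conjE)
      fix p assume p: "good p (\<delta> p)" "W i \<subseteq> S \<inter> ball p (\<delta> p) - {y}"
      then have "\<H> (?f ` W i) \<le> ennreal (?J p + \<eta>/2) * \<H> (W i)"
        using WB[of i] ball_subset_cball[of p "\<delta> p"] unfolding good_def by blast
      also have "\<dots> = (\<integral>\<^sup>+ x. ennreal (?J p + \<eta>/2) * indicator (W i) x \<partial>?M)" by (rule const[symmetric])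
      also have "\<dots> \<le> (\<integral>\<^sup>+ x. (ennreal (?J x) + ennreal \<eta>) * indicator (W i) x \<partial>?M)"
      proof (intro nn_integral_mono)
        fix x
        show "ennreal (?J p + \<eta>/2) * indicator (W i) x \<le> (ennreal (?J x) + ennreal \<eta>) * indicator (W i) x"
        proof (cases "x \<in> W i")
          case True
          then have "\<bar>?J x - ?J p\<bar> \<le> \<eta>/2" using p unfolding good_def by blast
          then have "?J p + \<eta>/2 \<le> ?J x + \<eta>" by linarith
          then have "ennreal (?J p + \<eta>/2) \<le> ennreal (?J x + \<eta>)" by (rule ennreal_leI)
          then show ?thesis using True J0[of x] \<eta> by (simp add: ennreal_plus)
        qed simp
      qed
      finally show ?thesis .
    qed simp
    have low: "jacobian_integral S \<nu> y (W i)
        \<le> \<H> (?f ` W i) + ennreal \<eta> * \<H> (W i)" for i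
      using W[of i]
    proof (elim disjE exE conjE)
      fix p assume p: "good p (\<delta> p)" "W i \<subseteq> S \<inter> ball p (\<delta> p) - {y}"
      have "jacobian_integral S \<nu> y (W i)
          \<le> (\<integral>\<^sup>+ x. (ennreal (?J p - \<eta>/2) + ennreal \<eta>) * indicator (W i) x \<partial>?M)"
      proof (intro nn_integral_mono)
        fix x
        show "ennreal (?J x) * indicator (W i) x \<le> (ennreal (?J p - \<eta>/2) + ennreal \<eta>) * indicator (W i) x"
        proof (cases "x \<in> W i")
          case True
          then have "\<bar>?J x - ?J p\<bar> \<le> \<eta>/2" using p unfolding good_def by blast
          \<comment> \<open>\<open>ennreal\<close> sends negative numbers to 0, so the lower local
            estimate only sees the positive part of \<open>?J p - \<eta>/2\<close>.\<close>
          then have "?J x \<le> max 0 (?J p - \<eta>/2) + \<eta>" by linarith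
          then have "ennreal (?J x) \<le> ennreal (max 0 (?J p - \<eta>/2) + \<eta>)" by (rule ennreal_leI)
          also have "\<dots> = ennreal (?J p - \<eta>/2) + ennreal \<eta>"
            using \<eta> by (subst ennreal_plus) (auto simp: max_def ennreal_neg)
          finally show ?thesis using True by simp
        qed simp
      qed
      also have "\<dots> = ennreal (?J p - \<eta>/2) * \<H> (W i) + ennreal \<eta> * \<H> (W i)"
        unfolding const by (simp add: distrib_right)
      also have "ennreal (?J p - \<eta>/2) * \<H> (W i) \<le> \<H> (?f ` W i)"
        using p WB[of i] ball_subset_cball[of p "\<delta> p"] unfolding good_def by blast
      finally show ?thesis by (simp add: add_right_mono)
    qed simp
  show thesis
  proof (rule that[of W])
    show "disjoint_family W" using A(1) by (auto simp: W_def disjoint_family_on_def)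
    show "(\<Union>i. W i) = V" using A(3) by (auto simp: W_def)
  qed (use WB up low in blast)+
qed

lemma ennreal_le_of_small_multiples:
  fixes a b h :: ennreal
  assumes "h < top" "\<And>\<eta>::real. 0 < \<eta> \<Longrightarrow> a \<le> b + ennreal \<eta> * h"
  shows "a \<le> b"
proof (rule ennreal_le_epsilon)
  fix e :: real assume e: "0 < e"
  obtain r where r: "h = ennreal r" "0 \<le> r" using assms(1) by (cases h) auto
  have "a \<le> b + ennreal (e / (r + 1)) * h" using e r by (intro assms(2)) simp
  also have "ennreal (e / (r + 1)) * h = ennreal (e / (r + 1) * r)"
    unfolding r(1) by (rule ennreal_mult[symmetric]) (use e r in auto)
  also have "\<dots> \<le> ennreal e" using e r by (intro ennreal_leI) (simp add: field_simps)
  finally show "a \<le> b + ennreal e" by (simp add: add_left_mono)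
qed

text \<open>Countable subadditivity of the outer measure suffices here: where the images of the
  pieces overlap, the sum merely becomes larger.\<close>

lemma hausdorff_outer_radial_projection_le:
  fixes S :: "'a::euclidean_space set"
  assumes d: "2 \<le> DIM('a)" and S: "C1_surface S \<nu>" and V: "V \<in> sets borel" "V \<subseteq> S - {y}"
  shows "\<H> (radial y ` V) \<le> jacobian_integral S \<nu> y V"
proof (rule ennreal_le_of_small_multiples[OF C1_surface_finite[OF S]])
  let ?J = "jacobian \<nu> y" and ?f = "radial y" and ?M = "surface_measure S"
  fix \<eta> :: real assume \<eta>: "0 < \<eta>"
  have SB: "S \<in> sets borel" using S by (rule C1_surface_borel)
  have [measurable]: "?J \<in> borel_measurable ?M" by (rule jacobian_measurable[OF S])
  obtain W :: "nat \<Rightarrow> 'a set" where W0: "disjoint_family W" "\<forall>i. W i \<in> sets borel" "(\<Union>i. W i) = V"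
    "\<forall>i. \<H> (?f ` W i) \<le> (\<integral>\<^sup>+ x. (ennreal (?J x) + ennreal \<eta>) * indicator (W i) x \<partial>?M)"
    "\<forall>i. jacobian_integral S \<nu> y (W i) \<le> \<H> (?f ` W i) + ennreal \<eta> * \<H> (W i)"
    using radial_projection_partition[OF d S V \<eta>] .
  note W = W0(1) W0(2)[rule_format] W0(3) W0(4)[rule_format] W0(5)[rule_format]
  have WM: "W i \<in> sets ?M" for i
    using W(2)[of i] W(3) V SB by (auto simp: sets_surface_measure sets_restrict_space_iff)
  have VM [measurable]: "V \<in> sets ?M"
    using V SB by (auto simp: sets_surface_measure sets_restrict_space_iff)
  have "\<H> (?f ` V) = \<H> (\<Union>i. ?f ` W i)"
    using W(3) by (simp add: image_UN[symmetric])
  also have "\<dots> \<le> (\<Sum>i. \<H> (?f ` W i))" by (rule hausdorff_outer_UN_le)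
  also have "\<dots> \<le> (\<Sum>i. \<integral>\<^sup>+ x. (ennreal (?J x) + ennreal \<eta>) * indicator (W i) x \<partial>?M)"
    by (intro suminf_le W(4)) auto
  also have "\<dots> = (\<integral>\<^sup>+ x. (ennreal (?J x) + ennreal \<eta>) * indicator V x \<partial>?M)"
    unfolding W(3)[symmetric] by (rule nn_integral_disjoint_pieces[OF _ WM W(1)]) measurable
  also have "\<dots> = jacobian_integral S \<nu> y V + (\<integral>\<^sup>+ x. ennreal \<eta> * indicator V x \<partial>?M)"
    by (simp add: distrib_right nn_integral_add)
  also have "(\<integral>\<^sup>+ x. ennreal \<eta> * indicator V x \<partial>?M) \<le> ennreal \<eta> * \<H> S"
  proof -
    have "V \<subseteq> S" using V by auto
    then show ?thesis
      by (simp add: nn_integral_cmult emeasure_surface_measure[OF SB V(1)] hausdorff_outer_mono mult_left_mono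
          del: One_nat_def)
  qed
  finally show "\<H> (?f ` V)
      \<le> jacobian_integral S \<nu> y V + ennreal \<eta> * \<H> S"
    by (simp add: add_left_mono)
qed

text \<open>Now the measures of the images have to add up, so the images of the pieces must be
  disjoint and Borel; this is what \<open>inj\<close> and \<open>im\<close> provide.\<close>

lemma hausdorff_outer_radial_projection_ge:
  fixes S :: "'a::euclidean_space set"
  assumes d: "2 \<le> DIM('a)" and S: "C1_surface S \<nu>" and V: "V \<in> sets borel" "V \<subseteq> S - {y}"
    and inj: "inj_on (radial y) V"
    and im: "\<And>A. A \<in> sets borel \<Longrightarrow> A \<subseteq> V \<Longrightarrow> radial y ` A \<in> sets borel"
  shows "jacobian_integral S \<nu> y V \<le> \<H> (radial y ` V)"
proof (rule ennreal_le_of_small_multiples[OF C1_surface_finite[OF S]])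
  let ?n = "DIM('a) - 1" and ?J = "jacobian \<nu> y" and ?f = "radial y" and ?M = "surface_measure S"
  fix \<eta> :: real assume \<eta>: "0 < \<eta>"
  have SB: "S \<in> sets borel" using S by (rule C1_surface_borel)
  have [measurable]: "?J \<in> borel_measurable ?M" by (rule jacobian_measurable[OF S])
  obtain W :: "nat \<Rightarrow> 'a set" where W0: "disjoint_family W" "\<forall>i. W i \<in> sets borel" "(\<Union>i. W i) = V"
    "\<forall>i. \<H> (?f ` W i) \<le> (\<integral>\<^sup>+ x. (ennreal (?J x) + ennreal \<eta>) * indicator (W i) x \<partial>?M)"
    "\<forall>i. jacobian_integral S \<nu> y (W i) \<le> \<H> (?f ` W i) + ennreal \<eta> * \<H> (W i)"
    using radial_projection_partition[OF d S V \<eta>] .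
  note W = W0(1) W0(2)[rule_format] W0(3) W0(4)[rule_format] W0(5)[rule_format]
  have WV: "W i \<subseteq> V" for i using W(3) by auto
  have WM: "W i \<in> sets ?M" for i
    using W(2)[of i] W(3) V SB by (auto simp: sets_surface_measure sets_restrict_space_iff)
  have add: "(\<Sum>i. \<H> (X i)) = \<H> (\<Union>i. X i)"
    if X: "\<And>i. X i \<in> sets borel" "disjoint_family X" for X :: "nat \<Rightarrow> 'a set"
    using suminf_emeasure[of X "hausdorff_measure ?n"] X sets.countable_UN[of X UNIV borel]
    by (auto simp: emeasure_hausdorff_measure image_subset_iff)
  have fW: "disjoint_family (\<lambda>i. ?f ` W i)"
    unfolding disjoint_family_on_def
  proof (intro ballI impI)
    fix i j :: nat assume "i \<noteq> j"
    then have "W i \<inter> W j = {}" using W(1) by (auto simp: disjoint_family_on_def)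
    then show "?f ` W i \<inter> ?f ` W j = {}"
      using inj_on_image_Int[OF inj WV WV, of i j] by simp
  qed
  have "jacobian_integral S \<nu> y V = (\<Sum>i. \<integral>\<^sup>+ x. ennreal (?J x) * indicator (W i) x \<partial>?M)"
    unfolding W(3)[symmetric] by (rule nn_integral_disjoint_pieces[OF _ WM W(1), symmetric]) measurable
  also have "\<dots> \<le> (\<Sum>i. \<H> (?f ` W i) + ennreal \<eta> * \<H> (W i))"
    by (intro suminf_le W(5)) auto
  also have "\<dots> = (\<Sum>i. \<H> (?f ` W i)) + ennreal \<eta> * (\<Sum>i. \<H> (W i))"
    by (simp add: suminf_add[symmetric] ennreal_suminf_cmult)
  also have "(\<Sum>i. \<H> (?f ` W i)) = \<H> (?f ` V)"
    unfolding add[OF im[OF W(2) WV] fW] image_UN[symmetric] W(3) ..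
  also have "(\<Sum>i. \<H> (W i)) = \<H> V" unfolding add[OF W(2) W(1)] W(3) ..
  also have "ennreal \<eta> * \<H> V \<le> ennreal \<eta> * \<H> S"
    using V by (intro mult_left_mono hausdorff_outer_mono) auto
  finally show "jacobian_integral S \<nu> y V \<le> \<H> (?f ` V) + ennreal \<eta> * \<H> S"
    by (simp add: add_left_mono)
qed

section \<open>Change of variables and integrals over half spheres\<close>

definition half_sphere :: "'a::euclidean_space \<Rightarrow> 'a set" where
  "half_sphere v = {w. norm w = 1 \<and> w \<bullet> v < 0}"

definition half_sphere_integral :: "'a::euclidean_space \<Rightarrow> ennreal" where
  "half_sphere_integral v =
     (\<integral>\<^sup>+ w. ennreal (- 4 * (w \<bullet> v)) * indicator (half_sphere v) w \<partial>hausdorff_measure (DIM('a) - 1))"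

lemma half_sphere_borel [measurable]: "half_sphere (v::'a::euclidean_space) \<in> sets borel"
  unfolding half_sphere_def by measurable

text \<open>A reflection taking \<open>v\<close> to \<open>v'\<close> preserves Hausdorff measure.
  This is why the bound for the inner integral is the same at every boundary point.\<close>

lemma half_sphere_integral_cong_norm:
  fixes v v' :: "'a::euclidean_space"
  assumes "norm v = norm v'"
  shows "half_sphere_integral v = half_sphere_integral v'"
proof -
  let ?H = "hausdorff_measure (DIM('a) - 1) :: 'a measure"
  obtain R where R: "orthogonal_transformation R" "R v = v'"
    using reflection_exists[OF assms] by metis
  have linR: "linear R" using R(1) by (simp add: orthogonal_transformation_def)
  have Rin: "R x \<bullet> R y = x \<bullet> y" for x y using R(1) by (simp add: orthogonal_transformation_def)
  have [measurable]: "R \<in> borel_measurable borel"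
    using linR by (intro borel_measurable_continuous_onI linear_continuous_on linear_conv_bounded_linear[THEN iffD1])
  have distr: "distr ?H borel R = ?H"
  proof (rule measure_eqI)
    fix A assume "A \<in> sets (distr ?H borel R)"
    then have A: "A \<in> sets borel" by simp
    have "R -` A \<in> sets borel" using measurable_sets[of R borel borel A] A by simp
    moreover have "R ` (R -` A) = A"
      by (rule surj_image_vimage_eq[OF orthogonal_transformation_surj[OF R(1)]])
    then have "\<H> (R -` A) = \<H> A"
      using hausdorff_outer_orthogonal_image[OF R(1), of _ "R -` A"] by simp
    ultimately show "emeasure (distr ?H borel R) A = emeasure ?H A"
      using A by (simp add: emeasure_distr emeasure_hausdorff_measure)
  qed simp
  have "half_sphere_integral v' = (\<integral>\<^sup>+ w. ennreal (- 4 * (w \<bullet> v')) * indicator (half_sphere v') w \<partial>distr ?H borel R)"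
    unfolding half_sphere_integral_def distr ..
  also have "\<dots> = (\<integral>\<^sup>+ w. ennreal (- 4 * (R w \<bullet> v')) * indicator (half_sphere v') (R w) \<partial>?H)"
    by (subst nn_integral_distr) auto
  also have "\<dots> = half_sphere_integral v"
    unfolding half_sphere_integral_def R(2)[symmetric] Rin
    by (intro nn_integral_cong)
       (simp add: indicator_def half_sphere_def Rin orthogonal_transformation_norm[OF R(1)])
  finally show ?thesis ..
qed

text \<open>The push-forward of surface measure weighted by the Jacobian. Formulating the area
  formula as an inequality between measures passes from sets to integrals without simple
  functions.\<close>

abbreviation radial_image_measure ::
    "'a::euclidean_space set \<Rightarrow> ('a \<Rightarrow> 'a) \<Rightarrow> 'a \<Rightarrow> 'a set \<Rightarrow> 'a measure" where
  "radial_image_measure S \<nu> y V \<equiv>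
     distr (density (surface_measure S) (\<lambda>x. ennreal (jacobian \<nu> y x) * indicator V x)) borel (radial y)"

lemma emeasure_radial_density:
  fixes S :: "'a::euclidean_space set"
  assumes S: "C1_surface S \<nu>" and V: "V \<in> sets borel" "V \<subseteq> S" and B: "B \<in> sets borel"
  shows "emeasure (radial_image_measure S \<nu> y V) B
    = jacobian_integral S \<nu> y (V \<inter> radial y -` B)"
proof -
  let ?M = "surface_measure S" and ?f = "radial y"
  have [measurable]: "jacobian \<nu> y \<in> borel_measurable ?M" by (rule jacobian_measurable[OF S])
  have [measurable]: "V \<in> sets ?M"
    using V C1_surface_borel[OF S] by (simp add: sets_surface_measure sets_restrict_space_iff)
  have [measurable]: "?f \<in> borel_measurable ?M"
    by (rule borel_measurable_surface_measure) measurable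
  have [measurable]: "B \<in> sets borel" by fact
  have "?f -` B \<inter> space ?M \<in> sets ?M" by measurable
  then have [measurable]: "?f -` B \<inter> S \<in> sets ?M" by simp
  have "emeasure (radial_image_measure S \<nu> y V) B
      = (\<integral>\<^sup>+ x. ennreal (jacobian \<nu> y x) * indicator V x * indicator (?f -` B \<inter> S) x \<partial>?M)"
    by (subst emeasure_distr) (auto simp: emeasure_density)
  also have "\<dots> = (\<integral>\<^sup>+ x. ennreal (jacobian \<nu> y x) * indicator (V \<inter> ?f -` B) x \<partial>?M)"
    by (intro nn_integral_cong) (auto simp: indicator_def)
  finally show ?thesis .
qed

lemma radial_integral:
  fixes S :: "'a::euclidean_space set"
  assumes S: "C1_surface S \<nu>" and V: "V \<in> sets borel" "V \<subseteq> S" and [measurable]: "g \<in> borel_measurable borel"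
  shows "(\<integral>\<^sup>+ w. g w \<partial>radial_image_measure S \<nu> y V)
    = (\<integral>\<^sup>+ x. g (sgn (x - y)) * ennreal (jacobian \<nu> y x) * indicator V x \<partial>surface_measure S)"
proof -
  let ?M = "surface_measure S" and ?f = "radial y"
  have [measurable]: "jacobian \<nu> y \<in> borel_measurable ?M" by (rule jacobian_measurable[OF S])
  have [measurable]: "V \<in> sets ?M"
    using V C1_surface_borel[OF S] by (simp add: sets_surface_measure sets_restrict_space_iff)
  have [measurable]: "?f \<in> borel_measurable ?M"
    by (rule borel_measurable_surface_measure) measurable
  have "(\<integral>\<^sup>+ w. g w \<partial>radial_image_measure S \<nu> y V)
    = (\<integral>\<^sup>+ x. g (?f x) \<partial>density ?M (\<lambda>x. ennreal (jacobian \<nu> y x) * indicator V x))"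
    by (rule nn_integral_distr) auto
  also have "\<dots> = (\<integral>\<^sup>+ x. ennreal (jacobian \<nu> y x) * indicator V x * g (?f x) \<partial>?M)"
    by (rule nn_integral_density) measurable
  finally show ?thesis by (simp add: ac_simps)
qed

text \<open>The bound for images of sets says that Hausdorff measure on \<open>T\<close> is
  dominated by \<open>radial_image_measure\<close>, and the integral is monotone in the measure.
  Directions hit several times only enlarge the right side.\<close>

lemma nn_integral_radial_le:
  fixes S :: "'a::euclidean_space set"
  assumes d: "2 \<le> DIM('a)" and S: "C1_surface S \<nu>" and V: "V \<in> sets borel" "V \<subseteq> S - {y}"
    and T: "T \<in> sets borel" "T \<subseteq> radial y ` V" and g: "g \<in> borel_measurable borel"
  shows "(\<integral>\<^sup>+ w. g w * indicator T w \<partial>hausdorff_measure (DIM('a) - 1))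
    \<le> (\<integral>\<^sup>+ x. g (sgn (x - y)) * ennreal (jacobian \<nu> y x) * indicator V x \<partial>surface_measure S)"
proof -
  let ?H = "hausdorff_measure (DIM('a) - 1) :: 'a measure"
  let ?N = "radial_image_measure S \<nu> y V"
  have VS: "V \<subseteq> S" using V by auto
  have [measurable]: "T \<in> sets borel" "g \<in> borel_measurable borel" by fact+
  have le: "emeasure (density ?H (indicator T)) B \<le> emeasure ?N B" for B
  proof (cases "B \<in> sets borel")
    case True
    have fB: "radial y -` B \<in> sets borel"
      using measurable_sets[of "\<lambda>x. sgn (x - y)" borel borel B] True by simp
    have "emeasure (density ?H (indicator T)) B = emeasure ?H (T \<inter> B)"
      using True T by (subst emeasure_density) (auto simp: indicator_inter_arith[symmetric])
    also have "\<dots> = \<H> (T \<inter> B)"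
      using True T by (intro emeasure_hausdorff_measure) auto
    also have "\<dots> \<le> \<H> (radial y ` (V \<inter> radial y -` B))"
      using T(2) by (intro hausdorff_outer_mono) auto
    also have "\<dots> \<le> emeasure ?N B"
      unfolding emeasure_radial_density[OF S V(1) VS True]
      using V fB by (intro hausdorff_outer_radial_projection_le[OF d S]) auto
    finally show ?thesis .
  qed (simp add: emeasure_notin_sets)
  have "(\<integral>\<^sup>+ w. g w * indicator T w \<partial>?H) = (\<integral>\<^sup>+ w. g w \<partial>density ?H (indicator T))"
    by (subst nn_integral_density) (auto simp: mult.commute)
  also have "\<dots> \<le> (\<integral>\<^sup>+ w. g w \<partial>?N)"
    by (rule nn_integral_mono_measure) (auto simp: le_measure_iff le_fun_def le simp del: One_nat_def)
  finally show ?thesis unfolding radial_integral[OF S V(1) VS g] .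
qed

lemma nn_integral_radial_ge:
  fixes S :: "'a::euclidean_space set"
  assumes d: "2 \<le> DIM('a)" and S: "C1_surface S \<nu>" and V: "V \<in> sets borel" "V \<subseteq> S - {y}"
    and T: "T \<in> sets borel" "radial y ` V \<subseteq> T" and g: "g \<in> borel_measurable borel"
    and inj: "inj_on (radial y) V"
    and im: "\<And>A. A \<in> sets borel \<Longrightarrow> A \<subseteq> V \<Longrightarrow> radial y ` A \<in> sets borel"
  shows "(\<integral>\<^sup>+ x. g (sgn (x - y)) * ennreal (jacobian \<nu> y x) * indicator V x \<partial>surface_measure S)
    \<le> (\<integral>\<^sup>+ w. g w * indicator T w \<partial>hausdorff_measure (DIM('a) - 1))"
proof -
  let ?H = "hausdorff_measure (DIM('a) - 1) :: 'a measure"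
  let ?N = "radial_image_measure S \<nu> y V"
  have VS: "V \<subseteq> S" using V by auto
  have [measurable]: "T \<in> sets borel" "g \<in> borel_measurable borel" by fact+
  have le: "emeasure ?N B \<le> emeasure (density ?H (indicator T)) B" for B
  proof (cases "B \<in> sets borel")
    case True
    have fB: "V \<inter> radial y -` B \<in> sets borel"
      using measurable_sets[of "\<lambda>x. sgn (x - y)" borel borel B] True V by auto
    have "emeasure ?N B \<le> \<H> (radial y ` (V \<inter> radial y -` B))"
      unfolding emeasure_radial_density[OF S V(1) VS True]
      by (rule hausdorff_outer_radial_projection_ge[OF d S fB])
         (use V inj in \<open>auto intro: im inj_on_subset\<close>)
    also have "\<dots> \<le> \<H> (T \<inter> B)"
      using T(2) by (intro hausdorff_outer_mono) auto
    also have "\<dots> = emeasure ?H (T \<inter> B)"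
      using True T by (intro emeasure_hausdorff_measure[symmetric]) auto
    also have "\<dots> = emeasure (density ?H (indicator T)) B"
      using True T by (subst emeasure_density) (auto simp: indicator_inter_arith[symmetric])
    finally show ?thesis .
  qed (simp add: emeasure_notin_sets)
  have "(\<integral>\<^sup>+ w. g w \<partial>?N) \<le> (\<integral>\<^sup>+ w. g w \<partial>density ?H (indicator T))"
    by (rule nn_integral_mono_measure) (auto simp: le_measure_iff le_fun_def le simp del: One_nat_def)
  also have "\<dots> = (\<integral>\<^sup>+ w. g w * indicator T w \<partial>?H)"
    by (subst nn_integral_density) (auto simp: mult.commute)
  finally show ?thesis unfolding radial_integral[OF S V(1) VS g] .
qed

section \<open>Spheres and the value of the constant\<close>

lemma C1_surface_sphere:
  fixes c :: "'a::euclidean_space"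
  assumes \<rho>: "0 < \<rho>"
  shows "C1_surface (sphere c \<rho>) (\<lambda>x. (1 / \<rho>) *\<^sub>R (x - c))"
  unfolding C1_surface_def
proof (intro conjI ballI allI impI)
  show "continuous_on (sphere c \<rho>) (\<lambda>x. (1 / \<rho>) *\<^sub>R (x - c))" by (intro continuous_intros)
  show "norm ((1 / \<rho>) *\<^sub>R (x - c)) = 1" if "x \<in> sphere c \<rho>" for x
    using that \<rho> by (simp add: dist_norm norm_minus_commute)
  fix p and \<epsilon> :: real assume p: "p \<in> sphere c \<rho>" and \<epsilon>: "0 < \<epsilon>"
  show "\<exists>\<delta>>0. \<forall>x\<in>sphere c \<rho> \<inter> ball p \<delta>. \<forall>y\<in>sphere c \<rho> \<inter> ball p \<delta>.
      \<bar>(1 / \<rho>) *\<^sub>R (p - c) \<bullet> (x - y)\<bar> \<le> \<epsilon> * norm (x - y)"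
  proof (intro exI[of _ "\<epsilon> * \<rho>"] conjI ballI)
    show "0 < \<epsilon> * \<rho>" using \<epsilon> \<rho> by simp
    fix x y assume x: "x \<in> sphere c \<rho> \<inter> ball p (\<epsilon> * \<rho>)" and y: "y \<in> sphere c \<rho> \<inter> ball p (\<epsilon> * \<rho>)"
    have "(x - c) \<bullet> (x - c) = (y - c) \<bullet> (y - c)"
      using x y by (simp add: dist_norm norm_minus_commute flip: power2_norm_eq_inner)
    \<comment> \<open>The equation of the sphere makes \<open>x - y\<close> orthogonal to
      \<open>x + y - 2 c\<close>, so \<open>p - c\<close> may be replaced by the mean of
      \<open>p - x\<close> and \<open>p - y\<close>, which is small near \<open>p\<close>.\<close>
    then have "2 * ((p - c) \<bullet> (x - y)) = ((p - x) + (p - y)) \<bullet> (x - y)"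
      by (simp add: inner_diff_left inner_diff_right inner_add_left inner_add_right inner_commute)
    then have "2 * \<bar>(p - c) \<bullet> (x - y)\<bar> = \<bar>((p - x) + (p - y)) \<bullet> (x - y)\<bar>" by linarith
    also have "\<dots> \<le> norm ((p - x) + (p - y)) * norm (x - y)" by (rule Cauchy_Schwarz_ineq2)
    also have "\<dots> \<le> (\<epsilon> * \<rho> + \<epsilon> * \<rho>) * norm (x - y)"
      using x y by (intro mult_right_mono order_trans[OF norm_triangle_ineq] add_mono) (auto simp: dist_norm)
    finally have "\<bar>(p - c) \<bullet> (x - y)\<bar> \<le> \<epsilon> * \<rho> * norm (x - y)" by simp
    then show "\<bar>(1 / \<rho>) *\<^sub>R (p - c) \<bullet> (x - y)\<bar> \<le> \<epsilon> * norm (x - y)"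
      unfolding inner_scaleR_left abs_mult using \<rho> by (simp add: field_simps)
  qed
qed simp

text \<open>A chord makes the same angle with the sphere at both ends: with \<open>w\<close> the
  direction from \<open>y\<close> to \<open>x\<close>, \<open>\<nu> x \<bullet> w\<close> and
  -\<open>\<nu> y \<bullet> w\<close> both equal \<open>norm (x - y)\<close> / (2 \<rho>). Hence the
  integrand is exactly -4 \<open>w \<bullet> \<nu> y\<close> times the Jacobian, and the projection
  is a bijection onto the half sphere.\<close>

lemma sphere_integral_eq:
  fixes c y :: "'a::euclidean_space"
  assumes d: "2 \<le> DIM('a)" and \<rho>: "0 < \<rho>" and y: "y \<in> sphere c \<rho>"
  defines "\<nu> \<equiv> \<lambda>x. (1 / \<rho>) *\<^sub>R (x - c)"
  shows "(\<integral>\<^sup>+ x. ennreal ((norm (\<nu> x - \<nu> y))\<^sup>2 / norm (x - y) ^ (DIM('a) - 1)) \<partial>surface_measure (sphere c \<rho>))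
    = half_sphere_integral (\<nu> y)"
proof -
  let ?S = "sphere c \<rho>" and ?n = "DIM('a) - 1" and ?f = "radial y"
  have S: "C1_surface ?S \<nu>" unfolding \<nu>_def by (rule C1_surface_sphere[OF \<rho>])
  define v where "v = \<nu> y"
  have v1: "norm v = 1" using y \<rho> by (simp add: v_def \<nu>_def dist_norm norm_minus_commute)
  have yc: "y - c = \<rho> *\<^sub>R v" using \<rho> by (simp add: v_def \<nu>_def)
  define V where "V = ?S - {y}"
  have V: "V \<in> sets borel" "V \<subseteq> ?S - {y}" by (auto simp: V_def)
  have fv: "?f x \<bullet> v = - norm (x - y) / (2 * \<rho>)" "norm (?f x) = 1" if x: "x \<in> V" for x
  proof -
    have "norm ((y - c) + (x - y)) = \<rho>" using x by (simp add: V_def dist_norm norm_minus_commute)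
    then have eq: "(norm ((y - c) + (x - y)))\<^sup>2 = (norm (y - c))\<^sup>2"
      using y by (simp add: dist_norm norm_minus_commute)
    have *: "(norm (a + b))\<^sup>2 = (norm a)\<^sup>2 + 2 * (a \<bullet> b) + (norm b)\<^sup>2" for a b :: 'a
      by (simp add: power2_norm_eq_inner inner_add_left inner_add_right inner_commute)
    from eq *[of "y - c" "x - y"] have "2 * ((y - c) \<bullet> (x - y)) + (norm (x - y))\<^sup>2 = 0" by linarith
    then have 1: "2 * \<rho> * (v \<bullet> (x - y)) + (norm (x - y))\<^sup>2 = 0" by (simp add: yc)
    have nz: "norm (x - y) \<noteq> 0" using x by (simp add: V_def)
    have "?f x \<bullet> v = (v \<bullet> (x - y)) / norm (x - y)"
      by (simp add: sgn_div_norm inner_commute divide_inverse)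
    also have "v \<bullet> (x - y) = - (norm (x - y))\<^sup>2 / (2 * \<rho>)" using 1 \<rho> by (simp add: field_simps)
    finally show "?f x \<bullet> v = - norm (x - y) / (2 * \<rho>)" using nz by (simp add: power2_eq_square)
    show "norm (?f x) = 1" using x by (simp add: V_def norm_sgn)
  qed
  \<comment> \<open>The second intersection of the line through \<open>y\<close> in direction
    \<open>w\<close> with the sphere. On the half sphere it inverts the projection; being Borel on
    the whole space, it also shows that images of Borel sets are Borel.\<close>
  define \<psi> where "\<psi> w = y - (2 * \<rho> * (w \<bullet> v)) *\<^sub>R w" for w
  have \<psi>f: "\<psi> (?f x) = x" if x: "x \<in> V" for x
    using fv(1)[OF x] x \<rho> by (simp add: \<psi>_def) (simp add: sgn_div_norm V_def)
  have f\<psi>: "\<psi> w \<in> V" "?f (\<psi> w) = w" if w: "w \<in> half_sphere v" for w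
  proof -
    have w1: "w \<bullet> w = 1" and wv: "w \<bullet> v < 0" using w by (auto simp: half_sphere_def norm_eq_1)
    have v2: "v \<bullet> v = 1" using v1 by (simp add: norm_eq_1)
    have "\<psi> w - c = \<rho> *\<^sub>R (v - (2 * (w \<bullet> v)) *\<^sub>R w)" using yc by (simp add: \<psi>_def algebra_simps)
    moreover have "norm (v - (2 * (w \<bullet> v)) *\<^sub>R w) = 1"
      unfolding norm_eq_1 using w1 v2 by (simp add: inner_diff_left inner_diff_right inner_commute)
    ultimately have "norm (\<psi> w - c) = \<rho>" using \<rho> by simp
    moreover have pos: "0 < - (2 * \<rho> * (w \<bullet> v))" using \<rho> wv by (simp add: mult_pos_neg)
    moreover have "\<psi> w - y = (- (2 * \<rho> * (w \<bullet> v))) *\<^sub>R w" by (simp add: \<psi>_def)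
    ultimately show "\<psi> w \<in> V"
      using w1 by (auto simp: V_def dist_norm norm_minus_commute)
    have "sgn w = w" using w by (simp add: sgn_div_norm half_sphere_def)
    then show "?f (\<psi> w) = w"
      unfolding \<open>\<psi> w - y = _\<close> sgn_scaleR using pos by simp
  qed
  have fV: "?f x \<in> half_sphere v" if "x \<in> V" for x
    using fv[OF that] that \<rho> by (simp add: half_sphere_def V_def)
  have img: "?f ` V = half_sphere v"
  proof (intro set_eqI iffI)
    fix w assume w: "w \<in> half_sphere v"
    show "w \<in> ?f ` V" using f\<psi>[OF w] by (metis imageI)
  qed (use fV in auto)
  have inj: "inj_on ?f V" by (rule inj_on_inverseI[of V \<psi>]) (rule \<psi>f)
  have im: "?f ` A \<in> sets borel" if A: "A \<in> sets borel" "A \<subseteq> V" for A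
  proof -
    have [measurable]: "\<psi> \<in> borel_measurable borel" unfolding \<psi>_def[abs_def] by measurable
    have "\<psi> -` A \<in> sets borel" using measurable_sets[of \<psi> borel borel A] A by simp
    moreover have "?f ` A = half_sphere v \<inter> \<psi> -` A"
    proof (intro set_eqI iffI)
      fix w assume "w \<in> ?f ` A"
      then obtain x where "x \<in> A" "x \<in> V" "w = ?f x" using A(2) by blast
      then show "w \<in> half_sphere v \<inter> \<psi> -` A" using fV[of x] \<psi>f[of x] by simp
    next
      fix w assume "w \<in> half_sphere v \<inter> \<psi> -` A"
      then show "w \<in> ?f ` A" using f\<psi>(2)[of w] by (auto intro: image_eqI[of _ _ "\<psi> w"])
    qed
    ultimately show ?thesis by simp
  qed
  have integrand: "ennreal ((norm (\<nu> x - \<nu> y))\<^sup>2 / norm (x - y) ^ ?n)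
      = ennreal (- 4 * (?f x \<bullet> v)) * ennreal (jacobian \<nu> y x) * indicator V x" if x: "x \<in> ?S" for x
  proof (cases "x = y")
    case False
    then have xV: "x \<in> V" using x by (simp add: V_def)
    have \<nu>d: "\<nu> x - \<nu> y = (1 / \<rho>) *\<^sub>R (x - y)" by (simp add: \<nu>_def algebra_simps)
    then have \<nu>x: "\<nu> x = v + (1 / \<rho>) *\<^sub>R (x - y)" by (simp add: v_def algebra_simps)
    have xy: "(x - y) \<bullet> ?f x = norm (x - y)"
      using False by (simp add: sgn_div_norm power2_eq_square flip: power2_norm_eq_inner)
    have "\<nu> x \<bullet> ?f x = ?f x \<bullet> v + (1 / \<rho>) * ((x - y) \<bullet> ?f x)"
      unfolding \<nu>x inner_add_left inner_scaleR_left by (simp only: inner_commute)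
    also have "\<dots> = norm (x - y) / (2 * \<rho>)"
      unfolding fv(1)[OF xV] xy using \<rho> by (simp add: field_simps)
    finally have "jacobian \<nu> y x = norm (x - y) / (2 * \<rho>) / norm (x - y) ^ ?n"
      using \<rho> by (simp add: jacobian_def)
    then have "- 4 * (?f x \<bullet> v) * jacobian \<nu> y x = (norm (\<nu> x - \<nu> y))\<^sup>2 / norm (x - y) ^ ?n"
      using fv(1)[OF xV] \<rho> unfolding \<nu>d by (simp add: power_divide power2_eq_square)
    moreover have "0 \<le> - 4 * (?f x \<bullet> v)" using fv(1)[OF xV] \<rho> by simp
    ultimately show ?thesis
      using xV by (simp add: ennreal_mult'[symmetric] del: mult_minus_left)
  qed (simp add: V_def)
  have "(\<integral>\<^sup>+ x. ennreal ((norm (\<nu> x - \<nu> y))\<^sup>2 / norm (x - y) ^ ?n) \<partial>surface_measure ?S)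
      = (\<integral>\<^sup>+ x. ennreal (- 4 * (?f x \<bullet> v)) * ennreal (jacobian \<nu> y x) * indicator V x \<partial>surface_measure ?S)"
    using integrand by (intro nn_integral_cong) simp
  also have "\<dots> = half_sphere_integral v"
    unfolding half_sphere_integral_def
    using nn_integral_radial_le[OF d S V half_sphere_borel, of v "\<lambda>w. ennreal (- 4 * (w \<bullet> v))"]
      nn_integral_radial_ge[OF d S V half_sphere_borel, of v "\<lambda>w. ennreal (- 4 * (w \<bullet> v))"] inj im img
    by (intro antisym) auto
  finally show ?thesis by (simp add: v_def)
qed

text \<open>On the unit sphere the normal is the position vector, so this is
  \<open>sphere_integral_eq\<close> at \<open>e\<close>. The integrands may differ at
  \<open>x = e\<close>: in dimension 3 one is \<open>0 powi 0 = 1\<close>, the other is a quotient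
  with value 0 there. That point has measure zero.\<close>

lemma unit_sphere_integral_eq:
  fixes e :: "'a::euclidean_space"
  assumes d: "2 \<le> DIM('a)" and e: "e \<in> sphere 0 1"
  shows "(\<integral>\<^sup>+ x. ennreal (norm (x - e) powi (3 - int DIM('a))) \<partial>surface_measure (sphere 0 1)) = half_sphere_integral e"
proof -
  let ?M = "surface_measure (sphere (0::'a) 1)"
  have eM: "{e} \<in> sets ?M"
    using e by (simp add: sets_surface_measure sets_restrict_space_iff)
  have "emeasure ?M {e} = 0"
    using e d by (subst emeasure_surface_measure) (auto intro: hausdorff_outer_singleton)
  then have "AE x in ?M. x \<noteq> e"
    using eM by (intro AE_I'[of "{e}"]) (auto simp: null_sets_def)
  then have "(\<integral>\<^sup>+ x. ennreal (norm (x - e) powi (3 - int DIM('a))) \<partial>?M)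
      = (\<integral>\<^sup>+ x. ennreal ((norm ((1 / 1) *\<^sub>R (x - 0) - (1 / 1) *\<^sub>R (e - 0)))\<^sup>2 / norm (x - e) ^ (DIM('a) - 1)) \<partial>?M)"
  proof (intro nn_integral_cong_AE, eventually_elim)
    fix x assume "x \<noteq> e"
    define n where "n = DIM('a) - 1"
    have "3 - int DIM('a) = 2 - int n" using d by (simp add: n_def of_nat_diff)
    moreover have "norm (x - e) powi (2 - int n) = norm (x - e) powi 2 / norm (x - e) powi int n"
      using \<open>x \<noteq> e\<close> by (intro power_int_diff) simp
    ultimately have "norm (x - e) powi (3 - int DIM('a)) = norm (x - e) powi 2 / norm (x - e) powi int n"
      by metis
    also have "\<dots> = (norm (x - e))\<^sup>2 / norm (x - e) ^ (DIM('a) - 1)"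
      unfolding n_def[symmetric] by simp
    finally show "ennreal (norm (x - e) powi (3 - int DIM('a)))
      = ennreal ((norm ((1 / 1) *\<^sub>R (x - 0) - (1 / 1) *\<^sub>R (e - 0)))\<^sup>2 / norm (x - e) ^ (DIM('a) - 1))"
      by simp
  qed
  also have "\<dots> = half_sphere_integral ((1 / 1) *\<^sub>R (e - 0))"
    using e by (intro sphere_integral_eq d) auto
  finally show ?thesis by simp
qed

section \<open>Boundaries of \<open>C\<^sup>2\<close> domains\<close>

text \<open>Intended is \<open>F x = \<gamma> (perp u x) - x \<bullet> u\<close> with gradient
  \<open>G\<close>. The last condition gives a global correction onto the zero set: moving from
  \<open>x\<close> by \<open>F x *\<^sub>R u\<close> always ends where \<open>F\<close>
  vanishes.\<close>

definition defining_function ::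
  "'a::euclidean_space set \<Rightarrow> 'a \<Rightarrow> real \<Rightarrow> 'a \<Rightarrow> ('a \<Rightarrow> real) \<Rightarrow> ('a \<Rightarrow> 'a) \<Rightarrow> bool" where
  "defining_function \<Omega> p r u F G \<longleftrightarrow> 0 < r \<and> norm u = 1 \<and>
     (\<forall>x\<in>ball p r. x \<in> \<Omega> \<longleftrightarrow> F x < 0) \<and> (\<forall>x\<in>ball p r. x \<in> frontier \<Omega> \<longleftrightarrow> F x = 0) \<and>
     (\<forall>x. (F has_derivative (\<lambda>h. G x \<bullet> h)) (at x)) \<and> continuous_on UNIV G \<and>
     (\<forall>x. G x \<bullet> u = - 1) \<and> (\<forall>x t. F (x + t *\<^sub>R u) = F x - t)"

text \<open>\<open>C2_boundary\<close> describes \<Omega> only; the boundary has to be located.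
  Points with \<open>F\<close> positive have a neighbourhood missing \<Omega>, and from a zero of
  \<open>F\<close> any small step along \<open>u\<close> enters \<Omega>.\<close>

lemma defining_function_exists:
  fixes \<Omega> :: "'a::euclidean_space set"
  assumes C2: "C2_boundary \<Omega>" and op: "open \<Omega>" and p: "p \<in> frontier \<Omega>"
  shows "\<exists>r u F G. defining_function \<Omega> p r u F G"
proof -
  obtain r u \<gamma> where r: "r > 0" and u: "norm u = 1" and \<gamma>: "C2_function \<gamma>"
    and \<Omega>: "\<Omega> \<inter> ball p r = {x \<in> ball p r. \<gamma> (x - (x \<bullet> u) *\<^sub>R u) < x \<bullet> u}"
    using C2 p unfolding C2_boundary_def by blast
  obtain f' :: "'a \<Rightarrow> 'a \<Rightarrow>\<^sub>L real" and f'' where f': "\<And>x. (\<gamma> has_derivative blinfun_apply (f' x)) (at x)"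
    and f'': "\<And>x. (f' has_derivative blinfun_apply (f'' x)) (at x)"
    using \<gamma> unfolding C2_function_def by blast
  have f'c: "continuous_on UNIV f'"
    using f'' by (meson continuous_at_imp_continuous_on has_derivative_continuous)
  define F where "F x = \<gamma> (perp u x) - x \<bullet> u" for x
  define L where "L x h = f' (perp u x) (perp u h) - h \<bullet> u" for x h
  \<comment> \<open>The Riesz representative of the derivative \<open>L x\<close>, assembled from
    its values on the basis.\<close>
  define G where "G x = (\<Sum>b\<in>Basis. L x b *\<^sub>R b)" for x
  have blp: "bounded_linear (perp u)"
    unfolding perp_def[abs_def] by (intro bounded_linear_intros)
  have bl: "bounded_linear (L x)" for x
    unfolding L_def[abs_def]
    by (intro bounded_linear_sub bounded_linear_inner_left bounded_linear_compose[OF blinfun.bounded_linear_right blp])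
  have GL: "G x \<bullet> h = L x h" for x h
  proof -
    have "L x h = L x (\<Sum>b\<in>Basis. (h \<bullet> b) *\<^sub>R b)" by (simp add: euclidean_representation)
    also have "\<dots> = (\<Sum>b\<in>Basis. (h \<bullet> b) * L x b)"
      using bounded_linear.linear[OF bl] by (simp add: linear_sum linear_cmul)
    also have "\<dots> = G x \<bullet> h" by (simp add: G_def inner_sum_left inner_commute[of h] mult.commute)
    finally show ?thesis ..
  qed
  have pu: "perp u u = 0" using u by (simp add: perp_def norm_eq_1)
  have dF: "(F has_derivative (\<lambda>h. G x \<bullet> h)) (at x)" for x
  proof -
    have "(perp u has_derivative perp u) (at x)"
      using blp by (rule bounded_linear_imp_has_derivative)
    from has_derivative_compose[OF this f']
    have "((\<lambda>x. \<gamma> (perp u x)) has_derivative (\<lambda>h. f' (perp u x) (perp u h))) (at x)" .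
    then have "(F has_derivative (\<lambda>h. f' (perp u x) (perp u h) - h \<bullet> u)) (at x)"
      unfolding F_def[abs_def] by (intro has_derivative_diff has_derivative_inner_left has_derivative_ident)
    then show ?thesis by (simp add: GL L_def)
  qed
  have cG: "continuous_on UNIV G"
  proof -
    have "continuous_on UNIV (\<lambda>x. f' (perp u x))"
      by (rule continuous_on_compose2[OF f'c continuous_on_perp]) auto
    then show ?thesis unfolding G_def[abs_def] L_def by (intro continuous_intros)
  qed
  have Gu: "G x \<bullet> u = - 1" for x
    using u unfolding GL by (simp add: L_def pu blinfun.zero_right norm_eq_1)
  have Fu: "F (x + t *\<^sub>R u) = F x - t" for x t
    using u by (simp add: F_def perp_def inner_add_left norm_eq_1 algebra_simps)
  have in\<Omega>: "x \<in> \<Omega> \<longleftrightarrow> F x < 0" if "x \<in> ball p r" for x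
  proof -
    have "x \<in> \<Omega> \<longleftrightarrow> x \<in> \<Omega> \<inter> ball p r" using that by simp
    also have "\<dots> \<longleftrightarrow> F x < 0" unfolding \<Omega> using that by (simp add: F_def perp_def)
    finally show ?thesis .
  qed
  have Fc: "continuous_on UNIV F"
    using dF by (meson continuous_at_imp_continuous_on has_derivative_continuous)
  have fr: "x \<in> frontier \<Omega> \<longleftrightarrow> F x = 0" if x: "x \<in> ball p r" for x
  proof
    assume "x \<in> frontier \<Omega>"
    then have "x \<notin> \<Omega>" "x \<in> closure \<Omega>" using op by (auto simp: frontier_def interior_open)
    have "\<not> F x > 0"
    proof
      assume "F x > 0"
      moreover have "open (ball p r \<inter> {x. 0 < F x})"
        by (intro open_Int open_ball open_Collect_less continuous_intros Fc)
      ultimately have "\<Omega> \<inter> (ball p r \<inter> {x. 0 < F x}) \<noteq> {}"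
        using \<open>x \<in> closure \<Omega>\<close> x open_Int_closure_eq_empty[of "ball p r \<inter> {x. 0 < F x}" \<Omega>] by blast
      then show False using in\<Omega> by fastforce
    qed
    with \<open>x \<notin> \<Omega>\<close> in\<Omega>[OF x] show "F x = 0" by simp
  next
    assume F0: "F x = 0"
    have "x \<notin> \<Omega>" using in\<Omega>[OF x] F0 by simp
    moreover have "x \<in> closure \<Omega>"
      unfolding closure_approachable
    proof (intro allI impI)
      fix e :: real assume e: "0 < e"
      define t where "t = min e (r - dist p x) / 2"
      have t: "0 < t" "t < e" "t < r - dist p x" using e x by (auto simp: t_def min_def)
      have "dist p (x + t *\<^sub>R u) \<le> dist p x + t"
        using dist_triangle[of p "x + t *\<^sub>R u" x] t u by (simp add: dist_norm)
      then have "x + t *\<^sub>R u \<in> ball p r" using t by simp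
      then have "x + t *\<^sub>R u \<in> \<Omega>" using in\<Omega> Fu F0 t by simp
      moreover have "dist (x + t *\<^sub>R u) x < e" using t u by (simp add: dist_norm)
      ultimately show "\<exists>y\<in>\<Omega>. dist y x < e" by blast
    qed
    ultimately show "x \<in> frontier \<Omega>" using op by (simp add: frontier_def interior_open)
  qed
  show ?thesis
    unfolding defining_function_def using r u in\<Omega> fr dF cG Gu Fu by blast
qed

lemma defining_function_nonzero: "defining_function \<Omega> p r u F G \<Longrightarrow> G x \<noteq> 0"
  unfolding defining_function_def by (metis inner_zero_left neg_equal_0_iff_equal zero_neq_one)

lemma defining_function_line_derivative:
  assumes "defining_function \<Omega> p r u F G"
  shows "((\<lambda>t. F (x + t *\<^sub>R w)) has_real_derivative (G x \<bullet> w)) (at 0)"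
proof -
  have 1: "((\<lambda>t::real. x + t *\<^sub>R w) has_derivative (\<lambda>t. t *\<^sub>R w)) (at 0)"
    by (auto intro!: derivative_eq_intros)
  have 2: "(F has_derivative (\<lambda>h. G x \<bullet> h)) (at (x + 0 *\<^sub>R w))"
    using assms by (simp add: defining_function_def)
  show ?thesis
    using has_derivative_compose[OF 1 2]
    by (simp add: has_field_derivative_def mult_commute_abs)
qed

text \<open>\<open>outward_unit_normal\<close> is given by curves and one-sided membership. It is
  unique because every direction orthogonal to the gradient is a tangent vector, which forces
  \<open>n\<close> to be parallel to the gradient, and membership of
  \<open>x - t *\<^sub>R n\<close> in \<Omega> fixes the sign.\<close>

lemma outward_unit_normal_eq:
  fixes \<Omega> :: "'a::euclidean_space set"
  assumes F: "defining_function \<Omega> p r u F G" and x: "x \<in> frontier \<Omega>" "x \<in> ball p r"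
    and n: "outward_unit_normal \<Omega> x n"
  shows "n = sgn (G x)"
proof -
  define g where "g = sgn (G x)"
  have G0: "G x \<noteq> 0" by (rule defining_function_nonzero[OF F])
  then have g1: "norm g = 1" by (simp add: g_def norm_sgn)
  have Gg: "G x = norm (G x) *\<^sub>R g" using G0 by (simp add: g_def sgn_div_norm)
  have Fx: "F x = 0" using F x by (simp add: defining_function_def)
  have Fu: "F (z + t *\<^sub>R u) = F z - t" for z t using F by (simp add: defining_function_def)
  have dF: "(F has_derivative (\<lambda>h. G z \<bullet> h)) (at z)" for z using F by (simp add: defining_function_def)
  have tangent: "n \<bullet> h = 0" if h: "g \<bullet> h = 0" for h
  proof -
    \<comment> \<open>The straight line, corrected along \<open>u\<close> onto the zero set. As
      \<open>h\<close> is orthogonal to the gradient, the correction has derivative 0 and the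
      velocity is still \<open>h\<close>.\<close>
    define c where "c t = x + t *\<^sub>R h + F (x + t *\<^sub>R h) *\<^sub>R u" for t
    have Gh: "G x \<bullet> h = 0" using h by (subst Gg) simp
    have c0: "c 0 = x" by (simp add: c_def Fx)
    have "((\<lambda>t. F (x + t *\<^sub>R h)) has_vector_derivative 0) (at 0)"
      using defining_function_line_derivative[OF F, of x h] Gh
      by (simp add: has_real_derivative_iff_has_vector_derivative)
    then have dc: "(c has_vector_derivative h) (at 0)"
      unfolding c_def[abs_def] by (auto intro!: derivative_eq_intros simp: has_vector_derivative_def has_derivative_scaleR_left)
    have "(c \<longlongrightarrow> c 0) (at 0)"
      using has_vector_derivative_continuous[OF dc] by (simp add: continuous_at)
    then have "\<forall>\<^sub>F t in at 0. c t \<in> ball p r"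
      using x(2) unfolding c0 by (intro topological_tendstoD) auto
    then have "\<forall>\<^sub>F t in at 0. c t \<in> frontier \<Omega>"
    proof eventually_elim
      case (elim t)
      moreover have "F (c t) = 0" by (simp add: c_def Fu)
      ultimately show ?case using F by (simp add: defining_function_def)
    qed
    then have "h \<in> tangent_vectors (frontier \<Omega>) x"
      unfolding tangent_vectors_def using c0 dc by blast
    then show ?thesis using n by (simp add: outward_unit_normal_def)
  qed
  have n1: "norm n = 1" using n by (simp add: outward_unit_normal_def)
  have gg: "g \<bullet> g = 1" "n \<bullet> n = 1" using g1 n1 by (simp_all add: norm_eq_1)
  have "g \<bullet> (n - (n \<bullet> g) *\<^sub>R g) = 0" using gg by (simp add: inner_diff_right inner_commute)
  from tangent[OF this] have "(n \<bullet> g)\<^sup>2 = 1" using gg by (simp add: inner_diff_right power2_eq_square)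
  then consider "n \<bullet> g = 1" | "n \<bullet> g = - 1" by (auto simp: power2_eq_1_iff)
  then show ?thesis
  proof cases
    case 1
    then have "(n - g) \<bullet> (n - g) = 0" using gg by (simp add: inner_diff_left inner_diff_right inner_commute)
    then show ?thesis by (simp add: g_def)
  next
    case 2
    then have "(n + g) \<bullet> (n + g) = 0" using gg by (simp add: inner_add_left inner_add_right inner_commute)
    then have ng: "n = - g" by (simp add: add_eq_0_iff2)
    have "G x \<bullet> g > 0" using G0 gg by (subst Gg) simp
    then obtain d where d: "d > 0" "\<And>t. 0 < t \<Longrightarrow> t < d \<Longrightarrow> F x < F (x + t *\<^sub>R g)"
      using DERIV_pos_inc_right[OF defining_function_line_derivative[OF F, of x g]] by auto
    have "\<forall>\<^sub>F t in at_right 0. x - t *\<^sub>R n \<in> \<Omega>"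
      using n unfolding outward_unit_normal_def by (auto elim: eventually_mono)
    moreover have "\<forall>\<^sub>F t in at_right (0::real). t < d" "\<forall>\<^sub>F t in at_right (0::real). 0 < t"
      using d(1) by (auto intro: order_tendstoD(2)[OF tendsto_ident_at] simp: eventually_at_right_less)
    moreover have "((\<lambda>t. x + t *\<^sub>R g) \<longlongrightarrow> x + 0 *\<^sub>R g) (at_right 0)" by (intro tendsto_intros)
    then have "\<forall>\<^sub>F t in at_right 0. x + t *\<^sub>R g \<in> ball p r"
      using x(2) by (intro topological_tendstoD) auto
    ultimately have "\<forall>\<^sub>F t in at_right (0::real). False"
    proof eventually_elim
      case (elim t)
      then have "F (x + t *\<^sub>R g) < 0" using F by (simp add: ng defining_function_def)
      with d(2)[of t] elim Fx show ?case by simp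
    qed
    then show ?thesis by simp
  qed
qed

context
  fixes \<Omega> :: "'a::euclidean_space set" and \<nu> :: "'a \<Rightarrow> 'a"
  assumes domain: "bounded_C2_domain \<Omega>"
    and normal: "\<forall>x\<in>frontier \<Omega>. outward_unit_normal \<Omega> x (\<nu> x)"
begin

lemma boundary_defining_function:
  assumes "p \<in> frontier \<Omega>"
  shows "\<exists>r u F G. defining_function \<Omega> p r u F G \<and> (\<forall>x\<in>frontier \<Omega> \<inter> ball p r. \<nu> x = sgn (G x))"
proof -
  obtain r u F G where F: "defining_function \<Omega> p r u F G"
    using defining_function_exists[OF _ _ assms] domain unfolding bounded_C2_domain_def by blast
  moreover have "\<forall>x\<in>frontier \<Omega> \<inter> ball p r. \<nu> x = sgn (G x)"
    using outward_unit_normal_eq[OF F] normal by blast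
  ultimately show ?thesis by blast
qed

lemma boundary_normal_inner_sign:
  assumes "defining_function \<Omega> p r u F G" "\<nu> x = sgn (G x)"
  shows "\<nu> x \<bullet> w < 0 \<longleftrightarrow> G x \<bullet> w < 0" "0 < \<nu> x \<bullet> w \<longleftrightarrow> 0 < G x \<bullet> w"
  using defining_function_nonzero[OF assms(1), of x] assms(2)
  by (auto simp: sgn_div_norm mult_less_0_iff zero_less_mult_iff)

text \<open>For the secant condition, \<open>F\<close> vanishes at both boundary points, so
  \<open>G p \<bullet> (x - y)\<close> is purely the error of linearising \<open>F\<close> at
  \<open>p\<close>. The mean value inequality bounds it by the oscillation of \<open>G\<close> near
  \<open>p\<close>.\<close>

lemma boundary_C1_surface: "C1_surface (frontier \<Omega>) \<nu>"
  unfolding C1_surface_def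
proof (intro conjI ballI allI impI)
  have "bounded \<Omega>" using domain by (simp add: bounded_C2_domain_def)
  then show "compact (frontier \<Omega>)" by (rule compact_frontier_bounded)
  show "norm (\<nu> x) = 1" if "x \<in> frontier \<Omega>" for x
    using normal that by (simp add: outward_unit_normal_def)
  show "continuous_on (frontier \<Omega>) \<nu>"
    unfolding continuous_on_eq_continuous_within
  proof
    fix p assume p: "p \<in> frontier \<Omega>"
    obtain r u F G where F: "defining_function \<Omega> p r u F G"
      and \<nu>: "\<forall>x\<in>frontier \<Omega> \<inter> ball p r. \<nu> x = sgn (G x)"
      using boundary_defining_function[OF p] by blast
    have "isCont G p" using F by (simp add: defining_function_def continuous_on_eq_continuous_at)
    then have "isCont (\<lambda>x. sgn (G x)) p"
      using defining_function_nonzero[OF F, of p] by (intro isCont_sgn)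
    then have "continuous (at p within frontier \<Omega>) (\<lambda>x. sgn (G x))" by (rule continuous_at_imp_continuous_within)
    then show "continuous (at p within frontier \<Omega>) \<nu>"
      by (rule continuous_transform_within[of _ _ _ r])
         (use F \<nu> p in \<open>auto simp: defining_function_def dist_commute\<close>)
  qed
  fix p and \<epsilon> :: real assume p: "p \<in> frontier \<Omega>" and \<epsilon>: "0 < \<epsilon>"
  obtain r u F G where F: "defining_function \<Omega> p r u F G"
    and \<nu>: "\<forall>x\<in>frontier \<Omega> \<inter> ball p r. \<nu> x = sgn (G x)"
    using boundary_defining_function[OF p] by blast
  have r: "r > 0" using F by (simp add: defining_function_def)
  have \<nu>p: "\<nu> p = sgn (G p)" using \<nu> p r by simp
  have G0: "0 < norm (G p)" using defining_function_nonzero[OF F] by simp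
  have "isCont G p" using F by (simp add: defining_function_def continuous_on_eq_continuous_at)
  then obtain d where d: "d > 0" "\<And>x. dist x p < d \<Longrightarrow> dist (G x) (G p) < \<epsilon> * norm (G p)"
    using \<epsilon> G0 unfolding continuous_at_eps_delta by (metis mult_pos_pos)
  show "\<exists>\<delta>>0. \<forall>x\<in>frontier \<Omega> \<inter> ball p \<delta>. \<forall>y\<in>frontier \<Omega> \<inter> ball p \<delta>. \<bar>\<nu> p \<bullet> (x - y)\<bar> \<le> \<epsilon> * norm (x - y)"
  proof (intro exI[of _ "min r d"] conjI ballI)
    fix x y assume x: "x \<in> frontier \<Omega> \<inter> ball p (min r d)" and y: "y \<in> frontier \<Omega> \<inter> ball p (min r d)"
    have "norm ((F x - G p \<bullet> x) - (F y - G p \<bullet> y)) \<le> \<epsilon> * norm (G p) * norm (x - y)"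
    proof (rule differentiable_bound[of "ball p d" "\<lambda>x. F x - G p \<bullet> x" "\<lambda>x h. G x \<bullet> h - G p \<bullet> h"])
      fix z assume z: "z \<in> ball p d"
      show "((\<lambda>x. F x - G p \<bullet> x) has_derivative (\<lambda>h. G z \<bullet> h - G p \<bullet> h)) (at z within ball p d)"
        using F by (intro has_derivative_diff has_derivative_inner_right has_derivative_ident)
          (auto simp: defining_function_def intro: has_derivative_at_withinI)
      show "onorm (\<lambda>h. G z \<bullet> h - G p \<bullet> h) \<le> \<epsilon> * norm (G p)"
      proof (rule onorm_le)
        fix h
        have "norm (G z \<bullet> h - G p \<bullet> h) \<le> norm (G z - G p) * norm h"
          using Cauchy_Schwarz_ineq2[of "G z - G p" h] by (simp add: inner_diff_left)
        also have "\<dots> \<le> \<epsilon> * norm (G p) * norm h"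
          using d(2)[of z] z by (intro mult_right_mono) (auto simp: dist_norm norm_minus_commute)
        finally show "norm (G z \<bullet> h - G p \<bullet> h) \<le> \<epsilon> * norm (G p) * norm h" .
      qed
    qed (use x y in auto)
    moreover have "F x = 0" "F y = 0" using F x y by (auto simp: defining_function_def)
    ultimately have "\<bar>G p \<bullet> (x - y)\<bar> \<le> \<epsilon> * norm (G p) * norm (x - y)"
      by (simp add: inner_diff_right abs_minus_commute)
    then show "\<bar>\<nu> p \<bullet> (x - y)\<bar> \<le> \<epsilon> * norm (x - y)"
      unfolding \<nu>p using G0 by (simp add: sgn_div_norm abs_mult field_simps)
  qed (use r d in auto)
qed

section \<open>Rays through the domain and the size of boundary pieces\<close>

lemma boundary_ray_enters:
  assumes y: "y \<in> frontier \<Omega>" and w: "\<nu> y \<bullet> w < 0"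
  shows "\<exists>d>0. \<forall>t. 0 < t \<and> t < d \<longrightarrow> y + t *\<^sub>R w \<in> \<Omega>"
proof -
  obtain r u F G where F: "defining_function \<Omega> y r u F G"
    and \<nu>: "\<forall>x\<in>frontier \<Omega> \<inter> ball y r. \<nu> x = sgn (G x)"
    using boundary_defining_function[OF y] by blast
  have r: "r > 0" using F by (simp add: defining_function_def)
  have "G y \<bullet> w < 0" using boundary_normal_inner_sign(1)[OF F] \<nu> y r w by simp
  then obtain d where d: "d > 0" "\<And>t. 0 < t \<Longrightarrow> t < d \<Longrightarrow> F (y + t *\<^sub>R w) < F y"
    using DERIV_neg_dec_right[OF defining_function_line_derivative[OF F, of y w]] by auto
  have Fy: "F y = 0" using F y r by (simp add: defining_function_def)
  have w0: "0 < norm w" using w by auto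
  show ?thesis
  proof (intro exI[of _ "min d (r / norm w)"] conjI allI impI)
    show "0 < min d (r / norm w)" using d r w0 by simp
    fix t assume t: "0 < t \<and> t < min d (r / norm w)"
    then have "y + t *\<^sub>R w \<in> ball y r" using w0 by (simp add: dist_norm field_simps)
    moreover have "F (y + t *\<^sub>R w) < 0" using d(2)[of t] t Fy by simp
    ultimately show "y + t *\<^sub>R w \<in> \<Omega>" using F by (simp add: defining_function_def)
  qed
qed

text \<open>The exit time is the infimum \<open>s\<close> of the positive times outside \<Omega>; it
  is positive since the ray starts inside, and finite since \<Omega> is bounded.\<close>

lemma boundary_ray_exits:
  assumes y: "y \<in> frontier \<Omega>" and w: "norm w = 1" "\<nu> y \<bullet> w < 0"
  shows "\<exists>t>0. y + t *\<^sub>R w \<in> frontier \<Omega> \<and> 0 \<le> \<nu> (y + t *\<^sub>R w) \<bullet> w"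
proof -
  have op: "open \<Omega>" and bd: "bounded \<Omega>" using domain by (auto simp: bounded_C2_domain_def)
  obtain d where d: "d > 0" "\<And>t. 0 < t \<Longrightarrow> t < d \<Longrightarrow> y + t *\<^sub>R w \<in> \<Omega>"
    using boundary_ray_enters[OF y w(2)] by blast
  define X where "X = {t. 0 < t \<and> y + t *\<^sub>R w \<notin> \<Omega>}"
  obtain m where m: "\<And>x. x \<in> \<Omega> \<Longrightarrow> norm x \<le> m" using bd by (auto simp: bounded_iff)
  have "y + (m + norm y + 1 + d) *\<^sub>R w \<notin> \<Omega>"
  proof
    assume "y + (m + norm y + 1 + d) *\<^sub>R w \<in> \<Omega>"
    then have "norm (y + (m + norm y + 1 + d) *\<^sub>R w) \<le> m" by (rule m)
    moreover have "\<bar>m + norm y + 1 + d\<bar> - norm y \<le> norm (y + (m + norm y + 1 + d) *\<^sub>R w)"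
      using norm_diff_ineq[of "(m + norm y + 1 + d) *\<^sub>R w" y] w by (simp add: add.commute)
    ultimately show False using d by linarith
  qed
  moreover have "0 \<le> m"
  proof -
    obtain z where "z \<in> \<Omega>" using domain by (auto simp: bounded_C2_domain_def)
    then show ?thesis using m norm_ge_zero order_trans by blast
  qed
  ultimately have "m + norm y + 1 + d \<in> X" using d(1) by (simp add: X_def add_nonneg_pos add_pos_nonneg)
  then have Xne: "X \<noteq> {}" by auto
  have Xd: "d \<le> t" if "t \<in> X" for t using d(2)[of t] that by (force simp: X_def)
  define s where "s = Inf X"
  have bb: "bdd_below X" using Xd by (intro bdd_belowI)
  have sd: "d \<le> s" unfolding s_def using Xne Xd by (intro cInf_greatest)
  have below: "y + t *\<^sub>R w \<in> \<Omega>" if "0 < t" "t < s" for t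
    using cInf_lower[OF _ bb, of t] that by (force simp: X_def s_def)
  have cont: "continuous_on UNIV (\<lambda>t. y + t *\<^sub>R w)" by (intro continuous_intros)
  have "s \<in> closure X" unfolding s_def using Xne bb by (rule closure_contains_Inf)
  then have s\<Omega>: "y + s *\<^sub>R w \<notin> \<Omega>"
  proof -
    have "closed {t. y + t *\<^sub>R w \<in> - \<Omega>}"
      using continuous_closed_vimage[of "- \<Omega>" "\<lambda>t. y + t *\<^sub>R w"] op
      by (auto simp: vimage_def closed_Compl intro: continuous_intros)
    moreover have "X \<subseteq> {t. y + t *\<^sub>R w \<in> - \<Omega>}" by (auto simp: X_def)
    ultimately have "closure X \<subseteq> {t. y + t *\<^sub>R w \<in> - \<Omega>}" by (rule closure_minimal[rotated])
    then show ?thesis using \<open>s \<in> closure X\<close> by auto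
  qed
  have s0: "0 < s" using sd d by simp
  have "y + s *\<^sub>R w \<in> closure \<Omega>"
    unfolding closure_approachable
  proof (intro allI impI)
    fix e :: real assume e: "0 < e"
    define t where "t = s - min e s / 2"
    have t: "0 < t" "t < s" "s - t < e" using e s0 by (auto simp: t_def min_def)
    have "dist (y + t *\<^sub>R w) (y + s *\<^sub>R w) = norm ((t - s) *\<^sub>R w)"
      by (simp add: dist_norm algebra_simps)
    also have "\<dots> = s - t" using t w by simp
    finally show "\<exists>z\<in>\<Omega>. dist z (y + s *\<^sub>R w) < e"
      using below[of t] t by (intro bexI[of _ "y + t *\<^sub>R w"]) simp_all
  qed
  then have fr: "y + s *\<^sub>R w \<in> frontier \<Omega>" using s\<Omega> op by (simp add: frontier_def interior_open)
  \<comment> \<open>If the ray crossed inwards at its exit point, \<open>F\<close> would be positive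
    just before \<open>s\<close>, where the ray is still in \<Omega>.\<close>
  have "\<not> \<nu> (y + s *\<^sub>R w) \<bullet> w < 0"
  proof
    assume neg: "\<nu> (y + s *\<^sub>R w) \<bullet> w < 0"
    let ?x = "y + s *\<^sub>R w"
    obtain r u F G where F: "defining_function \<Omega> ?x r u F G"
      and \<nu>: "\<forall>x\<in>frontier \<Omega> \<inter> ball ?x r. \<nu> x = sgn (G x)"
      using boundary_defining_function[OF fr] by blast
    have r: "r > 0" using F by (simp add: defining_function_def)
    have "G ?x \<bullet> w < 0" using boundary_normal_inner_sign(1)[OF F] \<nu> fr r neg by simp
    then have "0 < G ?x \<bullet> (- w)" by simp
    then obtain d' where d': "d' > 0" "\<And>t. 0 < t \<Longrightarrow> t < d' \<Longrightarrow> F ?x < F (?x + t *\<^sub>R (- w))"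
      using DERIV_pos_inc_right[OF defining_function_line_derivative[OF F, of ?x "- w"]] by auto
    define t where "t = min (min d' r) s / 2"
    have t: "0 < t" "t < d'" "t < r" "t < s" using d' r s0 by (auto simp: t_def min_def)
    have eq: "?x + t *\<^sub>R (- w) = y + (s - t) *\<^sub>R w" by (simp add: algebra_simps)
    have "?x + t *\<^sub>R (- w) \<in> ball ?x r" using t w by (simp add: dist_norm)
    moreover have "?x + t *\<^sub>R (- w) \<in> \<Omega>" unfolding eq using t by (intro below) auto
    ultimately have "F (?x + t *\<^sub>R (- w)) < 0" using F unfolding defining_function_def by blast
    moreover have "F ?x = 0" using F fr r unfolding defining_function_def by simp
    ultimately show False using d'(2)[of t] t by simp
  qed
  then show ?thesis using s0 fr by (intro exI[of _ s]) auto
qed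

text \<open>Projection along \<open>u\<close> does not increase distances, and the projection of the
  boundary piece contains a disc because the boundary is a graph over it.\<close>

lemma boundary_ball_positive:
  assumes p: "p \<in> frontier \<Omega>" and \<delta>: "0 < \<delta>"
  shows "0 < \<H> (frontier \<Omega> \<inter> ball p \<delta>)"
proof -
  obtain r u F G where F: "defining_function \<Omega> p r u F G"
    using boundary_defining_function[OF p] by blast
  have r: "r > 0" and u: "norm u = 1" and Fu: "\<And>x t. F (x + t *\<^sub>R u) = F x - t"
    using F by (auto simp: defining_function_def)
  have Fp: "F p = 0" using F p r by (simp add: defining_function_def)
  have "isCont F p" using F by (auto simp: defining_function_def intro: has_derivative_continuous)
  \<comment> \<open>\<open>q\<close> raises a point of the hyperplane to the height of
    \<open>p\<close>, and \<open>c\<close> corrects it along \<open>u\<close> onto the boundary. By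
    continuity the points over a small disc stay near \<open>p\<close>.\<close>
  define q where "q z = z + (p \<bullet> u) *\<^sub>R u" for z
  define c where "c z = q z + F (q z) *\<^sub>R u" for z
  define a where "a = perp u p"
  have qa: "q a = p" by (simp add: q_def a_def perp_def)
  have "isCont q a" unfolding q_def by (intro continuous_intros)
  moreover have "isCont F (q a)" using \<open>isCont F p\<close> by (simp add: qa)
  ultimately have "isCont c a" unfolding c_def by (intro continuous_intros isCont_o2[of a q F])
  moreover have "c a = p" by (simp add: c_def qa Fp)
  moreover have "0 < min r \<delta>" using r \<delta> by simp
  ultimately obtain \<eta> where \<eta>: "\<eta> > 0" "\<And>z. dist z a < \<eta> \<Longrightarrow> dist (c z) p < min r \<delta>"
    unfolding continuous_at_eps_delta by metis
  have au: "a \<bullet> u = 0" unfolding a_def by (rule perp_orthogonal[OF u])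
  have sub: "{z. z \<bullet> u = 0 \<and> dist a z < \<eta>} \<subseteq> perp u ` (frontier \<Omega> \<inter> ball p \<delta>)"
  proof
    fix z assume z: "z \<in> {z. z \<bullet> u = 0 \<and> dist a z < \<eta>}"
    then have "dist (c z) p < min r \<delta>" by (intro \<eta>) (simp add: dist_commute)
    then have cz: "c z \<in> ball p r" "c z \<in> ball p \<delta>" by (auto simp: dist_commute)
    have "F (c z) = 0" by (simp add: c_def Fu)
    then have "c z \<in> frontier \<Omega>" using F cz by (simp add: defining_function_def)
    moreover have "perp u (c z) = z"
      using z u by (simp add: c_def q_def perp_def inner_add_left norm_eq_1 algebra_simps)
    ultimately show "z \<in> perp u ` (frontier \<Omega> \<inter> ball p \<delta>)" using cz by (metis IntI imageI)
  qed
  have "0 < \<H> {z. z \<bullet> u = 0 \<and> dist a z < \<eta>}"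
    by (rule hausdorff_outer_hyperplane_positive[OF u au \<eta>(1)])
  also have "\<dots> \<le> \<H> (perp u ` (frontier \<Omega> \<inter> ball p \<delta>))"
    by (rule hausdorff_outer_mono[OF sub])
  also have "\<dots> \<le> ennreal (1 ^ (DIM('a) - 1)) * \<H> ((\<lambda>x. x) ` (frontier \<Omega> \<inter> ball p \<delta>))"
    by (rule hausdorff_outer_dominated) (auto simp: dist_norm perp_diff[symmetric] norm_perp_le u)
  finally show ?thesis by simp
qed


text \<open>Contains the first exit point of every ray entering \<open>\<Omega>\<close> at \<open>y\<close>. The exit may be
  tangential, hence the weak inequality.\<close>

definition facing :: "'a \<Rightarrow> 'a set" where
  "facing y = {x \<in> frontier \<Omega>. sgn (x - y) \<bullet> \<nu> y < 0 \<and> 0 \<le> \<nu> x \<bullet> sgn (x - y)}"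

lemma norm_normal: "x \<in> frontier \<Omega> \<Longrightarrow> norm (\<nu> x) = 1"
  using normal by (simp add: outward_unit_normal_def)

lemma facing_borel: "facing y \<in> sets borel"
proof -
  let ?M = "surface_measure (frontier \<Omega>)"
  have [measurable]: "\<nu> \<in> borel_measurable ?M"
    by (rule C1_surface_normal_measurable[OF boundary_C1_surface])
  have [measurable]: "radial y \<in> borel_measurable ?M"
    by (rule borel_measurable_surface_measure) measurable
  have "{x \<in> space ?M. sgn (x - y) \<bullet> \<nu> y < 0 \<and> 0 \<le> \<nu> x \<bullet> sgn (x - y)} \<in> sets ?M" by measurable
  then show ?thesis
    using C1_surface_borel[OF boundary_C1_surface]
    by (simp add: facing_def sets_surface_measure sets_restrict_space_iff)
qed

lemma facing_subset: "facing y \<subseteq> frontier \<Omega> - {y}"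
  by (auto simp: facing_def)

lemma half_sphere_subset_facing_directions:
  assumes y: "y \<in> frontier \<Omega>"
  shows "half_sphere (\<nu> y) \<subseteq> radial y ` facing y"
proof
  fix w assume "w \<in> half_sphere (\<nu> y)"
  then have w: "norm w = 1" "\<nu> y \<bullet> w < 0" by (auto simp: half_sphere_def inner_commute)
  obtain t where t: "t > 0" "y + t *\<^sub>R w \<in> frontier \<Omega>" "0 \<le> \<nu> (y + t *\<^sub>R w) \<bullet> w"
    using boundary_ray_exits[OF y w] by blast
  have "sgn (y + t *\<^sub>R w - y) = w" using t w by (simp add: sgn_scaleR) (simp add: sgn_div_norm)
  then show "w \<in> radial y ` facing y"
    using t w by (intro image_eqI[of _ _ "y + t *\<^sub>R w"]) (auto simp: facing_def inner_commute)
qed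

text \<open>The form required by \<open>nn_integral_radial_le\<close>. It lies pointwise below the
  integrand of the theorem while its integral is still at least the constant; this sandwich yields
  the inequality as well as the equality case.\<close>

definition facing_density :: "'a \<Rightarrow> 'a \<Rightarrow> ennreal" where
  "facing_density y x =
     ennreal (- 4 * (sgn (x - y) \<bullet> \<nu> y)) * ennreal (jacobian \<nu> y x) * indicator (facing y) x"

lemma half_sphere_integral_le_facing:
  assumes d: "2 \<le> DIM('a)" and y: "y \<in> frontier \<Omega>"
  shows "half_sphere_integral (\<nu> y) \<le> (\<integral>\<^sup>+ x. facing_density y x \<partial>surface_measure (frontier \<Omega>))"
  unfolding half_sphere_integral_def facing_density_def
  by (rule nn_integral_radial_le[OF d boundary_C1_surface facing_borel facing_subset half_sphere_borel
        half_sphere_subset_facing_directions[OF y], where g = "\<lambda>w. ennreal (- 4 * (w \<bullet> \<nu> y))"]) measurable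

lemma facing_density_eq:
  assumes x: "x \<in> facing y"
  shows "facing_density y x
    = ennreal (- 4 * (\<nu> x \<bullet> sgn (x - y)) * (\<nu> y \<bullet> sgn (x - y)) / norm (x - y) ^ (DIM('a) - 1))"
proof -
  define w where "w = sgn (x - y)"
  have "0 \<le> - 4 * (w \<bullet> \<nu> y)" and "0 \<le> \<nu> x \<bullet> w" using x by (auto simp: facing_def w_def)
  moreover have "jacobian \<nu> y x = (\<nu> x \<bullet> w) / norm (x - y) ^ (DIM('a) - 1)"
    using \<open>0 \<le> \<nu> x \<bullet> w\<close> by (simp add: jacobian_def w_def)
  ultimately have "facing_density y x = ennreal (- 4 * (w \<bullet> \<nu> y) * ((\<nu> x \<bullet> w) / norm (x - y) ^ (DIM('a) - 1)))"
    unfolding facing_density_def w_def[symmetric] using x by (subst ennreal_mult) auto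
  also have "- 4 * (w \<bullet> \<nu> y) * ((\<nu> x \<bullet> w) / norm (x - y) ^ (DIM('a) - 1))
      = - 4 * (\<nu> x \<bullet> w) * (\<nu> y \<bullet> w) / norm (x - y) ^ (DIM('a) - 1)"
    by (simp add: inner_commute[of w])
  finally show ?thesis by (simp only: w_def)
qed

lemma normal_difference_bound:
  fixes a b w :: 'a
  assumes "norm w = 1"
  shows "- 4 * (a \<bullet> w) * (b \<bullet> w) \<le> ((a - b) \<bullet> w)\<^sup>2" "((a - b) \<bullet> w)\<^sup>2 \<le> (norm (a - b))\<^sup>2"
proof -
  have "((a - b) \<bullet> w)\<^sup>2 + 4 * (a \<bullet> w) * (b \<bullet> w) = ((a + b) \<bullet> w)\<^sup>2"
    by (simp add: inner_diff_left inner_add_left power2_eq_square algebra_simps)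
  then show "- 4 * (a \<bullet> w) * (b \<bullet> w) \<le> ((a - b) \<bullet> w)\<^sup>2"
    using zero_le_power2[of "(a + b) \<bullet> w"] by linarith
  have "\<bar>(a - b) \<bullet> w\<bar> \<le> \<bar>norm (a - b)\<bar>" using Cauchy_Schwarz_ineq2[of "a - b" w] assms by simp
  then show "((a - b) \<bullet> w)\<^sup>2 \<le> (norm (a - b))\<^sup>2" by (simp only: abs_le_square_iff)
qed

lemma facing_density_le:
  "facing_density y x \<le> ennreal ((norm (\<nu> x - \<nu> y))\<^sup>2 / norm (x - y) ^ (DIM('a) - 1))"
proof (cases "x \<in> facing y")
  case True
  then have "norm (sgn (x - y)) = 1" using facing_subset[of y] by (auto simp: norm_sgn)
  from normal_difference_bound[OF this, of "\<nu> x" "\<nu> y"] show ?thesis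
    unfolding facing_density_eq[OF True] by (intro ennreal_leI divide_right_mono) auto
qed (simp add: facing_density_def)

text \<open>With \<open>w = sgn (x - y)\<close> the conclusion is
  \<open>perp w (\<nu> x - \<nu> y) = 0\<close> multiplied by the squared distance. Cleared of
  denominators it is continuous even at \<open>x = y\<close>, as needed to remove exceptional null
  sets. Outside \<open>facing y\<close> the density is 0, which already forces equal
  normals.\<close>

lemma facing_density_eq_parallel:
  assumes eq: "ennreal ((norm (\<nu> x - \<nu> y))\<^sup>2 / norm (x - y) ^ (DIM('a) - 1)) \<le> facing_density y x"
  shows "(norm (x - y))\<^sup>2 *\<^sub>R (\<nu> x - \<nu> y) - ((\<nu> x - \<nu> y) \<bullet> (x - y)) *\<^sub>R (x - y) = 0"
proof (cases "x = y")
  case False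
  define D where "D = \<nu> x - \<nu> y"
  define w where "w = sgn (x - y)"
  have w: "norm w = 1" using False by (simp add: w_def norm_sgn)
  have xw: "x - y = norm (x - y) *\<^sub>R w" using False by (simp add: w_def sgn_div_norm)
  have pos: "0 < norm (x - y) ^ (DIM('a) - 1)" using False by simp
  have "perp w D = 0"
  proof (cases "x \<in> facing y")
    case True
    have "0 \<le> - 4 * (\<nu> x \<bullet> w) * (\<nu> y \<bullet> w)"
      using True by (simp add: facing_def w_def inner_commute mult_nonneg_nonpos)
    then have nn: "0 \<le> - 4 * (\<nu> x \<bullet> w) * (\<nu> y \<bullet> w) / norm (x - y) ^ (DIM('a) - 1)"
      using pos by (rule divide_nonneg_pos)
    have "(norm D)\<^sup>2 / norm (x - y) ^ (DIM('a) - 1)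
        \<le> - 4 * (\<nu> x \<bullet> w) * (\<nu> y \<bullet> w) / norm (x - y) ^ (DIM('a) - 1)"
      using eq unfolding facing_density_eq[OF True] D_def w_def[symmetric] ennreal_le_iff[OF nn] .
    then have "(norm D)\<^sup>2 \<le> - 4 * (\<nu> x \<bullet> w) * (\<nu> y \<bullet> w)"
      using pos by (simp only: divide_le_cancel)
    also have "\<dots> \<le> (D \<bullet> w)\<^sup>2" unfolding D_def by (rule normal_difference_bound(1)[OF w])
    finally have "(norm (perp w D))\<^sup>2 \<le> 0" by (simp add: norm_perp_sq[OF w])
    then show ?thesis by simp
  next
    case not_facing: False
    then have "ennreal ((norm D)\<^sup>2 / norm (x - y) ^ (DIM('a) - 1)) = 0"
      using eq by (simp add: facing_density_def D_def)
    then have "(norm D)\<^sup>2 / norm (x - y) ^ (DIM('a) - 1) \<le> 0" by (simp add: ennreal_eq_0_iff)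
    then have "(norm D)\<^sup>2 \<le> 0" using pos by (simp add: divide_le_0_iff del: One_nat_def)
    then show ?thesis by (simp add: perp_def)
  qed
  moreover have "(norm (x - y))\<^sup>2 *\<^sub>R D - (D \<bullet> (norm (x - y) *\<^sub>R w)) *\<^sub>R (norm (x - y) *\<^sub>R w)
      = (norm (x - y))\<^sup>2 *\<^sub>R perp w D"
    by (simp add: perp_def power2_eq_square scaleR_diff_right)
  ultimately show ?thesis unfolding xw[symmetric] D_def by simp
qed simp

text \<open>A continuous function that is nonzero at \<open>p\<close> is nonzero on a whole boundary
  ball around \<open>p\<close>, and such balls are not null sets.\<close>

lemma all_boundary_if_AE:
  fixes k :: "'a \<Rightarrow> 'b::real_normed_vector"
  assumes k: "continuous_on (frontier \<Omega>) k" and AE: "AE x in surface_measure (frontier \<Omega>). k x = 0"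
    and p: "p \<in> frontier \<Omega>"
  shows "k p = 0"
proof (rule ccontr)
  assume kp: "k p \<noteq> 0"
  then obtain \<delta> where \<delta>: "\<delta> > 0" "\<And>x. x \<in> frontier \<Omega> \<Longrightarrow> dist x p < \<delta> \<Longrightarrow> dist (k x) (k p) < norm (k p)"
    using k p unfolding continuous_on_iff by (metis zero_less_norm_iff)
  let ?M = "surface_measure (frontier \<Omega>)" and ?B = "frontier \<Omega> \<inter> ball p \<delta>"
  have SB: "frontier \<Omega> \<in> sets borel" by (rule C1_surface_borel[OF boundary_C1_surface])
  have B: "?B \<in> sets ?M" using SB by (auto simp: sets_surface_measure sets_restrict_space_iff)
  have "AE x in ?M. x \<notin> ?B"
    using AE
  proof eventually_elim
    case (elim x)
    then show ?case using \<delta>(2)[of x] by (auto simp: dist_commute)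
  qed
  then have "emeasure ?M ?B = 0" using AE_iff_null_sets[OF B] by (auto simp: null_sets_def)
  then show False
    using boundary_ball_positive[OF p \<delta>(1)] SB by (simp add: emeasure_surface_measure)
qed

section \<open>Rigidity: parallel differences of normals force a ball\<close>

lemma boundary_hit:
  assumes y: "y \<in> frontier \<Omega>" and h: "h \<bullet> \<nu> y < 0"
  shows "\<exists>t>0. y + t *\<^sub>R h \<in> frontier \<Omega> \<and> 0 \<le> \<nu> (y + t *\<^sub>R h) \<bullet> h"
proof -
  have h0: "0 < norm h" using h by auto
  have "norm (sgn h) = 1" "\<nu> y \<bullet> sgn h < 0"
    using h h0 by (auto simp: norm_sgn sgn_div_norm inner_commute mult_less_0_iff)
  then obtain t where t: "t > 0" "y + t *\<^sub>R sgn h \<in> frontier \<Omega>" "0 \<le> \<nu> (y + t *\<^sub>R sgn h) \<bullet> sgn h"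
    using boundary_ray_exits[OF y] by blast
  have "t *\<^sub>R sgn h = (t / norm h) *\<^sub>R h" by (simp add: sgn_div_norm divide_inverse)
  with t h0 show ?thesis
    by (intro exI[of _ "t / norm h"]) (auto simp: sgn_div_norm zero_le_mult_iff)
qed

text \<open>The factor \<open>l\<close> might vary with the pair of points. Comparing three
  non-collinear boundary points shows that it does not; then
  \<open>\<nu> x = L *\<^sub>R (x - c)\<close> with a fixed \<open>c\<close>, and unit length of
  \<nu> puts the boundary on a sphere.\<close>

lemma ball_if_normals_parallel:
  assumes d: "2 \<le> DIM('a)"
    and par: "\<And>x y. x \<in> frontier \<Omega> \<Longrightarrow> y \<in> frontier \<Omega> \<Longrightarrow> \<exists>l. \<nu> x - \<nu> y = l *\<^sub>R (x - y)"
  shows "\<exists>c r. 0 < r \<and> \<Omega> = ball c r"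
proof -
  let ?S = "frontier \<Omega>"
  have \<Omega>: "\<Omega> \<noteq> {}" "open \<Omega>" "bounded \<Omega>" using domain by (auto simp: bounded_C2_domain_def)
  have "\<Omega> \<noteq> UNIV" using \<Omega>(3) not_bounded_UNIV by blast
  then obtain y where y: "y \<in> ?S" using \<Omega>(1) frontier_eq_empty[of \<Omega>] by blast
  define v where "v = \<nu> y"
  have v1: "v \<bullet> v = 1" using norm_normal[OF y] by (simp add: v_def norm_eq_1)
  obtain l where l: "\<And>x. x \<in> ?S \<Longrightarrow> \<nu> x - \<nu> y = l x *\<^sub>R (x - y)"
    using par[OF _ y] by metis
  \<comment> \<open>\<open>x - y\<close> and \<open>x' - y\<close> are linearly independent, so the
    coefficients in the relation for the pair \<open>x\<close>, \<open>x'\<close> can be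
    compared.\<close>
  have transversal: "l x = l x'"
    if x: "x \<in> ?S" "x \<noteq> y" "x' \<in> ?S" and np: "\<And>t. x' - y \<noteq> t *\<^sub>R (x - y)" for x x'
  proof -
    obtain m where m: "\<nu> x - \<nu> x' = m *\<^sub>R (x - x')" using par x by blast
    have "\<nu> x - \<nu> x' = l x *\<^sub>R (x - y) - l x' *\<^sub>R (x' - y)"
      unfolding l[OF x(1), symmetric] l[OF x(3), symmetric] by simp
    moreover have "x - x' = (x - y) - (x' - y)" by simp
    ultimately have "l x *\<^sub>R (x - y) - l x' *\<^sub>R (x' - y) = m *\<^sub>R ((x - y) - (x' - y))" using m by metis
    then have 1: "(l x' - m) *\<^sub>R (x' - y) = (l x - m) *\<^sub>R (x - y)" by (simp add: algebra_simps)
    have "l x' = m"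
    proof (rule ccontr)
      assume "l x' \<noteq> m"
      then have "x' - y = ((l x - m) / (l x' - m)) *\<^sub>R (x - y)"
        using arg_cong[OF 1, of "\<lambda>z. (1 / (l x' - m)) *\<^sub>R z"] by simp
      then show False using np by blast
    qed
    with 1 x show ?thesis by simp
  qed
  obtain q :: 'a where q: "q \<noteq> 0" "v \<bullet> q = 0"
    using orthogonal_to_vector_exists[OF d, of v] by (auto simp: orthogonal_def)
  \<comment> \<open>If the boundary lay on one line through \<open>y\<close>, all directions
    entering \<Omega> at \<open>y\<close> would be multiples of one vector. But both
    -\<open>v\<close> and \<open>q - v\<close> enter, and they are independent.\<close>
  have other: "\<exists>x'\<in>?S. \<forall>t. x' - y \<noteq> t *\<^sub>R (x - y)" if x: "x \<in> ?S" for x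
  proof (rule ccontr)
    assume "\<not> ?thesis"
    then have all: "\<And>x'. x' \<in> ?S \<Longrightarrow> \<exists>t. x' - y = t *\<^sub>R (x - y)" by blast
    have dir: "\<exists>t. h = t *\<^sub>R (x - y)" if hv: "h \<bullet> v < 0" for h
    proof -
      have "h \<bullet> \<nu> y < 0" using hv by (simp add: v_def)
      from boundary_hit[OF y this] obtain s where s: "s > 0" "y + s *\<^sub>R h \<in> ?S" by blast
      obtain t where "s *\<^sub>R h = t *\<^sub>R (x - y)" using all[OF s(2)] by auto
      then have "(1 / s) *\<^sub>R (s *\<^sub>R h) = (1 / s) *\<^sub>R (t *\<^sub>R (x - y))" by (simp only:)
      then have "h = (t / s) *\<^sub>R (x - y)" using s(1) by simp
      then show ?thesis by blast
    qed
    obtain a where a: "- v = a *\<^sub>R (x - y)" using dir[of "- v"] v1 by auto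
    have "(q - v) \<bullet> v < 0" using v1 q(2) by (simp add: inner_diff_left inner_commute[of q])
    from dir[OF this] obtain b where b: "q - v = b *\<^sub>R (x - y)" by blast
    have a0: "a \<noteq> 0" using a v1 by auto
    have "q = (b - a) *\<^sub>R (x - y)" using a b by (simp add: algebra_simps)
    also have "x - y = (1 / a) *\<^sub>R (a *\<^sub>R (x - y))" using a0 by simp
    also have "\<dots> = (- 1 / a) *\<^sub>R v" unfolding a[symmetric] by simp
    finally have qv: "q = ((b - a) * (- 1 / a)) *\<^sub>R v" by (simp only: scaleR_scaleR)
    have "v \<bullet> q = (b - a) * (- 1 / a)" by (subst qv) (simp only: inner_scaleR_right v1 mult_1_right)
    then have "(b - a) * (- 1 / a) = 0" using q(2) by simp
    with qv have "q = 0 *\<^sub>R v" by (simp only:)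
    then show False using q(1) by simp
  qed
  \<comment> \<open>When \<open>x\<close> and \<open>x'\<close> are collinear with \<open>y\<close>,
    both are compared with a third boundary point off that line.\<close>
  have const: "l x = l x'" if x: "x \<in> ?S" "x \<noteq> y" "x' \<in> ?S" "x' \<noteq> y" for x x'
  proof (cases "\<exists>t. x' - y = t *\<^sub>R (x - y)")
    case True
    then obtain t where t: "x' - y = t *\<^sub>R (x - y)" by blast
    then have t0: "t \<noteq> 0" using x by auto
    obtain z where z: "z \<in> ?S" "\<And>t. z - y \<noteq> t *\<^sub>R (x - y)" using other[OF x(1)] by blast
    have "l x = l z" using transversal[OF x(1,2) z(1)] z(2) by blast
    moreover have "l x' = l z" using transversal[OF x(3,4) z(1)] z(2) unfolding t by auto
    ultimately show ?thesis by simp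
  qed (use transversal[OF x(1-3)] in blast)
  \<comment> \<open>The exit point of the ray along the inner normal at \<open>y\<close>. Its normal
    cannot be \<open>v\<close>, so the common factor is nonzero.\<close>
  obtain x0 where x0: "x0 \<in> ?S" "x0 \<noteq> y" "0 \<le> \<nu> x0 \<bullet> (- v)"
  proof -
    have "(- v) \<bullet> \<nu> y < 0" using v1 by (simp add: v_def)
    from boundary_hit[OF y this] obtain t where "t > 0" "y + t *\<^sub>R (- v) \<in> ?S" "0 \<le> \<nu> (y + t *\<^sub>R (- v)) \<bullet> (- v)"
      by blast
    moreover have "v \<noteq> 0" using v1 by auto
    ultimately show thesis by (intro that[of "y + t *\<^sub>R (- v)"]) auto
  qed
  define L where "L = l x0"
  have \<nu>L: "\<nu> x = v + L *\<^sub>R (x - y)" if "x \<in> ?S" for x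
  proof (cases "x = y")
    case False
    then show ?thesis using l[OF that] const[OF that False x0(1,2)] by (simp add: L_def v_def algebra_simps)
  qed (simp add: v_def)
  have L0: "L \<noteq> 0"
  proof
    assume "L = 0"
    then have "\<nu> x0 = v" using \<nu>L[OF x0(1)] by simp
    then show False using x0(3) v1 by simp
  qed
  define c where "c = y - (1 / L) *\<^sub>R v"
  define r where "r = 1 / \<bar>L\<bar>"
  have r: "0 < r" using L0 by (simp add: r_def)
  have Sc: "dist c x = r" if x: "x \<in> ?S" for x
  proof -
    have "x - c = (1 / L) *\<^sub>R \<nu> x" using L0 by (simp add: \<nu>L[OF x] c_def algebra_simps)
    then have "norm (x - c) = r" using norm_normal[OF x] by (simp add: r_def)
    then show ?thesis by (simp add: dist_norm norm_minus_commute)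
  qed
  \<comment> \<open>The exterior of the ball, connected in dimension at least 2, contains no
    boundary point and is not inside the bounded \<Omega>, so it misses \<Omega>. The same argument
    for the open ball shows that it is filled by \<Omega>.\<close>
  have "(- cball c r) \<inter> \<Omega> = {}"
  proof (rule ccontr)
    assume ne: "(- cball c r) \<inter> \<Omega> \<noteq> {}"
    have "connected (- cball c r)"
      using d by (intro connected_complement_bounded_convex) auto
    moreover have "\<not> - cball c r \<subseteq> \<Omega>"
    proof
      assume "- cball c r \<subseteq> \<Omega>"
      then have "UNIV = cball c r \<union> \<Omega>" by auto
      then have "bounded (UNIV :: 'a set)" using \<Omega>(3) by (metis bounded_Un bounded_cball)
      then show False using not_bounded_UNIV by blast
    qed
    ultimately have "(- cball c r) \<inter> ?S \<noteq> {}"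
      using ne by (intro connected_Int_frontier) auto
    then show False using Sc by force
  qed
  then have "\<Omega> \<subseteq> interior (cball c r)" using \<Omega>(2) by (intro interior_maximal) auto
  then have sub: "\<Omega> \<subseteq> ball c r" by simp
  have "ball c r \<subseteq> \<Omega>"
  proof (rule ccontr)
    assume "\<not> ball c r \<subseteq> \<Omega>"
    then have "ball c r \<inter> ?S \<noteq> {}"
      using sub \<Omega>(1) by (intro connected_Int_frontier) (auto simp: connected_ball)
    then show False using Sc by force
  qed
  with sub r show ?thesis by blast
qed

end

text \<open>In the theorem \<nu> is any field satisfying \<open>outward_unit_normal\<close>; on a
  ball it is identified by this existence statement together with uniqueness. Tangency follows by
  differentiating the constant squared distance to \<open>c\<close> along a curve.\<close>

lemma outward_unit_normal_ball:
  fixes c x :: "'a::euclidean_space"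
  assumes r: "0 < r" and x: "x \<in> sphere c r"
  shows "outward_unit_normal (ball c r) x ((1 / r) *\<^sub>R (x - c))"
  unfolding outward_unit_normal_def
proof (intro conjI ballI)
  show "norm ((1 / r) *\<^sub>R (x - c)) = 1" using r x by (simp add: dist_norm norm_minus_commute)
  fix h assume "h \<in> tangent_vectors (frontier (ball c r)) x"
  then obtain k where k: "k 0 = x" "\<forall>\<^sub>F t in at 0. k t \<in> frontier (ball c r)" "(k has_vector_derivative h) (at 0)"
    unfolding tangent_vectors_def by blast
  have "((\<lambda>t. (k t - c) \<bullet> (k t - c)) has_derivative (\<lambda>t. (k 0 - c) \<bullet> (t *\<^sub>R h) + (t *\<^sub>R h) \<bullet> (k 0 - c))) (at 0)"
    using k(3) unfolding has_vector_derivative_def by (auto intro!: derivative_eq_intros)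
  then have 1: "((\<lambda>t. (k t - c) \<bullet> (k t - c)) has_real_derivative (2 * ((x - c) \<bullet> h))) (at 0)"
    unfolding has_field_derivative_def by (rule has_derivative_eq_rhs) (auto simp: k(1) inner_commute)
  have "\<forall>\<^sub>F t in at 0. (k t - c) \<bullet> (k t - c) = r\<^sup>2"
    using k(2)
  proof eventually_elim
    case (elim t)
    then have "norm (k t - c) = r" using r by (simp add: dist_norm norm_minus_commute)
    then show ?case by (simp add: power2_norm_eq_inner[symmetric])
  qed
  moreover have "(k 0 - c) \<bullet> (k 0 - c) = r\<^sup>2"
    using x by (simp add: k(1) dist_norm norm_minus_commute flip: power2_norm_eq_inner)
  ultimately have "((\<lambda>t. r\<^sup>2) has_real_derivative (2 * ((x - c) \<bullet> h))) (at 0)"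
    unfolding has_field_derivative_def
    by (intro has_derivative_transform_eventually[OF 1[unfolded has_field_derivative_def]]) auto
  then have "2 * ((x - c) \<bullet> h) = 0" by (rule DERIV_unique) (rule DERIV_const)
  then show "(1 / r) *\<^sub>R (x - c) \<bullet> h = 0" by simp
next
  show "\<forall>\<^sub>F t in at_right 0. x + t *\<^sub>R ((1 / r) *\<^sub>R (x - c)) \<notin> ball c r \<and> x - t *\<^sub>R ((1 / r) *\<^sub>R (x - c)) \<in> ball c r"
    (is "eventually ?P _")
  proof -
    define n where "n = (1 / r) *\<^sub>R (x - c)"
    have "r *\<^sub>R n = x - c" using r by (simp add: n_def)
    then have xc: "x = c + r *\<^sub>R n" by simp
    have n1: "norm n = 1" using r x by (simp add: n_def dist_norm norm_minus_commute)
    have "?P t" if t: "0 < t" "t < r" for t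
    proof -
      have 1: "x + t *\<^sub>R n - c = (r + t) *\<^sub>R n" "x - t *\<^sub>R n - c = (r - t) *\<^sub>R n"
        by (simp_all add: xc algebra_simps)
      have "norm (x + t *\<^sub>R n - c) = r + t" "norm (x - t *\<^sub>R n - c) = r - t"
        unfolding 1 using n1 t r by simp_all
      then have "dist c (x + t *\<^sub>R n) = r + t" "dist c (x - t *\<^sub>R n) = r - t"
        by (simp_all add: dist_norm norm_minus_commute)
      then show ?thesis using t unfolding n_def by simp
    qed
    moreover have "\<forall>\<^sub>F t in at_right (0::real). 0 < t \<and> t < r"
      using r by (intro eventually_conj eventually_at_right_less order_tendstoD(2)[OF tendsto_ident_at])
    ultimately show ?thesis by (auto elim: eventually_mono)
  qed
qed

section \<open>The inequality and its equality case\<close>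

text \<open>Used twice in the equality case, for the outer and for the inner integral. Finiteness is
  what permits subtracting the integrals.\<close>

lemma AE_le_if_nn_integral_le:
  assumes [measurable]: "f \<in> borel_measurable M" "g \<in> borel_measurable M"
    and le: "AE x in M. g x \<le> f x" and int: "(\<integral>\<^sup>+ x. f x \<partial>M) \<le> (\<integral>\<^sup>+ x. g x \<partial>M)"
    and fin: "(\<integral>\<^sup>+ x. g x \<partial>M) < top"
  shows "AE x in M. f x \<le> g x"
proof -
  have "(\<integral>\<^sup>+ x. (f x - g x) \<partial>M) = (\<integral>\<^sup>+ x. f x \<partial>M) - (\<integral>\<^sup>+ x. g x \<partial>M)"
    using fin le by (intro nn_integral_diff) auto
  also have "\<dots> = 0" using int le_less_trans[OF int fin] by (simp add: diff_eq_0_iff_ennreal)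
  finally have "AE x in M. f x - g x = 0" by (subst (asm) nn_integral_0_iff_AE) auto
  then show ?thesis by eventually_elim (auto simp: ennreal_minus_eq_0)
qed

lemma half_sphere_integral_finite:
  fixes v :: "'a::euclidean_space"
  assumes v: "norm v = 1"
  shows "half_sphere_integral v < top"
proof -
  let ?H = "hausdorff_measure (DIM('a) - 1) :: 'a measure"
  have "half_sphere_integral v \<le> (\<integral>\<^sup>+ w. 4 * indicator (sphere 0 1) w \<partial>?H)"
    unfolding half_sphere_integral_def
  proof (intro nn_integral_mono)
    fix w
    show "ennreal (- 4 * (w \<bullet> v)) * indicator (half_sphere v) w \<le> 4 * indicator (sphere 0 1) w"
    proof (cases "w \<in> half_sphere v")
      case True
      then have w: "norm w = 1" by (simp add: half_sphere_def)
      then have "- 4 * (w \<bullet> v) \<le> 4" using Cauchy_Schwarz_ineq2[of w v] v by auto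
      then have "ennreal (- 4 * (w \<bullet> v)) \<le> ennreal 4" by (rule ennreal_leI)
      then show ?thesis using True w by simp
    qed simp
  qed
  also have "\<dots> = 4 * \<H> (sphere (0::'a) 1)"
    by (subst nn_integral_cmult_indicator) (auto simp: emeasure_hausdorff_measure borel_closed)
  also have "\<dots> < top"
    using C1_surface_finite[OF C1_surface_sphere[of 1 "0::'a"]] by (simp add: ennreal_mult_less_top)
  finally show ?thesis .
qed

theorem theorem1p1:
  fixes \<Omega> :: "'a::euclidean_space set" and \<nu> :: "'a \<Rightarrow> 'a" and e :: 'a
  assumes dim: "DIM('a) \<ge> 3"
    and domain: "bounded_C2_domain \<Omega>"
    and normal: "\<forall>x\<in>frontier \<Omega>. outward_unit_normal \<Omega> x (\<nu> x)"
    and e: "e \<in> sphere 0 1"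
  shows "((\<integral>\<^sup>+ y. (\<integral>\<^sup>+ x. ennreal ((norm (\<nu> x - \<nu> y))\<^sup>2 / norm (x - y) ^ (DIM('a) - 1))
              \<partial>surface_measure (frontier \<Omega>)) \<partial>surface_measure (frontier \<Omega>))
           \<ge> emeasure (surface_measure (frontier \<Omega>)) (frontier \<Omega>) *
              (\<integral>\<^sup>+ x. ennreal (norm (x - e) powi (3 - int DIM('a))) \<partial>surface_measure (sphere 0 1)))
         \<and> ((\<integral>\<^sup>+ y. (\<integral>\<^sup>+ x. ennreal ((norm (\<nu> x - \<nu> y))\<^sup>2 / norm (x - y) ^ (DIM('a) - 1))
              \<partial>surface_measure (frontier \<Omega>)) \<partial>surface_measure (frontier \<Omega>))
           = emeasure (surface_measure (frontier \<Omega>)) (frontier \<Omega>) *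
              (\<integral>\<^sup>+ x. ennreal (norm (x - e) powi (3 - int DIM('a))) \<partial>surface_measure (sphere 0 1))
           \<longleftrightarrow> (\<exists>c r. r > 0 \<and> \<Omega> = ball c r))"
proof -
  have d: "2 \<le> DIM('a)" using dim by simp
  let ?S = "frontier \<Omega>" and ?M = "surface_measure (frontier \<Omega>)"
  define C where "C = half_sphere_integral e"
  define f where "f y x = ennreal ((norm (\<nu> x - \<nu> y))\<^sup>2 / norm (x - y) ^ (DIM('a) - 1))" for y x
  define I where "I y = (\<integral>\<^sup>+ x. f y x \<partial>?M)" for y
  note S = boundary_C1_surface[OF domain normal]
  have SB: "?S \<in> sets borel" by (rule C1_surface_borel[OF S])
  have e1: "norm e = 1" using e by simp
  have Cfin: "C < top" unfolding C_def by (rule half_sphere_integral_finite[OF e1])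
  have Sfin: "emeasure ?M ?S < top"
    using C1_surface_finite[OF S] SB by (simp add: emeasure_surface_measure)
  \<comment> \<open>Sigma-finiteness of \<open>?M\<close> makes the inner integral \<open>I\<close>
    a measurable function of \<open>y\<close>.\<close>
  interpret finite_measure ?M using Sfin by (intro finite_measureI) simp
  have CI: "C * emeasure ?M ?S = (\<integral>\<^sup>+ y. C \<partial>?M)" by simp
  have [measurable]: "\<nu> \<in> borel_measurable ?M" by (rule C1_surface_normal_measurable[OF S])
  have [measurable]: "(\<lambda>x. x) \<in> borel_measurable ?M" by (rule borel_measurable_surface_measure) simp
  have [measurable]: "case_prod f \<in> borel_measurable (?M \<Otimes>\<^sub>M ?M)"
    unfolding f_def split_beta' by measurable
  have [measurable]: "I \<in> borel_measurable ?M" unfolding I_def by measurable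
  have CC: "half_sphere_integral (\<nu> y) = C" if "y \<in> ?S" for y
    unfolding C_def using norm_normal[OF domain normal that] e1 by (intro half_sphere_integral_cong_norm) simp
  have Cle: "C \<le> (\<integral>\<^sup>+ x. facing_density \<Omega> \<nu> y x \<partial>?M)" if "y \<in> ?S" for y
    using half_sphere_integral_le_facing[OF domain normal d that] CC[OF that] by simp
  have fle: "facing_density \<Omega> \<nu> y x \<le> f y x" for x y
    unfolding f_def by (rule facing_density_le[OF domain normal])
  have ge: "C \<le> I y" if "y \<in> ?S" for y
    unfolding I_def using Cle[OF that] by (rule order_trans) (intro nn_integral_mono fle)
  have inequality: "C * emeasure ?M ?S \<le> (\<integral>\<^sup>+ y. I y \<partial>?M)"
    unfolding CI using ge by (intro nn_integral_mono) simp
  have equality: "(\<integral>\<^sup>+ y. I y \<partial>?M) = C * emeasure ?M ?S \<longleftrightarrow> (\<exists>c r. r > 0 \<and> \<Omega> = ball c r)"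
  proof
    assume "\<exists>c r. r > 0 \<and> \<Omega> = ball c r"
    then obtain c r where r: "r > 0" and \<Omega>: "\<Omega> = ball c r" by blast
    have Sr: "?S = sphere c r" using r by (simp add: \<Omega>)
    have \<nu>: "\<nu> x = (1 / r) *\<^sub>R (x - c)" if x: "x \<in> ?S" for x
    proof -
      obtain s u F G where F: "defining_function \<Omega> x s u F G"
        using boundary_defining_function[OF domain normal x] by blast
      then have "x \<in> ball x s" by (simp add: defining_function_def)
      moreover have "outward_unit_normal \<Omega> x (\<nu> x)" using normal x by blast
      moreover have "outward_unit_normal \<Omega> x ((1 / r) *\<^sub>R (x - c))"
        unfolding \<Omega> using x by (intro outward_unit_normal_ball r) (simp add: Sr)
      ultimately show ?thesis using outward_unit_normal_eq[OF F x] by metis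
    qed
    have "I y = C" if y: "y \<in> ?S" for y
    proof -
      have "I y = (\<integral>\<^sup>+ x. ennreal ((norm ((1 / r) *\<^sub>R (x - c) - (1 / r) *\<^sub>R (y - c)))\<^sup>2 / norm (x - y) ^ (DIM('a) - 1)) \<partial>?M)"
        unfolding I_def f_def using \<nu> y by (intro nn_integral_cong) simp
      also have "\<dots> = half_sphere_integral ((1 / r) *\<^sub>R (y - c))"
        unfolding Sr using y by (intro sphere_integral_eq d r) (simp add: Sr)
      finally show ?thesis using CC[OF y] \<nu>[OF y] by simp
    qed
    then show "(\<integral>\<^sup>+ y. I y \<partial>?M) = C * emeasure ?M ?S"
      unfolding CI by (intro nn_integral_cong) simp
  next
    assume eq: "(\<integral>\<^sup>+ y. I y \<partial>?M) = C * emeasure ?M ?S"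
    define K where "K x y = (norm (x - y))\<^sup>2 *\<^sub>R (\<nu> x - \<nu> y) - ((\<nu> x - \<nu> y) \<bullet> (x - y)) *\<^sub>R (x - y)" for x y
    have \<nu>c: "continuous_on ?S \<nu>" using S by (simp add: C1_surface_def)
    have "AE y in ?M. I y \<le> C"
    proof (rule AE_le_if_nn_integral_le)
      show "AE y in ?M. C \<le> I y" using ge by (intro AE_I2) simp
      show "(\<integral>\<^sup>+ y. I y \<partial>?M) \<le> (\<integral>\<^sup>+ y. C \<partial>?M)" unfolding eq CI[symmetric] ..
      show "(\<integral>\<^sup>+ y. C \<partial>?M) < top" unfolding CI[symmetric] using Cfin Sfin ennreal_mult_less_top by blast
    qed auto
    then have "AE y in ?M. \<forall>x\<in>?S. K x y = 0"
    proof (rule AE_mp, intro AE_I2 impI ballI)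
      fix y x assume "y \<in> space ?M" "I y \<le> C" "x \<in> ?S"
      then have y: "y \<in> ?S" by simp
      have [measurable]: "jacobian \<nu> y \<in> borel_measurable ?M" by (rule jacobian_measurable[OF S])
      have [measurable]: "(\<lambda>x. sgn (x - y)) \<in> borel_measurable ?M"
        by (rule borel_measurable_surface_measure) measurable
      have [measurable]: "facing \<Omega> \<nu> y \<in> sets ?M"
        using facing_borel[OF domain normal] facing_subset[OF domain normal, of y] SB
        by (auto simp: sets_surface_measure sets_restrict_space_iff)
      have [measurable]: "facing_density \<Omega> \<nu> y \<in> borel_measurable ?M"
        unfolding facing_density_def[OF domain normal, abs_def] by measurable
      \<comment> \<open>For such \<open>y\<close> the chain \<open>C\<close> \<le> integral of
        \<open>facing_density\<close> \<le> \<open>I y\<close> \<le> \<open>C\<close> collapses, so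
        the pointwise inequality below it is an equality almost everywhere.\<close>
      have "AE x in ?M. f y x \<le> facing_density \<Omega> \<nu> y x"
      proof (rule AE_le_if_nn_integral_le)
        show "f y \<in> borel_measurable ?M" unfolding f_def[abs_def] by measurable
        show "AE x in ?M. facing_density \<Omega> \<nu> y x \<le> f y x" using fle by simp
        have "(\<integral>\<^sup>+ x. f y x \<partial>?M) \<le> C" using \<open>I y \<le> C\<close> by (simp add: I_def)
        then show "(\<integral>\<^sup>+ x. f y x \<partial>?M) \<le> (\<integral>\<^sup>+ x. facing_density \<Omega> \<nu> y x \<partial>?M)"
          using Cle[OF y] by (rule order_trans)
        have "(\<integral>\<^sup>+ x. facing_density \<Omega> \<nu> y x \<partial>?M) \<le> I y"
          unfolding I_def by (intro nn_integral_mono fle)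
        then show "(\<integral>\<^sup>+ x. facing_density \<Omega> \<nu> y x \<partial>?M) < top"
          using \<open>I y \<le> C\<close> Cfin by (meson order.strict_trans1)
      qed measurable
      then have "AE x in ?M. K x y = 0"
        unfolding f_def K_def
        by (rule AE_mp) (intro AE_I2 impI facing_density_eq_parallel[OF domain normal])
      then show "K x y = 0"
        by (rule all_boundary_if_AE[OF domain normal, rotated])
           (use \<open>x \<in> ?S\<close> in \<open>auto simp: K_def intro!: continuous_intros \<nu>c\<close>)
    qed
    note AE = this
    \<comment> \<open>So far \<open>K x y\<close> vanishes for all \<open>x\<close> but only almost
      every \<open>y\<close>. For fixed \<open>x\<close> it is continuous in \<open>y\<close>, which
      removes the second exceptional set.\<close>
    have K: "K x y = 0" if x: "x \<in> ?S" and y: "y \<in> ?S" for x y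
    proof (rule all_boundary_if_AE[OF domain normal _ _ y])
      show "continuous_on ?S (\<lambda>y. K x y)" unfolding K_def by (intro continuous_intros \<nu>c)
      show "AE y in ?M. K x y = 0" using AE by (rule AE_mp) (use x in auto)
    qed
    show "\<exists>c r. r > 0 \<and> \<Omega> = ball c r"
    proof (rule ball_if_normals_parallel[OF domain normal d])
      fix x y assume xy: "x \<in> ?S" "y \<in> ?S"
      show "\<exists>l. \<nu> x - \<nu> y = l *\<^sub>R (x - y)"
      proof (cases "x = y")
        case False
        then have n0: "(norm (x - y))\<^sup>2 \<noteq> 0" by simp
        have "(norm (x - y))\<^sup>2 *\<^sub>R (\<nu> x - \<nu> y) = ((\<nu> x - \<nu> y) \<bullet> (x - y)) *\<^sub>R (x - y)"
          using K[OF xy] by (simp add: K_def)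
        then have "(1 / (norm (x - y))\<^sup>2) *\<^sub>R (norm (x - y))\<^sup>2 *\<^sub>R (\<nu> x - \<nu> y)
            = (1 / (norm (x - y))\<^sup>2) *\<^sub>R ((\<nu> x - \<nu> y) \<bullet> (x - y)) *\<^sub>R (x - y)"
          by (simp only:)
        then have "\<nu> x - \<nu> y = (1 / (norm (x - y))\<^sup>2 * ((\<nu> x - \<nu> y) \<bullet> (x - y))) *\<^sub>R (x - y)"
          using n0 by (simp only: scaleR_scaleR) simp
        then show ?thesis by blast
      qed simp
    qed
  qed
  show ?thesis
    unfolding unit_sphere_integral_eq[OF d e] C_def[symmetric] mult.commute[of _ C]
    using inequality equality unfolding I_def f_def by blast
qed

end
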